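(* Assume the standing setup. Then $\deg(\ell^d)\neq 0$, and for every subset $F\subseteq V$ of size $d$, $$\mathrm{ord}_{[F]}(\deg(\ell^d)) = \begin{cases}-1 & \text{if } F \text{ is a facet of } \Delta,\\ 0 & \text{otherwise,}\end{cases}$$ as integers.
   Context: Standing setup. $k$ is a field, $d\ge 2$ is an integer, and $\Delta$ is a simplicial complex of dimension $d-1$ with vertex set $V=\{1,\dots,n\}$. $\Delta$ is a connected $k$-homology manifold: $\Delta$ is connected and, for every nonempty face $G$, the link of $G$ has the same homology over $k$ as a sphere of dimension $d-|G|-1$ (in particular every $(d-2)$-dimensional face lies in exactly two facets). $\Delta$ is oriented: if $\mathrm{char}\,k\neq 2$, an orientation is a choice, for each facet, of an ordering of its vertices up to even permutations, such that for every $(d-2)$-face the two orientations induced on it by the two facets containing it are opposite; a facet ordered $v_1,\dots,v_d$ induces on the face omitting $v_i$ the ordering $v_1,\dots,\widehat{v_i},\dots,v_d$ if $i-1$ is even, and the opposite orientation if $i-1$ is odd. If $\mathrm{char}\,k=2$, every such $\Delta$ is regarded as oriented. For a facet $F=\{j_1<\dots<j_d\}$, $\epsilon_F\in\{\pm1\}$ is the sign of the permutation taking $(j_1,\dots,j_d)$ to the chosen ordering ($\epsilon_F=1$ if $\mathrm{char}\,k=2$). Let $K=k(a_{i,j}:1\le i\le d,\ 1\le j\le n)$ with the $a_{i,j}$ independent indeterminates, let $K[\Delta]$ be the Stanley–Reisner ring of $\Delta$ over $K$ in variables $x_1,\dots,x_n$, and for a face $G$ write $x_G=\prod_{j\in G}x_j$.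 For a subset $F=\{j_1<\dots<j_d\}\subseteq V$ of size $d$, $[F]\in k[a_{i,j}]$ is the determinant of the $d\times d$ matrix whose $(i,m)$ entry is $a_{i,j_m}$; it is an irreducible polynomial, and $\mathrm{ord}_{[F]}:K^\times\to\mathbb Z$ is the valuation given by order of vanishing along $[F]$. Set $\theta_i=\sum_{j}a_{i,j}x_j$ and $H(\Delta)=K[\Delta]/(\theta_1,\dots,\theta_d)$, graded with pieces $H^q(\Delta)$. $H^d(\Delta)$ is one-dimensional and $\deg:H^d(\Delta)\to K$ is the $K$-linear isomorphism with $\deg(x_F)=\epsilon_F/[F]$ for every facet $F$; for an element $y$ of $H(\Delta)$ (or of $K[\Delta]$), $\deg(y)$ means $\deg$ of its degree-$d$ component (image). Let $\ell$ be the image of $x_1+\dots+x_n$ in $H(\Delta)$. *)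

theory Defs
  imports Main "HOL-Library.Poly_Mapping" "HOL-Library.Product_Lexorder"
    "HOL-Library.Multiset" "HOL-Computational_Algebra.Fraction_Field"
    "HOL-Combinatorics.Permutations"
begin

definition simplicial_complex :: "nat set set \<Rightarrow> nat set \<Rightarrow> bool" where
  "simplicial_complex \<Delta> V \<longleftrightarrow> finite V \<and> \<Delta> \<subseteq> Pow V \<and> {} \<in> \<Delta>
     \<and> (\<forall>F\<in>\<Delta>. \<forall>G. G \<subseteq> F \<longrightarrow> G \<in> \<Delta>) \<and> (\<forall>v\<in>V. {v} \<in> \<Delta>)"

(* dimension d-1: largest face has d vertices *)
definition has_dim :: "nat set set \<Rightarrow> nat \<Rightarrow> bool" where
  "has_dim \<Delta> d \<longleftrightarrow> (\<forall>F\<in>\<Delta>. card F \<le> d) \<and> (\<exists>F\<in>\<Delta>. card F = d)"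

definition facet :: "nat set set \<Rightarrow> nat set \<Rightarrow> bool" where
  "facet \<Delta> F \<longleftrightarrow> F \<in> \<Delta> \<and> (\<forall>G\<in>\<Delta>. F \<subseteq> G \<longrightarrow> G = F)"

definition link :: "nat set set \<Rightarrow> nat set \<Rightarrow> nat set set" where
  "link \<Delta> G = {H \<in> \<Delta>. H \<inter> G = {} \<and> H \<union> G \<in> \<Delta>}"

definition connected_complex :: "nat set set \<Rightarrow> nat set \<Rightarrow> bool" where
  "connected_complex \<Delta> V \<longleftrightarrow> (\<forall>u\<in>V. \<forall>v\<in>V. (\<lambda>x y. {x, y} \<in> \<Delta>)\<^sup>*\<^sup>* u v)"

definition faces_of_card :: "nat set set \<Rightarrow> nat \<Rightarrow> nat set set" where
  "faces_of_card X s = {\<sigma> \<in> X. card \<sigma> = s}"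

definition col_rank :: "'r set \<Rightarrow> 'c set \<Rightarrow> ('r \<Rightarrow> 'c \<Rightarrow> 'k::field) \<Rightarrow> nat" where
  "col_rank R C M = Max {card S | S. S \<subseteq> C \<and>
      (\<forall>c. (\<forall>r\<in>R. (\<Sum>j\<in>S. c j * M r j) = 0) \<longrightarrow> (\<forall>j\<in>S. c j = 0))}"

(* simplicial boundary coefficient [\<sigma> : \<tau>] for the oriented (vertex-sorted) chain complex *)
definition bd_entry :: "nat set \<Rightarrow> nat set \<Rightarrow> 'k::field" where
  "bd_entry \<tau> \<sigma> = (if \<tau> \<subseteq> \<sigma> \<and> card \<sigma> = card \<tau> + 1
      then (-1) ^ card {w \<in> \<sigma>. w < the_elem (\<sigma> - \<tau>)} else 0)"

(* rank of the boundary map from faces with s vertices to faces with s-1 vertices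
   (augmented complex; the empty face has 0 vertices) *)
definition bd_rank :: "'k::field itself \<Rightarrow> nat set set \<Rightarrow> nat \<Rightarrow> nat" where
  "bd_rank _ X s = (if s = 0 then 0
      else col_rank (faces_of_card X (s - 1)) (faces_of_card X s) (bd_entry :: _ \<Rightarrow> _ \<Rightarrow> 'k))"

(* dimension over k of the reduced homology H~_{s-1}(X; k) *)
definition red_betti :: "'k::field itself \<Rightarrow> nat set set \<Rightarrow> nat \<Rightarrow> nat" where
  "red_betti K X s = card (faces_of_card X s) - bd_rank K X s - bd_rank K X (Suc s)"

(* X has the reduced homology over k of a sphere of dimension m-1 *)
definition homology_sphere_like :: "'k::field itself \<Rightarrow> nat set set \<Rightarrow> nat \<Rightarrow> bool" where
  "homology_sphere_like K X m \<longleftrightarrow> (\<forall>s. red_betti K X s = (if s = m then 1 else 0))"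

definition homology_manifold :: "'k::field itself \<Rightarrow> nat set set \<Rightarrow> nat set \<Rightarrow> nat \<Rightarrow> bool" where
  "homology_manifold K \<Delta> V d \<longleftrightarrow> simplicial_complex \<Delta> V \<and> has_dim \<Delta> d
     \<and> connected_complex \<Delta> V
     \<and> (\<forall>G\<in>\<Delta>. G \<noteq> {} \<longrightarrow> homology_sphere_like K (link \<Delta> G) (d - card G))"

definition inv_sign :: "nat list \<Rightarrow> int" where
  "inv_sign L = (-1) ^ card {(p, q). p < q \<and> q < length L \<and> L ! p > L ! q}"

(* sign of the orientation induced on F - {v} by the ordered facet L *)
definition induced_sign :: "nat list \<Rightarrow> nat \<Rightarrow> int" where
  "induced_sign L v = (-1) ^ length (takeWhile (\<lambda>x. x \<noteq> v) L) * inv_sign (removeAll v L)"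

definition oriented :: "nat set set \<Rightarrow> nat \<Rightarrow> (nat set \<Rightarrow> nat list) \<Rightarrow> bool" where
  "oriented \<Delta> d ori \<longleftrightarrow>
     (\<forall>F. facet \<Delta> F \<longrightarrow> distinct (ori F) \<and> set (ori F) = F) \<and>
     (\<forall>G\<in>\<Delta>. \<forall>F1 F2. card G = d - 1 \<and> facet \<Delta> F1 \<and> facet \<Delta> F2 \<and> F1 \<noteq> F2
        \<and> G \<subseteq> F1 \<and> G \<subseteq> F2 \<longrightarrow>
        induced_sign (ori F1) (the_elem (F1 - G)) = - induced_sign (ori F2) (the_elem (F2 - G)))"

definition epsilon :: "'k::field itself \<Rightarrow> (nat set \<Rightarrow> nat list) \<Rightarrow> nat set \<Rightarrow> 'k" where
  "epsilon _ ori F = (if CHAR('k) = 2 then 1 else of_int (inv_sign (ori F)))"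

type_synonym 'k mpoly = "((nat \<times> nat) \<Rightarrow>\<^sub>0 nat) \<Rightarrow>\<^sub>0 'k"
type_synonym 'k ratfun = "'k mpoly fract"

definition avar :: "nat \<Rightarrow> nat \<Rightarrow> 'k::field mpoly" where
  "avar i j = Poly_Mapping.single (Poly_Mapping.single (i, j) 1) 1"

definition aK :: "nat \<Rightarrow> nat \<Rightarrow> 'k::field ratfun" where
  "aK i j = Fract (avar i j) 1"

(* [F] = det (a_{i, j_m})_{i,m}, F = {j_1 < ... < j_d} *)
definition bracket :: "nat \<Rightarrow> nat set \<Rightarrow> 'k::field mpoly" where
  "bracket d F = (\<Sum>p | p permutes {1..d}. of_int (sign p) *
       (\<Prod>i\<in>{1..d}. avar i (sorted_list_of_set F ! (p i - 1))))"

definition ord :: "'k::field mpoly \<Rightarrow> 'k ratfun \<Rightarrow> int" where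
  "ord P x = (THE z. \<exists>g h. g \<noteq> 0 \<and> h \<noteq> 0 \<and> \<not> P dvd g \<and> \<not> P dvd h
                 \<and> x = Fract g h * Fract P 1 powi z)"

(* Degree-d monomials of K[x_1..x_n] are multisets of size d over {1..n}; those whose
   support is a face form a basis of K[\<Delta>]_d.  A K-linear functional on K[\<Delta>]_d is given
   by its values D on these monomials (D := 0 on monomials vanishing in K[\<Delta>]).
   It factors through H^d(\<Delta>) iff it kills \<theta>_i * m for every monomial m of degree d-1. *)
definition is_deg_functional :: "nat set set \<Rightarrow> nat \<Rightarrow> nat \<Rightarrow> (nat set \<Rightarrow> nat list)
     \<Rightarrow> (nat multiset \<Rightarrow> 'k::field ratfun) \<Rightarrow> bool" where
  "is_deg_functional \<Delta> n d ori D \<longleftrightarrow>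
     (\<forall>\<mu>. \<not> (size \<mu> = d \<and> set_mset \<mu> \<subseteq> {1..n} \<and> set_mset \<mu> \<in> \<Delta>) \<longrightarrow> D \<mu> = 0) \<and>
     (\<forall>i\<in>{1..d}. \<forall>m. size m = d - 1 \<and> set_mset m \<subseteq> {1..n} \<longrightarrow>
        (\<Sum>j\<in>{1..n}. aK i j * D (m + {#j#})) = 0) \<and>
     (\<forall>F. facet \<Delta> F \<longrightarrow>
        D (mset_set F) = Fract (Poly_Mapping.single 0 (epsilon TYPE('k) ori F)) 1 / Fract (bracket d F) 1)"

definition deg_fun :: "nat set set \<Rightarrow> nat \<Rightarrow> nat \<Rightarrow> (nat set \<Rightarrow> nat list)
     \<Rightarrow> nat multiset \<Rightarrow> 'k::field ratfun" where
  "deg_fun \<Delta> n d ori = (THE D. is_deg_functional \<Delta> n d ori D)"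

(* deg(\<ell>^d), \<ell> = x_1 + ... + x_n, expanding \<ell>^d = \<Sum>_{(j_1..j_d)} x_{j_1} ... x_{j_d} *)
definition deg_ell_pow :: "'k::field itself \<Rightarrow> nat set set \<Rightarrow> nat \<Rightarrow> nat \<Rightarrow> (nat set \<Rightarrow> nat list)
     \<Rightarrow> 'k ratfun" where
  "deg_ell_pow _ \<Delta> n d ori =
     (\<Sum>js \<in> {js. length js = d \<and> set js \<subseteq> {1..n}}. (deg_fun \<Delta> n d ori :: _ \<Rightarrow> 'k ratfun) (mset js))"

end

theory Submission
  imports "Jordan_Normal_Form.Determinant" Defs
begin

text \<open>
  Let \<open>v\<close> be one more generic column. For a facet \<open>G\<close> and \<open>j \<in> G\<close> let \<open>[G, j]\<close> denote \<open>[G]\<close> with column \<open>j\<close>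
  replaced by \<open>v\<close>. By Cramer's rule, evaluating a polynomial \<open>m\<close> of degree \<open>d\<close> at \<open>x\<^sub>j = [G, j] / [G]\<close> and
  summing \<open>\<epsilon>\<^sub>G m / ([G] \<Prod>\<^sub>j x\<^sub>j)\<close> over the facets gives a functional that kills the ideal of the
  \<open>\<theta>\<^sub>i\<close>, provided that the same sum vanishes when \<open>m\<close> has degree \<open>d - 1\<close>. That sum is a rational function of \<open>v\<close>
  of negative degree with at most simple poles along the hyperplanes spanned by the walls, and at each wall
  the residues of the two adjacent facets cancel by the orientation. Hence
  \<open>deg(\<ell>\<^sup>d) = \<Sum>\<^sub>G \<epsilon>\<^sub>G (\<Sum>\<^sub>j [G, j])\<^sup>d / ([G] \<Prod>\<^sub>j [G, j])\<close>. Since \<open>[F]\<close> is prime, a facet \<open>F\<close>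
  contributes a simple pole along \<open>[F]\<close> and no other facet does.

  If \<open>F\<close> is not a facet, there is no pole along \<open>[F]\<close>, and it must be shown that the restriction to \<open>[F] = 0\<close>
  does not vanish. For this the columns are degenerated along a one-parameter family inside \<open>[F] = 0\<close> for which
  one facet has a pole of strictly larger order than all others. A facet meeting \<open>F\<close> in at most \<open>d - 2\<close> vertices
  can be made dependent on its own, with a simple pole. For a facet \<open>F - i + w\<close> one moves some \<open>f \<in> F - i\<close>
  into the span of \<open>F - f - i\<close> and \<open>w\<close> into the span of \<open>F - f\<close>; it then has a triple pole, while the other
  facets have poles of order at most two.
\<close>

subsection \<open>Evaluation of polynomials\<close>

definition mon_eval :: "(nat \<times> nat \<Rightarrow> 'r::comm_ring_1) \<Rightarrow> (nat \<times> nat \<Rightarrow>\<^sub>0 nat) \<Rightarrow> 'r" where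
  "mon_eval \<sigma> m = (\<Prod>x\<in>Poly_Mapping.keys m. \<sigma> x ^ Poly_Mapping.lookup m x)"

definition mpoly_eval ::
    "('k::field \<Rightarrow> 'r::comm_ring_1) \<Rightarrow> (nat \<times> nat \<Rightarrow> 'r) \<Rightarrow> 'k mpoly \<Rightarrow> 'r" where
  "mpoly_eval f \<sigma> p =
     (\<Sum>m\<in>Poly_Mapping.keys p. f (Poly_Mapping.lookup p m) * mon_eval \<sigma> m)"

lemma mon_eval_superset:
  assumes "finite S" "Poly_Mapping.keys m \<subseteq> S"
  shows "mon_eval \<sigma> m = (\<Prod>x\<in>S. \<sigma> x ^ Poly_Mapping.lookup m x)"
  unfolding mon_eval_def
  by (rule prod.mono_neutral_left) (use assms in \<open>auto simp: in_keys_iff\<close>)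

lemma mon_eval_add: "mon_eval \<sigma> (m + m') = mon_eval \<sigma> m * mon_eval \<sigma> m'"
proof -
  let ?S = "Poly_Mapping.keys m \<union> Poly_Mapping.keys m'"
  have "mon_eval \<sigma> (m + m') = (\<Prod>x\<in>?S. \<sigma> x ^ Poly_Mapping.lookup (m + m') x)"
    by (rule mon_eval_superset) (auto simp: Poly_Mapping.keys_add)
  also have "\<dots> = (\<Prod>x\<in>?S. \<sigma> x ^ Poly_Mapping.lookup m x) * (\<Prod>x\<in>?S. \<sigma> x ^ Poly_Mapping.lookup m' x)"
    by (simp add: Poly_Mapping.lookup_add power_add prod.distrib)
  also have "\<dots> = mon_eval \<sigma> m * mon_eval \<sigma> m'"
    by (subst (1 2) mon_eval_superset[of ?S]) auto
  finally show ?thesis .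
qed

lemma mon_eval_0 [simp]: "mon_eval \<sigma> 0 = 1"
  by (simp add: mon_eval_def)

lemma mpoly_as_sum:
  "(p :: 'k::field mpoly) = (\<Sum>m\<in>Poly_Mapping.keys p. Poly_Mapping.single m (Poly_Mapping.lookup p m))"
  by (rule poly_mapping_eqI)
     (auto simp: lookup_sum Poly_Mapping.lookup_single when_def sum.delta in_keys_iff)

context
  fixes f :: "'k::field \<Rightarrow> 'r::comm_ring_1"
  assumes f: "comm_ring_hom f"
begin

interpretation f: comm_ring_hom f by (rule f)

lemma mpoly_eval_superset:
  assumes "finite S" "Poly_Mapping.keys p \<subseteq> S"
  shows "mpoly_eval f \<sigma> p = (\<Sum>m\<in>S. f (Poly_Mapping.lookup p m) * mon_eval \<sigma> m)"
  unfolding mpoly_eval_def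
  by (rule sum.mono_neutral_left) (use assms in \<open>auto simp: in_keys_iff\<close>)

lemma mpoly_eval_add: "mpoly_eval f \<sigma> (p + q) = mpoly_eval f \<sigma> p + mpoly_eval f \<sigma> q"
proof -
  let ?S = "Poly_Mapping.keys p \<union> Poly_Mapping.keys q"
  have "mpoly_eval f \<sigma> (p + q) = (\<Sum>m\<in>?S. f (Poly_Mapping.lookup (p + q) m) * mon_eval \<sigma> m)"
    by (rule mpoly_eval_superset) (auto simp: Poly_Mapping.keys_add)
  also have "\<dots> = (\<Sum>m\<in>?S. f (Poly_Mapping.lookup p m) * mon_eval \<sigma> m)
      + (\<Sum>m\<in>?S. f (Poly_Mapping.lookup q m) * mon_eval \<sigma> m)"
    by (simp add: Poly_Mapping.lookup_add f.hom_add algebra_simps sum.distrib)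
  also have "\<dots> = mpoly_eval f \<sigma> p + mpoly_eval f \<sigma> q"
    by (subst (1 2) mpoly_eval_superset[of ?S]) auto
  finally show ?thesis .
qed

lemma mpoly_eval_single: "mpoly_eval f \<sigma> (Poly_Mapping.single m c) = f c * mon_eval \<sigma> m"
  by (simp add: mpoly_eval_def)

lemma mpoly_eval_0: "mpoly_eval f \<sigma> 0 = 0"
  by (simp add: mpoly_eval_def)

lemma mpoly_eval_sum: "mpoly_eval f \<sigma> (sum g A) = (\<Sum>a\<in>A. mpoly_eval f \<sigma> (g a))"
  by (induction A rule: infinite_finite_induct) (auto simp: mpoly_eval_add mpoly_eval_0)

lemma mpoly_eval_mult: "mpoly_eval f \<sigma> (p * q) = mpoly_eval f \<sigma> p * mpoly_eval f \<sigma> q"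
proof -
  let ?s = "Poly_Mapping.single" and ?l = "Poly_Mapping.lookup" and ?k = "Poly_Mapping.keys"
  have "p * q = (\<Sum>m\<in>?k p. ?s m (?l p m)) * (\<Sum>m\<in>?k q. ?s m (?l q m))"
    by (subst (1) mpoly_as_sum[of p], subst (1) mpoly_as_sum[of q]) rule
  also have "\<dots> = (\<Sum>m\<in>?k p. \<Sum>m'\<in>?k q. ?s (m + m') (?l p m * ?l q m'))"
    by (simp add: sum_product Poly_Mapping.mult_single)
  finally have "mpoly_eval f \<sigma> (p * q) =
      (\<Sum>m\<in>?k p. \<Sum>m'\<in>?k q. f (?l p m) * mon_eval \<sigma> m * (f (?l q m') * mon_eval \<sigma> m'))"
    by (simp add: mpoly_eval_sum mpoly_eval_single mon_eval_add f.hom_mult mult_ac)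
  then show ?thesis
    by (simp add: mpoly_eval_def sum_product)
qed

lemma comm_ring_hom_mpoly_eval: "comm_ring_hom (mpoly_eval f \<sigma>)"
proof
  show "mpoly_eval f \<sigma> 1 = 1"
    using mpoly_eval_single[of \<sigma> 0 1] by simp
qed (auto simp: mpoly_eval_add mpoly_eval_mult mpoly_eval_0)

lemma mpoly_eval_avar [simp]: "mpoly_eval f \<sigma> (avar i j) = \<sigma> (i, j)"
  by (simp add: avar_def mpoly_eval_single mon_eval_def)

lemma mpoly_eval_const [simp]: "mpoly_eval f \<sigma> (Poly_Mapping.single 0 c) = f c"
  by (simp add: mpoly_eval_single)

end

text \<open>Serves to recognise left inverses: by \<open>mpoly_eval_comp\<close>, a substitution
  that is later undone amounts to evaluation at the variables themselves.\<close>

lemma mpoly_expand: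
  "mpoly_eval (Poly_Mapping.single 0) (\<lambda>(i, j). avar i j) p = (p :: 'k::field mpoly)"
proof -
  have hom: "comm_ring_hom (Poly_Mapping.single 0 :: 'k \<Rightarrow> 'k mpoly)"
    by unfold_locales (auto simp: Poly_Mapping.single_add Poly_Mapping.mult_single)
  have pw: "(avar i j :: 'k mpoly) ^ k = Poly_Mapping.single (Poly_Mapping.single (i, j) k) 1" for i j k
    by (induction k) (auto simp: avar_def Poly_Mapping.mult_single simp flip: Poly_Mapping.single_add)
  have "mon_eval (\<lambda>(i, j). avar i j) m = (Poly_Mapping.single m 1 :: 'k mpoly)" for m
  proof -
    have *: "(\<Prod>x\<in>A. Poly_Mapping.single (Poly_Mapping.single x (l x)) 1)
        = (Poly_Mapping.single (\<Sum>x\<in>A. Poly_Mapping.single x (l x)) 1 :: 'k mpoly)"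
      for A and l :: "nat \<times> nat \<Rightarrow> nat"
      by (induction A rule: infinite_finite_induct) (auto simp: Poly_Mapping.mult_single)
    have "(\<Sum>x\<in>Poly_Mapping.keys m. Poly_Mapping.single x (Poly_Mapping.lookup m x)) = m"
      by (rule poly_mapping_eqI)
         (auto simp: lookup_sum Poly_Mapping.lookup_single when_def sum.delta in_keys_iff)
    then show ?thesis
      using *[of "Poly_Mapping.lookup m" "Poly_Mapping.keys m"]
      by (simp add: mon_eval_def case_prod_beta pw)
  qed
  then show ?thesis
    by (simp add: mpoly_eval_def Poly_Mapping.mult_single mpoly_as_sum[symmetric])
qed

lemma mpoly_eval_comp:
  fixes f :: "'k::field \<Rightarrow> 'r::comm_ring_1" and h :: "'r \<Rightarrow> 's::comm_ring_1"
  assumes "comm_ring_hom h"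
  shows "h (mpoly_eval f \<sigma> p) = mpoly_eval (h \<circ> f) (h \<circ> \<sigma>) p"
proof -
  interpret comm_ring_hom h by fact
  show ?thesis
    by (simp add: mpoly_eval_def mon_eval_def hom_sum hom_mult hom_prod hom_power)
qed

subsection \<open>Determinants of lists of columns\<close>

text \<open>Columns are addressed by the labels in a list, so that replacing, repeating or dropping
  a column becomes a list operation; rows are counted from 0.\<close>

definition det_cols :: "(nat \<Rightarrow> nat \<Rightarrow> 'r::comm_ring_1) \<Rightarrow> nat list \<Rightarrow> 'r" where
  "det_cols A L = det (mat (length L) (length L) (\<lambda>(i, j). A i (L ! j)))"

definition front_minor :: "(nat \<Rightarrow> nat \<Rightarrow> 'r::comm_ring_1) \<Rightarrow> nat list \<Rightarrow> nat \<Rightarrow> 'r" where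
  "front_minor A M i = (-1) ^ i *
     det (mat (length M) (length M) (\<lambda>(r, c). A (if r < i then r else Suc r) (M ! c)))"

text \<open>The determinant whose first column is the free vector \<open>v\<close>, followed by the
  columns \<open>M\<close>. Taking the Laplace expansion as the definition makes it linear in
  \<open>v\<close>, and \<open>v\<close> need not be a column of \<open>A\<close>.\<close>

definition det_front :: "(nat \<Rightarrow> nat \<Rightarrow> 'r::comm_ring_1) \<Rightarrow> nat list \<Rightarrow> (nat \<Rightarrow> 'r) \<Rightarrow> 'r" where
  "det_front A M v = (\<Sum>i\<le>length M. v i * front_minor A M i)"

definition list_del :: "nat \<Rightarrow> 'a list \<Rightarrow> 'a list" where
  "list_del k L = take k L @ drop (Suc k) L"

lemma length_list_del [simp]: "k < length L \<Longrightarrow> length (list_del k L) = length L - 1"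
  by (simp add: list_del_def)

lemma nth_list_del:
  "k < length L \<Longrightarrow> c < length L - 1 \<Longrightarrow> list_del k L ! c = L ! (if c < k then c else Suc c)"
  by (auto simp: list_del_def nth_append min_def)

lemma list_del_update [simp]: "list_del k (L[k := x]) = list_del k L"
  by (simp add: list_del_def)

lemma atMost_length_list_del: "k < length L \<Longrightarrow> {..length (list_del k L)} = {..<length L}"
  by auto

lemma det_cols_cong:
  assumes "\<And>i x. i < length L \<Longrightarrow> x \<in> set L \<Longrightarrow> A i x = B i x"
  shows "det_cols A L = det_cols B L"
  unfolding det_cols_def by (intro arg_cong[of _ _ det] eq_matI) (use assms in auto)

lemma det_cols_hom:
  assumes "comm_ring_hom h"
  shows "h (det_cols A L) = det_cols (\<lambda>i j. h (A i j)) L"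
proof -
  interpret comm_ring_hom h by fact
  show ?thesis
    unfolding det_cols_def hom_det[symmetric] by (intro arg_cong[of _ _ det] eq_matI) auto
qed

text \<open>In the expansion along column \<open>k\<close> the cofactor sign (-1)^(i+k) splits into
  the (-1)^i kept in \<open>front_minor\<close> and the (-1)^k for moving the column to the
  front.\<close>

lemma det_cols_laplace:
  assumes "k < length L"
  shows "det_cols A L = (-1) ^ k * det_front A (list_del k L) (\<lambda>i. A i (L ! k))"
proof -
  let ?A = "mat (length L) (length L) (\<lambda>(i, j). A i (L ! j))"
  have cof: "cofactor ?A i k = (-1) ^ k * front_minor A (list_del k L) i" if "i < length L" for i
  proof -
    have "mat_delete ?A i k = mat (length (list_del k L)) (length (list_del k L))
        (\<lambda>(r, c). A (if r < i then r else Suc r) (list_del k L ! c))"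
      using that assms by (intro eq_matI) (auto simp: mat_delete_def nth_list_del)
    then show ?thesis
      by (simp add: cofactor_def front_minor_def power_add)
  qed
  have "det_cols A L = (\<Sum>i<length L. ?A $$ (i, k) * cofactor ?A i k)"
    unfolding det_cols_def using assms by (intro laplace_expansion_column) auto
  also have "\<dots> = (\<Sum>i<length L. A i (L ! k) * ((-1) ^ k * front_minor A (list_del k L) i))"
    using assms cof by (intro sum.cong) auto
  also have "\<dots> = (-1) ^ k * det_front A (list_del k L) (\<lambda>i. A i (L ! k))"
    using assms by (simp add: det_front_def atMost_length_list_del sum_distrib_left mult_ac
        del: length_list_del)
  finally show ?thesis .
qed

lemma det_cols_update:
  "k < length L \<Longrightarrow>
    det_cols A (L[k := x]) = (-1) ^ k * det_front A (list_del k L) (\<lambda>i. A i x)"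
  using det_cols_laplace[of k "L[k := x]" A] by simp

lemma det_front_cong:
  assumes "\<And>i x. i \<le> length M \<Longrightarrow> x \<in> set M \<Longrightarrow> A i x = B i x"
    and "\<And>i. i \<le> length M \<Longrightarrow> v i = w i"
  shows "det_front A M v = det_front B M w"
proof -
  have "front_minor A M i = front_minor B M i" for i
    unfolding front_minor_def
    by (intro arg_cong2[of _ _ _ _ "(*)"] arg_cong[of _ _ det] eq_matI) (use assms in auto)
  then show ?thesis
    using assms by (simp add: det_front_def less_Suc_eq_le)
qed

lemma det_front_sum:
  assumes "\<And>i. i \<le> length M \<Longrightarrow> v i = (\<Sum>s\<in>S. c s * w s i)"
  shows "det_front A M v = (\<Sum>s\<in>S. c s * det_front A M (w s))"
proof -
  have "det_front A M v = (\<Sum>i\<le>length M. \<Sum>s\<in>S. c s * (w s i * front_minor A M i))"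
    unfolding det_front_def
    by (intro sum.cong refl) (use assms in \<open>auto simp: sum_distrib_left mult_ac\<close>)
  also have "\<dots> = (\<Sum>s\<in>S. c s * det_front A M (w s))"
    by (subst sum.swap) (simp add: det_front_def sum_distrib_left)
  finally show ?thesis .
qed

lemma det_front_add_smult:
  "det_front A M (\<lambda>i. v i + c * w i) = det_front A M v + c * det_front A M w"
  by (simp add: det_front_def algebra_simps sum.distrib sum_distrib_left)

lemma det_cols_not_distinct:
  assumes "\<not> distinct L"
  shows "det_cols A L = 0"
proof -
  obtain i j where "i < length L" "j < length L" "i \<noteq> j" "L ! i = L ! j"
    using assms by (auto simp: distinct_conv_nth)
  then show ?thesis
    unfolding det_cols_def
    by (intro det_identical_columns[of _ "length L" i j]) (auto intro!: eq_vecI)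
qed

text \<open>Linearity in column \<open>k\<close>, in the form the degenerations need: that column of
  \<open>A\<close> is a combination of columns of a second matrix \<open>B\<close>, and the
  remaining columns of the two matrices coincide.\<close>

lemma det_cols_expand:
  assumes "k < length L" and S: "\<And>i. i < length L \<Longrightarrow> A i (L ! k) = (\<Sum>s\<in>S. c s * B i s)"
    and AB: "\<And>i j. i < length L \<Longrightarrow> j < length L \<Longrightarrow> j \<noteq> k \<Longrightarrow> A i (L ! j) = B i (L ! j)"
  shows "det_cols A L = (\<Sum>s\<in>S. c s * det_cols B (L[k := s]))"
proof -
  have len: "Suc (length (list_del k L)) = length L"
    using assms(1) by simp
  have mem: "\<exists>j<length L. j \<noteq> k \<and> x = L ! j" if "x \<in> set (list_del k L)" for x
  proof -
    from that obtain c where c: "c < length L - 1" "x = list_del k L ! c"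
      using assms(1) by (auto simp: in_set_conv_nth)
    then show ?thesis
      using assms(1) by (intro exI[of _ "if c < k then c else Suc c"]) (auto simp: nth_list_del)
  qed
  have "det_front A (list_del k L) (\<lambda>i. A i (L ! k))
      = (\<Sum>s\<in>S. c s * det_front A (list_del k L) (\<lambda>i. B i s))"
    using S len by (intro det_front_sum) (auto simp: less_Suc_eq_le[symmetric] simp del: length_list_del)
  moreover have "det_front A (list_del k L) (\<lambda>i. B i s) = det_front B (list_del k L) (\<lambda>i. B i s)" for s
    using AB mem len
    by (intro det_front_cong) (fastforce simp: less_Suc_eq_le[symmetric] simp del: length_list_del)+
  ultimately show ?thesis
    using assms(1) by (simp add: det_cols_laplace det_cols_update sum_distrib_left mult_ac)
qed

lemma det_cols_zero_column:
  assumes "x \<in> set L" "\<And>i. i < length L \<Longrightarrow> A i x = 0"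
  shows "det_cols A L = 0"
proof -
  obtain k where "k < length L" "L ! k = x"
    using assms(1) by (auto simp: in_set_conv_nth)
  then show ?thesis
    using det_cols_expand[of k L A "\<lambda>_. 0" A "{}"] assms(2) by simp
qed

lemma det_cols_diag:
  assumes "\<And>i j. i < length L \<Longrightarrow> j < length L \<Longrightarrow> A i (L ! j) = (if i = j then s j else 0)"
  shows "det_cols A L = (\<Prod>j<length L. s j)"
proof -
  let ?A = "mat (length L) (length L) (\<lambda>(i, j). A i (L ! j))"
  have "det_cols A L = prod_list (diag_mat ?A)"
    unfolding det_cols_def
    by (intro det_upper_triangular[of _ "length L"]) (auto simp: upper_triangular_def assms)
  also have "\<dots> = (\<Prod>j<length L. ?A $$ (j, j))"
    by (simp add: diag_mat_def prod.distinct_set_conv_list[symmetric] lessThan_atLeast0 del: upt_Suc)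
  finally show ?thesis
    by (simp add: assms)
qed

text \<open>By linearity each column \<open>j\<close> is inserted at place \<open>k\<close>, and for
  \<open>j \<noteq> k\<close> it then occurs twice.\<close>

lemma cramer_coeff:
  assumes "k < length L" and v: "\<And>i. i < length L \<Longrightarrow> v i = (\<Sum>j<length L. c j * A i (L ! j))"
  shows "(-1) ^ k * det_front A (list_del k L) v = c k * det_cols A L"
proof -
  have len: "Suc (length (list_del k L)) = length L"
    using assms(1) by simp
  have "(-1) ^ k * det_front A (list_del k L) v =
      (\<Sum>j<length L. c j * ((-1) ^ k * det_front A (list_del k L) (\<lambda>i. A i (L ! j))))"
    using v len
    by (subst det_front_sum[where S = "{..<length L}" and c = c and w = "\<lambda>j i. A i (L ! j)"])
       (auto simp: less_Suc_eq_le[symmetric] sum_distrib_left mult_ac simp del: length_list_del)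
  also have "\<dots> = (\<Sum>j<length L. c j * det_cols A (L[k := L ! j]))"
    using assms(1) by (simp add: det_cols_update)
  also have "\<dots> = (\<Sum>j<length L. if j = k then c k * det_cols A L else 0)"
  proof (intro sum.cong refl)
    fix j assume j: "j \<in> {..<length L}"
    have "\<not> distinct (L[k := L ! j])" if "j \<noteq> k"
      using that j assms(1) unfolding distinct_conv_nth
      by (metis length_list_update lessThan_iff nth_list_update_eq nth_list_update_neq)
    then show "c j * det_cols A (L[k := L ! j]) = (if j = k then c k * det_cols A L else 0)"
      by (auto simp: det_cols_not_distinct)
  qed
  finally show ?thesis
    using assms(1) by simp
qed

text \<open>Row \<open>i\<close> of the product of the matrix with its adjugate, applied to
  \<open>v\<close>; the determinant is not inverted.\<close>

lemma cramer_solution: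
  assumes "i < length L"
  shows "(\<Sum>j<length L. A i (L ! j) * ((-1) ^ j * det_front A (list_del j L) v)) = det_cols A L * v i"
proof -
  let ?n = "length L"
  let ?A = "mat ?n ?n (\<lambda>(i, j). A i (L ! j))"
  have A: "?A \<in> carrier_mat ?n ?n" by simp
  have cof: "cofactor ?A r k = (-1) ^ k * front_minor A (list_del k L) r" if "r < ?n" "k < ?n" for r k
  proof -
    have "mat_delete ?A r k = mat (length (list_del k L)) (length (list_del k L))
        (\<lambda>(r', c). A (if r' < r then r' else Suc r') (list_del k L ! c))"
      using that by (intro eq_matI) (auto simp: mat_delete_def nth_list_del)
    then show ?thesis
      by (simp add: cofactor_def front_minor_def power_add)
  qed
  have adj: "(\<Sum>j<?n. A i (L ! j) * cofactor ?A r j) = (if i = r then det_cols A L else 0)"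
    if "r < ?n" for r
  proof -
    have "(?A * adj_mat ?A) $$ (i, r) = (\<Sum>j<?n. A i (L ! j) * cofactor ?A r j)"
      using that assms by (auto simp: adj_mat_def times_mat_def scalar_prod_def lessThan_atLeast0)
    moreover have "(?A * adj_mat ?A) $$ (i, r) = (if i = r then det_cols A L else 0)"
      unfolding adj_mat(2)[OF A] using that assms by (simp add: det_cols_def)
    ultimately show ?thesis by simp
  qed
  have "(\<Sum>j<?n. A i (L ! j) * ((-1) ^ j * det_front A (list_del j L) v))
      = (\<Sum>j<?n. \<Sum>r<?n. v r * (A i (L ! j) * cofactor ?A r j))"
    by (intro sum.cong refl)
       (auto simp: det_front_def atMost_length_list_del cof sum_distrib_left mult_ac
         simp del: length_list_del intro!: sum.cong)
  also have "\<dots> = (\<Sum>r<?n. v r * (\<Sum>j<?n. A i (L ! j) * cofactor ?A r j))"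
    by (subst sum.swap) (simp add: sum_distrib_left)
  also have "\<dots> = (\<Sum>r<?n. if r = i then det_cols A L * v i else 0)"
    by (intro sum.cong refl) (auto simp: adj)
  finally show ?thesis
    using assms by simp
qed

abbreviation gen_mat :: "nat \<Rightarrow> nat \<Rightarrow> 'k::field mpoly" where
  "gen_mat i j \<equiv> avar (Suc i) j"

text \<open>\<open>bracket\<close> permutes \<open>{1..d}\<close> while \<open>det\<close> permutes
  \<open>{0..<d}\<close>; transporting permutations along \<open>Suc\<close> preserves signs and
  matches the two sums.\<close>

lemma bracket_eq_det_cols:
  assumes "finite F" "card F = d"
  shows "(bracket d F :: 'k::field mpoly) = det_cols gen_mat (sorted_list_of_set F)"
proof -
  let ?L = "sorted_list_of_set F"
  have len: "length ?L = d" using assms by simp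
  have bij: "bij_betw Suc {0..<d} {1..d}"
    by (auto simp: bij_betw_def image_Suc_atLeastLessThan atLeastLessThanSuc_atLeastAtMost)
  let ?m = "map_permutation {0..<d} Suc"
  have bij2: "bij_betw ?m {p. p permutes {0..<d}} {p. p permutes {1..d}}"
  proof (rule bij_betw_byWitness[where f' = "map_permutation {1..d} (\<lambda>x. x - 1)"])
    have bij': "bij_betw (\<lambda>x. x - 1) {1..d} {0..<d}"
      by (rule bij_betw_byWitness[of _ Suc]) auto
    show "\<forall>p\<in>{p. p permutes {0..<d}}. map_permutation {1..d} (\<lambda>x. x - 1) (?m p) = p"
      using bij by (auto intro!: map_permutation_compose_inv)
    show "\<forall>p\<in>{p. p permutes {1..d}}. ?m (map_permutation {1..d} (\<lambda>x. x - 1) p) = p"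
      using bij' by (auto intro!: map_permutation_compose_inv)
    show "?m ` {p. p permutes {0..<d}} \<subseteq> {p. p permutes {1..d}}"
      using bij by (auto intro: map_permutation_permutes)
    show "map_permutation {1..d} (\<lambda>x. x - 1) ` {p. p permutes {1..d}} \<subseteq> {p. p permutes {0..<d}}"
      using bij' by (auto intro: map_permutation_permutes)
  qed
  have "(bracket d F :: 'k mpoly) = (\<Sum>p | p permutes {0..<d}. of_int (sign (?m p)) *
      (\<Prod>i\<in>{1..d}. avar i (?L ! (?m p i - 1))))"
    unfolding bracket_def by (rule sum.reindex_bij_betw[OF bij2, symmetric])
  also have "\<dots> = (\<Sum>p | p permutes {0..<d}. of_int (sign p) *
      (\<Prod>i\<in>{0..<d}. avar (Suc i) (?L ! p i)))"
  proof (rule sum.cong)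
    fix p assume p: "p \<in> {p. p permutes {0..<d}}"
    have "sign (?m p) = sign p"
      using p by (intro sign_map_permutation) auto
    moreover have "(\<Prod>i\<in>{1..d}. avar i (?L ! (?m p i - 1))) =
        (\<Prod>i\<in>{0..<d}. avar (Suc i) (?L ! (?m p (Suc i) - 1)) :: 'k mpoly)"
      by (rule prod.reindex_bij_betw[OF bij, symmetric])
    moreover have "\<dots> = (\<Prod>i\<in>{0..<d}. avar (Suc i) (?L ! p i))"
      by (intro prod.cong) (auto simp: map_permutation_apply)
    ultimately show "of_int (sign (?m p)) * (\<Prod>i\<in>{1..d}. avar i (?L ! (?m p i - 1))) =
        (of_int (sign p) * (\<Prod>i\<in>{0..<d}. avar (Suc i) (?L ! p i)) :: 'k mpoly)"
      by simp
  qed simp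
  also have "\<dots> = det_cols gen_mat ?L"
    unfolding det_cols_def len by (subst det_def'[of _ d])
      (auto intro!: sum.cong prod.cong dest: permutes_in_image)
  finally show ?thesis .
qed

subsection \<open>Primality of generic determinants\<close>

lemma comm_ring_hom_id: "comm_ring_hom (\<lambda>x. x)"
  by unfold_locales auto

lemma comm_ring_hom_const_mpoly: "comm_ring_hom (Poly_Mapping.single 0 :: 'k::field \<Rightarrow> 'k mpoly)"
  by unfold_locales (auto simp: Poly_Mapping.single_add Poly_Mapping.mult_single)

lemma comm_ring_hom_const_poly: "comm_ring_hom (\<lambda>x::'a::comm_ring_1. [:x:])"
  by unfold_locales (auto simp: one_pCons)

lemma comm_ring_hom_comp:
  assumes "comm_ring_hom g" "comm_ring_hom h"
  shows "comm_ring_hom (\<lambda>x. g (h x))"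
proof -
  interpret g: comm_ring_hom g by fact
  interpret h: comm_ring_hom h by fact
  show ?thesis
    by unfold_locales (auto simp: g.hom_add h.hom_add g.hom_mult h.hom_mult)
qed

lemma comm_ring_hom_poly_eval: "comm_ring_hom (\<lambda>p. poly p (x::'a::comm_ring_1))"
  by unfold_locales auto

lemma mpoly_eval_det_cols:
  assumes "comm_ring_hom f"
  shows "mpoly_eval f \<sigma> (det_cols gen_mat L) = det_cols (\<lambda>i j. \<sigma> (Suc i, j)) L"
  by (subst det_cols_hom[OF comm_ring_hom_mpoly_eval[OF assms]]) (simp add: assms)

text \<open>For distinct \<open>L\<close> this is a 0/1 point at which the labels in
  \<open>L\<close> become the standard basis in order and every other label becomes the zero column.
  Evaluation there tells determinants with different column sets apart.\<close>

definition unit_cols :: "nat list \<Rightarrow> nat \<Rightarrow> nat \<Rightarrow> 'r::comm_ring_1" where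
  "unit_cols L i j = (if i < length L \<and> L ! i = j then 1 else 0)"

lemma det_cols_unit_cols: "distinct L \<Longrightarrow> det_cols (unit_cols L) L = 1"
  by (subst det_cols_diag[where s = "\<lambda>_. 1"]) (auto simp: unit_cols_def nth_eq_iff_index_eq)

lemma det_cols_gen_mat_nonzero:
  assumes "distinct L"
  shows "det_cols gen_mat L \<noteq> (0 :: 'k::field mpoly)"
proof
  assume "det_cols gen_mat L = (0 :: 'k mpoly)"
  then have "mpoly_eval (\<lambda>x. x) (\<lambda>(i, j). unit_cols L (i - 1) j) (det_cols gen_mat L) = (0 :: 'k)"
    by (simp add: mpoly_eval_0[OF comm_ring_hom_id])
  moreover have "det_cols (unit_cols L) L = (1 :: 'k)"
    by (rule det_cols_unit_cols[OF assms])
  ultimately show False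
    by (simp add: mpoly_eval_det_cols comm_ring_hom_id)
qed

text \<open>A Gauss-type argument valid over any domain: pseudo-division by the linear polynomial
  leaves constants, and powers of the leading coefficient \<open>M\<close> can be cancelled because
  \<open>M\<close> is prime and does not divide the polynomial. The case \<open>M = 1\<close> starts
  the induction over matrix sizes.\<close>

lemma prime_elem_linear_poly:
  fixes M N :: "'a::idom"
  assumes "prime_elem M \<and> \<not> M dvd N \<or> M = 1"
  shows "prime_elem [:N, M:]"
proof -
  let ?p = "[:N, M:]"
  have M0: "M \<noteq> 0" using assms by auto
  have cancel: "?p dvd g" if "smult (M ^ k) g = ?p * s" for k g s
    using that
  proof (induction k arbitrary: s)
    case (Suc k)
    have eq: "[:M:] * smult (M ^ k) g = ?p * s"
      using Suc.prems by (simp add: mult.commute)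
    have "[:M:] dvd s"
    proof (cases "M = 1")
      case False
      with assms have M: "prime_elem M" "\<not> M dvd N" by auto
      have "[:M:] dvd ?p * s" unfolding eq[symmetric] by (rule dvd_triv_left)
      moreover have "prime_elem [:M:]"
        using M(1) by (simp add: prime_elem_const_poly_iff)
      ultimately have "[:M:] dvd ?p \<or> [:M:] dvd s"
        by (rule prime_elem_dvd_multD[rotated])
      moreover have "\<not> [:M:] dvd ?p"
      proof
        assume "[:M:] dvd ?p"
        then have "M dvd Polynomial.coeff ?p 0"
          unfolding const_poly_dvd_iff by blast
        then show False using M(2) by simp
      qed
      ultimately show ?thesis by blast
    qed (simp add: one_pCons[symmetric])
    then obtain s' where s': "s = [:M:] * s'" by (elim dvdE)
    have "[:M:] * smult (M ^ k) g = [:M:] * (?p * s')"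
      using eq s' by (simp only: mult_ac)
    then have "smult (M ^ k) g = ?p * s'"
      using M0 by (subst (asm) mult_left_cancel) auto
    then show ?case by (rule Suc.IH)
  next
    case 0
    then have "g = ?p * s" by (simp only: power_0 smult_1_left)
    then show ?case by (rule dvdI)
  qed
  have divmod: "\<exists>k s r. smult (M ^ k) g = ?p * s + [:r:]" for g
  proof -
    obtain q r where qr: "pseudo_divmod g ?p = (q, r)" by force
    from pseudo_divmod[OF _ qr] M0
    have "smult (M ^ (Suc (degree g) - 1)) g = ?p * q + r" "r = 0 \<or> degree r < 1"
      by auto
    then show ?thesis
      by (metis degree_0 degree_eq_zeroE less_one)
  qed
  show ?thesis
  proof (rule prime_elemI)
    show "?p \<noteq> 0" using M0 by auto
    show "\<not> ?p dvd 1" using M0 by (auto dest!: dvd_imp_degree_le)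
  next
    fix g h assume gh: "?p dvd g * h"
    obtain k s r where 1: "smult (M ^ k) g = ?p * s + [:r:]" using divmod by blast
    obtain l t u where 2: "smult (M ^ l) h = ?p * t + [:u:]" using divmod by blast
    have "smult (M ^ k * M ^ l) (g * h) = smult (M ^ k) g * smult (M ^ l) h"
      by (simp add: mult_ac)
    also have "\<dots> = (?p * s + [:r:]) * (?p * t + [:u:])"
      unfolding 1 2 ..
    also have "\<dots> = ?p * (s * (?p * t + [:u:]) + [:r:] * t) + [:r:] * [:u:]"
    proof -
      have "(p * s + R) * (p * t + U) = p * (s * (p * t + U) + R * t) + R * U" for p R U :: "'a poly"
        by (simp add: algebra_simps)
      then show ?thesis .
    qed
    finally have "[:r:] * [:u:] = smult (M ^ k * M ^ l) (g * h) - ?p * (s * (?p * t + [:u:]) + [:r:] * t)"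
      by simp
    moreover have "?p dvd smult (M ^ k * M ^ l) (g * h)"
      using gh by (rule dvd_smult)
    ultimately have "?p dvd [:r:] * [:u:]"
      by (metis dvd_diff dvd_triv_left)
    then have "?p dvd [:r * u:]"
      by (simp add: mult.commute)
    \<comment> \<open>A nonzero constant is not a multiple of a polynomial of degree one.\<close>
    then have "r * u = 0"
      using M0 by (auto dest!: dvd_imp_degree_le)
    then show "?p dvd g \<or> ?p dvd h"
      using cancel 1 2 by auto
  qed
qed

text \<open>The last column is its version with the corner entry set to 0 plus the corner entry
  times the last unit vector; the signs of the expansion and of the corner cofactor cancel.\<close>

lemma det_cols_snoc_split:
  "det_cols A (L @ [x]) = A (length L) x * det_cols A L
     + det_cols (\<lambda>i j. if i = length L \<and> j = x then 0 else A i j) (L @ [x])"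
  if "x \<notin> set L"
proof -
  let ?k = "length L" and ?B = "\<lambda>i j. if i = length L \<and> j = x then 0 else A i j"
  have del: "list_del ?k (L @ [x]) = L"
    by (simp add: list_del_def)
  have minor: "front_minor A L ?k = (-1) ^ ?k * det_cols A L" for A :: "nat \<Rightarrow> nat \<Rightarrow> 'a"
    unfolding front_minor_def det_cols_def
    by (intro arg_cong2[of _ _ _ _ "(*)"] arg_cong[of _ _ det] eq_matI) auto
  have *: "det_cols A (L @ [x]) = (-1) ^ ?k * det_front A L (\<lambda>i. A i x)"
    for A :: "nat \<Rightarrow> nat \<Rightarrow> 'a"
    using det_cols_laplace[of ?k "L @ [x]" A] by (simp add: del nth_append)
  have "det_front A L (\<lambda>i. A i x)
      = det_front A L (\<lambda>i. ?B i x + A ?k x * (if i = ?k then 1 else 0))"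
    by (intro det_front_cong) auto
  also have "\<dots> = det_front A L (\<lambda>i. ?B i x) + A ?k x * front_minor A L ?k"
    unfolding det_front_add_smult
    by (simp add: det_front_def if_distrib[of "\<lambda>t. t * _"] sum.delta cong: if_cong)
  also have "det_front A L (\<lambda>i. ?B i x) = det_front ?B L (\<lambda>i. ?B i x)"
    using that by (intro det_front_cong) auto
  finally show ?thesis
    by (simp add: * minor algebra_simps flip: power_add mult_2)
qed

text \<open>Induction on the size: as a polynomial in the corner indeterminate the determinant is
  linear, with the smaller generic determinant \<open>M\<close> as leading coefficient and a
  constant term \<open>N\<close> not divisible by \<open>M\<close>.\<close>

theorem prime_elem_det_cols:
  assumes "distinct L" "L \<noteq> []"
  shows "prime_elem (det_cols gen_mat L :: 'k::field mpoly)"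
  using assms
proof (induction L rule: rev_induct)
  case (snoc x L)
  let ?k = "length L" and ?P = "det_cols gen_mat (L @ [x]) :: 'k mpoly"
  define M where "M = (det_cols gen_mat L :: 'k mpoly)"
  define N where "N = (det_cols (\<lambda>i j. if i = ?k \<and> j = x then 0 else gen_mat i j) (L @ [x]) :: 'k mpoly)"
  have x: "x \<notin> set L" "distinct L" using snoc.prems by auto
  have "\<not> M dvd N" if ne: "L \<noteq> []"
  proof
    assume dvd: "M dvd N"
    obtain K y where L: "L = K @ [y]" using ne by (cases L rule: rev_cases) auto
    have y: "y \<noteq> x" using x L by auto
    \<comment> \<open>Sending the last two columns \<open>y\<close>, \<open>x\<close> to the unit
      vectors in exchanged order makes column \<open>y\<close> vanish in the rows of
      \<open>M\<close>, whereas \<open>N\<close> becomes the determinant of a transposition: its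
      suppressed corner entry was already 0.\<close>
    let ?U = "unit_cols (K @ [x, y]) :: nat \<Rightarrow> nat \<Rightarrow> 'k"
    define e where "e = mpoly_eval (\<lambda>x. x) (\<lambda>(i, j). ?U (i - 1) j)"
    interpret e: comm_ring_hom e
      unfolding e_def by (rule comm_ring_hom_mpoly_eval[OF comm_ring_hom_id])
    have e_det: "e (det_cols gen_mat M) = det_cols ?U M" for M
      by (simp add: e_def mpoly_eval_det_cols comm_ring_hom_id)
    have e_avar: "e (avar i j) = ?U (i - 1) j" for i j
      by (simp add: e_def comm_ring_hom_id)
    have nth: "(K @ [x, y]) ! length K = x" "(K @ [x, y]) ! Suc (length K) = y"
      by (auto simp: nth_append)
    have dist: "distinct (K @ [x, y])" using snoc.prems L by auto
    have "e M = det_cols ?U L"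
      by (simp add: M_def e_det)
    also have "\<dots> = 0"
    proof -
      have "?U i y = 0" if "i < length L" for i
        using that dist by (auto simp: unit_cols_def L less_Suc_eq nth_append)
      then show ?thesis by (intro det_cols_zero_column[of y]) (auto simp: L)
    qed
    finally have "e N = 0"
      using dvd by (auto elim!: dvdE simp: e.hom_mult)
    moreover have "e N = det_cols ?U (L @ [x])"
      unfolding N_def
      by (subst det_cols_hom[OF e.comm_ring_hom_axioms], rule det_cols_cong)
         (use y nth in \<open>auto simp: e_avar unit_cols_def L\<close>)
    moreover have "det_cols ?U (L @ [x]) = (-1) ^ Suc (length K) * front_minor ?U L (length K)"
    proof -
      have "list_del (length L) (L @ [x]) = L"
        by (simp add: list_del_def)
      moreover have "?U i x = (if i = length K then 1 else 0)" if "i \<le> length L" for i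
        using that dist by (auto simp: unit_cols_def L less_Suc_eq nth_append le_Suc_eq)
      ultimately show ?thesis
        using det_cols_laplace[of "length L" "L @ [x]" ?U]
        by (simp add: nth_append det_front_def L if_distrib[of "\<lambda>t. t * _"] cong: if_cong)
    qed
    moreover have "front_minor ?U L (length K) = (-1) ^ length K"
    proof -
      have "det_cols (\<lambda>i. ?U (if i < length K then i else Suc i)) L = (\<Prod>j<length L. 1)"
        using dist y by (intro det_cols_diag)
          (auto simp: unit_cols_def L nth_append less_Suc_eq nth_eq_iff_index_eq)
      then show ?thesis
        by (simp add: front_minor_def det_cols_def)
    qed
    ultimately show False by simp
  qed
  moreover have "M = 1" if "L = []"
    using that by (simp add: M_def det_cols_def)
  ultimately have prime: "prime_elem [:N, M:]"
    using snoc.IH x by (intro prime_elem_linear_poly) (auto simp: M_def)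
  \<comment> \<open>The corner indeterminate becomes the polynomial variable and all others stay in
    the coefficients. Substituting the indeterminate back, \<open>bk\<close>, is a left inverse, so
    divisibility by the determinant can be tested after applying \<psi>.\<close>
  define \<psi> :: "'k mpoly \<Rightarrow> 'k mpoly poly" where
    "\<psi> = mpoly_eval (\<lambda>c. [:Poly_Mapping.single 0 c:])
        (\<lambda>(i, j). if i = Suc ?k \<and> j = x then [:0, 1:] else [:avar i j:])"
  have hc: "comm_ring_hom (\<lambda>c::'k. [:Poly_Mapping.single 0 c :: 'k mpoly:])"
    by (rule comm_ring_hom_comp[OF comm_ring_hom_const_poly comm_ring_hom_const_mpoly])
  interpret \<psi>: comm_ring_hom \<psi>
    unfolding \<psi>_def by (rule comm_ring_hom_mpoly_eval[OF hc])
  define bk where "bk p = poly p (avar (Suc ?k) x)" for p :: "'k mpoly poly"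
  have bk: "bk (\<psi> g) = g" for g
  proof -
    let ?b = "\<lambda>p. poly p (avar (Suc ?k) x :: 'k mpoly)"
    have "?b \<circ> (\<lambda>c. [:Poly_Mapping.single 0 c:]) = Poly_Mapping.single 0"
      and "?b \<circ> (\<lambda>(i, j). if i = Suc ?k \<and> j = x then [:0, 1:] else [:avar i j:]) = (\<lambda>(i, j). avar i j)"
      by (auto simp: fun_eq_iff)
    then show ?thesis
      unfolding \<psi>_def bk_def by (simp add: mpoly_eval_comp[OF comm_ring_hom_poly_eval] mpoly_expand)
  qed
  have "\<psi> ?P = det_cols (\<lambda>i j. if i = ?k \<and> j = x then [:0, 1:] else [:gen_mat i j:]) (L @ [x])"
    unfolding \<psi>_def by (simp add: mpoly_eval_det_cols[OF hc])
  also have "\<dots> = [:0, 1:] * det_cols (\<lambda>i j. [:gen_mat i j:]) L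
      + det_cols (\<lambda>i j. [:if i = ?k \<and> j = x then 0 else gen_mat i j:]) (L @ [x])"
    using x by (subst det_cols_snoc_split)
      (auto intro!: arg_cong2[of _ _ _ _ "(+)"] arg_cong[of _ _ "pCons 0"] det_cols_cong)
  also have "\<dots> = [:N, M:]"
    by (simp add: M_def N_def flip: det_cols_hom[OF comm_ring_hom_const_poly])
  finally have \<psi>P: "\<psi> ?P = [:N, M:]" .
  have dvd_iff: "?P dvd g \<longleftrightarrow> [:N, M:] dvd \<psi> g" for g
  proof
    assume "[:N, M:] dvd \<psi> g"
    then obtain q where "\<psi> g = \<psi> ?P * q" using \<psi>P by (auto elim: dvdE)
    then have "bk (\<psi> g) = bk (\<psi> ?P) * bk q" by (simp add: bk_def)
    then show "?P dvd g" by (simp add: bk)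
  qed (auto elim!: dvdE simp: \<psi>.hom_mult simp flip: \<psi>P)
  show ?case
  proof (rule prime_elemI)
    show "?P \<noteq> 0" using prime \<psi>P by auto
    show "\<not> ?P dvd 1" using prime dvd_iff[of 1] by (auto simp: prime_elem_def)
    show "?P dvd a \<or> ?P dvd b" if "?P dvd a * b" for a b
      using that prime by (auto simp: dvd_iff \<psi>.hom_mult prime_elem_dvd_mult_iff)
  qed
qed simp

text \<open>Well-definedness of the description in \<open>ord\<close>: two representations with
  different exponents give, after clearing denominators, a product of two elements not divisible by
  the prime \<open>P\<close> that is nevertheless divisible by \<open>P\<close>.\<close>

lemma ord_eqI:
  fixes P g h :: "'k::field mpoly"
  assumes P: "prime_elem P" and gh: "\<not> P dvd g" "\<not> P dvd h"
  shows "ord P (Fract g h * Fract P 1 powi z) = z"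
proof -
  let ?x = "Fract g h * Fract P 1 powi z"
  have P0: "P \<noteq> 0" "Fract P 1 \<noteq> 0"
    using P by (auto simp: Zero_fract_def eq_fract)
  have pow: "Fract P 1 ^ n = Fract (P ^ n) 1" for n
    by (induction n) (auto simp: One_fract_def)
  have key: False
    if *: "Fract g h * Fract P 1 powi z = Fract g' h' * Fract P 1 powi z'" and "z < z'"
      and h: "h \<noteq> 0" "h' \<noteq> 0" and nd: "\<not> P dvd g" "\<not> P dvd h'" for g h g' h' z z'
  proof -
    define n where "n = nat (z' - z)"
    have n: "z' = z + int n" "n > 0" using \<open>z < z'\<close> by (auto simp: n_def)
    have "Fract g h = Fract g' h' * Fract P 1 ^ n"
      using * P0 by (simp add: n(1) power_int_add mult_ac)
    then have "g * h' = g' * P ^ n * h"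
      using h P0 by (simp add: pow eq_fract)
    moreover have "P dvd g' * P ^ n * h"
      using n(2) by (simp add: dvd_power)
    ultimately show False
      using P nd by (metis prime_elem_dvd_mult_iff)
  qed
  have nz: "g \<noteq> 0" "h \<noteq> 0" using gh by auto
  show ?thesis
    unfolding ord_def
  proof (rule the_equality)
    fix z'
    assume "\<exists>g' h'. g' \<noteq> 0 \<and> h' \<noteq> 0 \<and> \<not> P dvd g' \<and> \<not> P dvd h' \<and> ?x = Fract g' h' * Fract P 1 powi z'"
    then obtain g' h' where "h' \<noteq> 0" "\<not> P dvd g'" "\<not> P dvd h'"
      and eq: "?x = Fract g' h' * Fract P 1 powi z'" by blast
    then show "z' = z"
      using key[OF eq] key[OF eq[symmetric]] nz gh by (cases z' z rule: linorder_cases) auto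
  qed (use gh nz in blast)
qed

subsection \<open>Facets, walls and orientations of homology manifolds\<close>

lemma col_rank_no_columns: "col_rank R {} M = 0"
  by (simp add: col_rank_def)

text \<open>Needed for the augmentation map of a set of points: any two columns are dependent, with
  coefficients 1 and -1.\<close>

lemma col_rank_ones:
  fixes M :: "'r \<Rightarrow> 'c \<Rightarrow> 'k::field"
  assumes "finite C" "C \<noteq> {}" "\<And>c. c \<in> C \<Longrightarrow> M r c = 1"
  shows "col_rank {r} C M = 1"
  unfolding col_rank_def
proof (rule Max_eqI)
  let ?indep = "\<lambda>S. \<forall>c. (\<forall>r\<in>{r}. (\<Sum>j\<in>S. c j * M r j) = 0) \<longrightarrow> (\<forall>j\<in>S. c j = (0 :: 'k))"
  have "{card S |S. S \<subseteq> C \<and> ?indep S} \<subseteq> card ` Pow C"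
    by auto
  then show "finite {card S |S. S \<subseteq> C \<and> ?indep S}"
    by (rule finite_subset) (simp add: assms)
  obtain a where "a \<in> C" using assms by auto
  then have "{a} \<subseteq> C" "?indep {a}" using assms(3) by auto
  then show "1 \<in> {card S |S. S \<subseteq> C \<and> ?indep S}"
    by (intro CollectI exI[of _ "{a}"]) auto
next
  fix y
  assume "y \<in> {card S |S. S \<subseteq> C \<and>
      (\<forall>c. (\<forall>r\<in>{r}. (\<Sum>j\<in>S. c j * M r j) = 0) \<longrightarrow> (\<forall>j\<in>S. c j = (0 :: 'k)))}"
  then obtain S where y: "y = card S" and S: "S \<subseteq> C"
    and indep: "\<And>c. (\<Sum>j\<in>S. c j * M r j) = 0 \<Longrightarrow> (\<forall>j\<in>S. c j = (0 :: 'k))"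
    by auto
  have fin: "finite S" using S assms(1) finite_subset by auto
  have "a = b" if ab: "a \<in> S" "b \<in> S" for a b
  proof (rule ccontr)
    assume neq: "a \<noteq> b"
    let ?c = "\<lambda>j. if j = a then 1 else if j = b then - 1 else (0 :: 'k)"
    have "(\<Sum>j\<in>S. ?c j * M r j) = (\<Sum>j\<in>{a, b}. ?c j * M r j)"
      by (rule sum.mono_neutral_right) (use fin ab in auto)
    also have "\<dots> = 0"
    proof -
      have "M r a = 1" "M r b = 1" using ab S assms(3) by auto
      then show ?thesis using neq by simp
    qed
    finally show False
      using indep[of ?c] ab(1) by auto
  qed
  then show "y \<le> 1"
    unfolding y by (metis card_le_Suc0_iff_eq fin One_nat_def)
qed

lemma faces_of_card_0: "simplicial_complex \<Delta> V \<Longrightarrow> G \<in> \<Delta> \<Longrightarrow> faces_of_card (link \<Delta> G) 0 = {{}}"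
  by (auto simp: faces_of_card_def link_def simplicial_complex_def finite_subset
      dest: rev_finite_subset[of V])

locale manifold =
  fixes K :: "'k::field itself" and \<Delta> :: "nat set set" and V :: "nat set" and d :: nat
  assumes d: "d \<ge> 2" and manifold: "homology_manifold K \<Delta> V d"
begin

lemma complex: "simplicial_complex \<Delta> V"
  using manifold by (simp add: homology_manifold_def)

lemma finite_V: "finite V"
  using complex by (simp add: simplicial_complex_def)

lemma face_sub: "F \<in> \<Delta> \<Longrightarrow> F \<subseteq> V"
  using complex by (auto simp: simplicial_complex_def)

lemma face_down: "F \<in> \<Delta> \<Longrightarrow> G \<subseteq> F \<Longrightarrow> G \<in> \<Delta>"
  using complex by (auto simp: simplicial_complex_def)

lemma face_finite: "F \<in> \<Delta> \<Longrightarrow> finite F"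
  using face_sub finite_V finite_subset by blast

lemma finite_complex: "finite \<Delta>"
  by (rule finite_subset[of _ "Pow V"]) (use face_sub finite_V in auto)

lemma face_card_le: "F \<in> \<Delta> \<Longrightarrow> card F \<le> d"
  using manifold by (auto simp: homology_manifold_def has_dim_def)

lemma ex_facet: "\<exists>F\<in>\<Delta>. card F = d"
  using manifold by (auto simp: homology_manifold_def has_dim_def)

lemma betti_link:
  "G \<in> \<Delta> \<Longrightarrow> G \<noteq> {} \<Longrightarrow> red_betti K (link \<Delta> G) s = (if s = d - card G then 1 else 0)"
  using manifold by (auto simp: homology_manifold_def homology_sphere_like_def)

text \<open>A maximal face \<open>F\<close> with fewer than \<open>d\<close> vertices would have the
  link \<open>{{}}\<close>, whose reduced homology sits at index 0, while the link of a nonempty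
  face must have it at index \<open>d - card F > 0\<close>.\<close>

lemma pure:
  assumes "G \<in> \<Delta>"
  shows "\<exists>F\<in>\<Delta>. G \<subseteq> F \<and> card F = d"
proof -
  let ?S = "{F \<in> \<Delta>. G \<subseteq> F}"
  have fin: "finite ?S" using finite_complex by auto
  obtain F where F: "F \<in> ?S" and max: "\<And>F'. F' \<in> ?S \<Longrightarrow> card F' \<le> card F"
  proof -
    have "Max (card ` ?S) \<in> card ` ?S"
      using fin assms by (intro Max_in) auto
    then obtain F where "F \<in> ?S" "card F = Max (card ` ?S)" by auto
    then show ?thesis using fin that by auto
  qed
  have "card F = d"
  proof (rule ccontr)
    assume neq: "card F \<noteq> d"
    then have lt: "card F < d" using F face_card_le by (simp add: order_less_le)
    \<comment> \<open>The homology condition concerns nonempty faces only; the empty face is not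
      maximal because a face with \<open>d\<close> vertices exists.\<close>
    have ne: "F \<noteq> {}"
    proof
      assume "F = {}"
      then have "G = {}" using F by auto
      then obtain F' where "F' \<in> ?S" "card F' = d" using ex_facet by auto
      then show False using max lt by fastforce
    qed
    have link: "link \<Delta> F = {{}}"
    proof -
      have "H = {}" if "H \<in> link \<Delta> F" for H
      proof (rule ccontr)
        assume "H \<noteq> {}"
        have H: "H \<inter> F = {}" "H \<union> F \<in> \<Delta>" using that by (auto simp: link_def)
        then have "card (H \<union> F) = card H + card F" "card H > 0"
          using face_finite[OF H(2)] \<open>H \<noteq> {}\<close> by (auto intro!: card_Un_disjoint simp: card_gt_0_iff)
        moreover have "H \<union> F \<in> ?S" using H F by auto
        ultimately show False using max[of "H \<union> F"] by auto
      qed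
      moreover have "{} \<in> link \<Delta> F" using F face_down[of F "{}"] by (auto simp: link_def)
      ultimately show ?thesis by auto
    qed
    have "faces_of_card {{} :: nat set} 0 = {{}}" "faces_of_card {{} :: nat set} 1 = {}"
      by (auto simp: faces_of_card_def)
    then have "red_betti K (link \<Delta> F) 0 = 1"
      by (simp add: red_betti_def link bd_rank_def col_rank_no_columns)
    then show False
      using betti_link[of F 0] F ne lt by auto
  qed
  then show ?thesis using F by auto
qed

lemma facet_iff: "facet \<Delta> F \<longleftrightarrow> F \<in> \<Delta> \<and> card F = d"
proof
  assume F: "facet \<Delta> F"
  then obtain F' where "F' \<in> \<Delta>" "F \<subseteq> F'" "card F' = d"
    using pure[of F] by (auto simp: facet_def)
  then show "F \<in> \<Delta> \<and> card F = d" using F by (auto simp: facet_def)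
next
  assume F: "F \<in> \<Delta> \<and> card F = d"
  have "G = F" if "G \<in> \<Delta>" "F \<subseteq> G" for G
    using that F face_card_le[of G] face_finite[of G] by (metis card_seteq)
  then show "facet \<Delta> F" using F by (auto simp: facet_def)
qed

text \<open>The link of \<open>T\<close> consists of isolated points, so its homology at index 1 has
  dimension one less than their number, the augmentation having rank one. As
  \<open>d \<ge> 2\<close>, \<open>T\<close> is nonempty and this dimension is 1.\<close>

lemma two_facets_at_wall:
  assumes "T \<in> \<Delta>" "card T = d - 1"
  obtains w w' where "w \<noteq> w'" "{x. x \<notin> T \<and> insert x T \<in> \<Delta>} = {w, w'}"
proof -
  let ?X = "link \<Delta> T" and ?C = "{x. x \<notin> T \<and> insert x T \<in> \<Delta>}"
  have ne: "T \<noteq> {}" using assms d by auto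
  have fT: "finite T" using face_finite assms by auto
  have fC: "finite ?C"
    by (rule finite_subset[of _ V]) (use face_sub finite_V in auto)
  have 0: "faces_of_card ?X 0 = {{}}"
    using faces_of_card_0[OF complex assms(1)] .
  have 1: "faces_of_card ?X 1 = (\<lambda>x. {x}) ` ?C"
    by (auto simp: faces_of_card_def link_def card_1_singleton_iff intro: face_down)
  have "faces_of_card ?X 2 = {}"
  proof -
    have False if "H \<in> ?X" "card H = 2" for H
    proof -
      have H: "H \<inter> T = {}" "H \<union> T \<in> \<Delta>" "finite H"
        using that by (auto simp: link_def card_ge_0_finite)
      then have "card (H \<union> T) = card H + card T"
        using fT by (intro card_Un_disjoint) auto
      then show False
        using face_card_le[OF H(2)] that assms d by auto
    qed
    then show ?thesis by (auto simp: faces_of_card_def)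
  qed
  then have r2: "bd_rank K ?X 2 = 0"
    by (simp add: bd_rank_def col_rank_no_columns)
  have "card ?C - bd_rank K ?X 1 = 1"
  proof -
    have "red_betti K ?X 1 = 1"
      using betti_link[OF assms(1) ne, of 1] assms d by auto
    then show ?thesis
      unfolding red_betti_def 1 using r2 by (simp add: card_image inj_on_def numeral_2_eq_2)
  qed
  moreover from this have "?C \<noteq> {}" by (metis card.empty diff_0_eq_0 zero_neq_one)
  then have "bd_rank K ?X 1 = 1"
  proof -
    have "bd_rank K ?X 1 = col_rank {{}} ((\<lambda>x. {x}) ` ?C) (bd_entry :: _ \<Rightarrow> _ \<Rightarrow> 'k)"
      unfolding bd_rank_def 1 by (simp add: 0)
    also have "\<dots> = 1"
    proof -
      have "{w. w = x \<and> w < x} = {}" for x :: nat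
        by auto
      then have *: "card {w. w = x \<and> w < x} = 0" for x :: nat
        by (simp only: card.empty)
      have "bd_entry {} {x} = (1 :: 'k)" for x
        unfolding bd_entry_def by (simp, simp only: * power_0)
      then show ?thesis
        using fC \<open>?C \<noteq> {}\<close> by (intro col_rank_ones) auto
    qed
    finally show ?thesis .
  qed
  ultimately have "card ?C = 2" by auto
  then show ?thesis
    using that by (auto simp: card_2_iff)
qed

end

section \<open>Inversion counts and induced orientations\<close>

fun inversions :: "nat list \<Rightarrow> nat" where
  "inversions [] = 0"
| "inversions (x # xs) = length (filter (\<lambda>y. y < x) xs) + inversions xs"

lemma card_inversions: "card {(p, q). p < q \<and> q < length L \<and> L ! p > L ! q} = inversions L"
proof (induction L)
  case (Cons x xs)
  let ?I = "{(p, q). p < q \<and> q < length xs \<and> xs ! p > xs ! q}"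
  let ?J = "{q. q < length xs \<and> xs ! q < x}"
  have eq: "{(p, q). p < q \<and> q < length (x # xs) \<and> (x # xs) ! p > (x # xs) ! q}
      = (\<lambda>q. (0, Suc q)) ` ?J \<union> (\<lambda>(p, q). (Suc p, Suc q)) ` ?I"
    (is "?L = ?R")
  proof (intro equalityI subsetI)
    fix z assume "z \<in> ?L"
    moreover obtain p q where z: "z = (p, q)" by force
    ultimately show "z \<in> ?R"
      unfolding z by (cases p; cases q) (auto simp: image_iff)
  qed auto
  have "finite ?I"
    by (rule finite_subset[of _ "{..length xs} \<times> {..length xs}"]) auto
  then have "card (?L) = card ((\<lambda>q. (0::nat, Suc q)) ` ?J) + card ((\<lambda>(p, q). (Suc p, Suc q)) ` ?I)"
    unfolding eq by (intro card_Un_disjoint) auto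
  also have "card ((\<lambda>q. (0::nat, Suc q)) ` ?J) = card ?J"
    by (intro card_image inj_onI) auto
  also have "card ((\<lambda>(p, q). (Suc p, Suc q)) ` ?I) = card ?I"
    by (intro card_image inj_onI) auto
  finally show ?case
    using Cons.IH by (simp add: length_filter_conv_card)
qed simp

lemma inv_sign_eq: "inv_sign L = (-1) ^ inversions L"
  by (simp add: inv_sign_def card_inversions)

lemma inversions_insert:
  "inversions (A @ v # B) = inversions (A @ B) + length (filter (\<lambda>y. v < y) A) + length (filter (\<lambda>y. y < v) B)"
  by (induction A) auto

text \<open>The inversions involving \<open>v\<close> are the larger entries before it and the
  smaller ones after it. Combined with the number of all entries before it, the larger ones count
  twice, and the parity of the number of smaller entries remains.\<close>

lemma induced_sign_eq:
  assumes "distinct L" "v \<in> set L"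
  shows "induced_sign L v = (-1) ^ card {x \<in> set L. x < v} * inv_sign L"
proof -
  obtain A B where L: "L = A @ v # B" using assms(2) by (auto simp: in_set_conv_decomp)
  have AB: "v \<notin> set A" "v \<notin> set B" "distinct A" "distinct B" "set A \<inter> set B = {}"
    using assms(1) L by auto
  have tw: "takeWhile (\<lambda>x. x \<noteq> v) L = A"
    using AB(1) by (auto simp: L takeWhile_tail intro!: takeWhile_append2[THEN trans])
  have rm: "removeAll v L = A @ B"
    using AB by (simp add: L removeAll_id)
  have less: "{x \<in> set L. x < v} = set (filter (\<lambda>y. y < v) A) \<union> set (filter (\<lambda>y. y < v) B)"
    by (auto simp: L)
  have c: "card {x \<in> set L. x < v} = length (filter (\<lambda>y. y < v) A) + length (filter (\<lambda>y. y < v) B)"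
    unfolding less using AB
    by (subst card_Un_disjoint, (auto)[3]) (simp only: distinct_card distinct_filter)
  have "filter (\<lambda>y. v < y) A = filter (\<lambda>y. \<not> y < v) A"
    using AB(1) by (intro filter_cong) (auto simp: not_less order_le_less)
  then have len: "length A = length (filter (\<lambda>y. y < v) A) + length (filter (\<lambda>y. v < y) A)"
    using sum_length_filter_compl[of "\<lambda>y. y < v" A] by simp
  have [simp]: "(-1::int) ^ k * (-1) ^ k = 1" for k
    by (simp flip: power_add mult_2)
  show ?thesis
    unfolding induced_sign_def tw rm c inv_sign_eq
    unfolding L inversions_insert len power_add
    by (simp add: algebra_simps)
qed

lemma epsilon_nonzero: "epsilon TYPE('k::field) ori F \<noteq> 0"
  by (simp add: epsilon_def inv_sign_eq)

lemma minus_one_char_2: "CHAR('k::field) = 2 \<Longrightarrow> (-1 :: 'k) = 1"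
  using of_nat_CHAR[where ?'a = 'k] by (simp add: minus_equation_iff eq_neg_iff_add_eq_0)

text \<open>The orientation condition rewritten with the position of the apex in the sorted facet,
  which also governs the sign when its column is expanded. In characteristic 2 both summands are 1
  and 1 + 1 = 0.\<close>

lemma (in manifold) epsilon_wall:
  assumes ori: "CHAR('k) \<noteq> 2 \<longrightarrow> oriented \<Delta> d ori"
    and T: "card T = d - 1" "w \<notin> T" "w' \<notin> T" "w \<noteq> w'" "insert w T \<in> \<Delta>" "insert w' T \<in> \<Delta>"
  shows "epsilon TYPE('k) ori (insert w T) * (-1) ^ card {x \<in> T. x < w}
       + epsilon TYPE('k) ori (insert w' T) * (-1) ^ card {x \<in> T. x < w'} = 0"
proof (cases "CHAR('k) = 2")
  case True
  have "(1 + 1 :: 'k) = 0"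
    using of_nat_CHAR[where ?'a = 'k] True by simp
  then show ?thesis
    unfolding minus_one_char_2[OF True] using True by (simp add: epsilon_def)
next
  case False
  have fT: "finite T" using face_finite[OF T(5)] by simp
  have fac: "facet \<Delta> (insert w T)" "facet \<Delta> (insert w' T)"
    using T(1-3) T(5,6) d fT by (simp_all add: facet_iff)
  have 1: "the_elem (insert w T - T) = w" "the_elem (insert w' T - T) = w'"
    using T(2,3) by (simp_all add: insert_Diff_if)
  have or: "oriented \<Delta> d ori" using ori False by auto
  have set: "distinct (ori (insert w T))" "set (ori (insert w T)) = insert w T"
    "distinct (ori (insert w' T))" "set (ori (insert w' T)) = insert w' T"
    using or fac by (auto simp: oriented_def)
  have TD: "T \<in> \<Delta>" by (rule face_down[OF T(5)]) auto
  have neq: "insert w T \<noteq> insert w' T" using T(2-4) by auto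
  have main: "induced_sign (ori (insert w T)) w = - induced_sign (ori (insert w' T)) w'"
    using or[unfolded oriented_def, THEN conjunct2, rule_format, OF TD, of "insert w T" "insert w' T"]
      T(1) fac neq unfolding 1 by auto
  have "{x \<in> insert w T. x < w} = {x \<in> T. x < w}" "{x \<in> insert w' T. x < w'} = {x \<in> T. x < w'}"
    by auto
  then have "(-1) ^ card {x \<in> T. x < w} * inv_sign (ori (insert w T)) =
      - ((-1) ^ card {x \<in> T. x < w'} * inv_sign (ori (insert w' T)))"
    using main set by (simp add: induced_sign_eq)
  then have eq: "of_int ((-1) ^ card {x \<in> T. x < w} * inv_sign (ori (insert w T))) =
      (of_int (- ((-1) ^ card {x \<in> T. x < w'} * inv_sign (ori (insert w' T)))) :: 'k)"
    by (rule arg_cong)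
  have of_int_sgn: "of_int ((-1) ^ a * i) = (of_int i * (-1) ^ a :: 'k)" for a i
    by (simp add: mult.commute)
  show ?thesis
    using eq False unfolding epsilon_def of_int_minus of_int_sgn by simp
qed

subsection \<open>The degree functional\<close>

abbreviation det_set :: "(nat \<Rightarrow> nat \<Rightarrow> 'r::comm_ring_1) \<Rightarrow> nat set \<Rightarrow> 'r" where
  "det_set A G \<equiv> det_cols A (sorted_list_of_set G)"

abbreviation face_det :: "(nat \<Rightarrow> nat \<Rightarrow> 'r::comm_ring_1) \<Rightarrow> nat set \<Rightarrow> (nat \<Rightarrow> 'r) \<Rightarrow> 'r" where
  "face_det A T v \<equiv> det_front A (sorted_list_of_set T) v"

text \<open>This is \<open>[G, j]\<close> with the free vector \<open>v\<close> as new column: the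
  sign moves \<open>v\<close> from the front to the place that \<open>j\<close> has in the sorted
  list of \<open>G\<close>.\<close>

definition replace_det ::
    "(nat \<Rightarrow> nat \<Rightarrow> 'r::comm_ring_1) \<Rightarrow> nat set \<Rightarrow> nat \<Rightarrow> (nat \<Rightarrow> 'r) \<Rightarrow> 'r" where
  "replace_det A G j v = (-1) ^ card {x \<in> G. x < j} * face_det A (G - {j}) v"

lemma card_less_nth_sorted_list:
  assumes "finite G" "k < card G"
  shows "card {x \<in> G. x < sorted_list_of_set G ! k} = k"
proof -
  let ?L = "sorted_list_of_set G"
  have len: "length ?L = card G" using assms by simp
  have ss: "sorted_wrt (<) ?L" using assms by simp
  have lt: "?L ! i < ?L ! j \<longleftrightarrow> i < j" if "i < card G" "j < card G" for i j
    using ss that len sorted_wrt_nth_less[of "(<)" ?L]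
    by (metis linorder_neqE_nat order_less_asym less_irrefl)
  have "{x \<in> G. x < ?L ! k} = (!) ?L ` {..<k}"
  proof (intro equalityI subsetI)
    fix x assume x: "x \<in> {x \<in> G. x < ?L ! k}"
    then have "x \<in> set ?L" using assms by simp
    then obtain i where "i < card G" "x = ?L ! i" using len by (auto simp: in_set_conv_nth)
    then show "x \<in> (!) ?L ` {..<k}" using x lt assms by auto
  next
    fix x assume "x \<in> (!) ?L ` {..<k}"
    then obtain i where i: "i < k" "x = ?L ! i" by auto
    then have "?L ! i \<in> set ?L" using assms len by (intro nth_mem) auto
    then show "x \<in> {x \<in> G. x < ?L ! k}" using i lt assms by auto
  qed
  moreover have "inj_on ((!) ?L) {..<k}"
    using assms len by (auto simp: inj_on_def nth_eq_iff_index_eq)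
  ultimately show ?thesis by (simp add: card_image)
qed

lemma list_del_sorted_list:
  assumes "finite G" "k < card G"
  shows "list_del k (sorted_list_of_set G) = sorted_list_of_set (G - {sorted_list_of_set G ! k})"
proof -
  let ?L = "sorted_list_of_set G"
  have k: "k < length ?L" using assms by simp
  then have L: "?L = take k ?L @ ?L ! k # drop (Suc k) ?L"
    by (rule id_take_nth_drop)
  have "distinct ?L" by simp
  then have "?L ! k \<notin> set (take k ?L)"
    using k by (auto simp: in_set_conv_nth nth_eq_iff_index_eq)
  then have "remove1 (?L ! k) (take k ?L @ ?L ! k # drop (Suc k) ?L) = list_del k ?L"
    by (simp add: remove1_append list_del_def)
  then have "remove1 (?L ! k) ?L = list_del k ?L"
    by (simp flip: L)
  moreover have "sorted_list_of_set (G - {?L ! k}) = remove1 (?L ! k) ?L"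
    using assms by (simp add: sorted_list_of_set_remove)
  ultimately show ?thesis by simp
qed

lemma replace_det_nth:
  assumes "finite G" "k < card G"
  shows "replace_det A G (sorted_list_of_set G ! k) v
    = (-1) ^ k * det_front A (list_del k (sorted_list_of_set G)) v"
  using assms by (simp add: replace_det_def card_less_nth_sorted_list list_del_sorted_list)

lemma replace_det_eq_det_cols:
  assumes "finite G" "k < card G"
  shows "replace_det A G (sorted_list_of_set G ! k) (\<lambda>i. A i x) = det_cols A ((sorted_list_of_set G)[k := x])"
  using assms by (simp add: replace_det_nth det_cols_update)

lemma bij_betw_nth_sorted_list:
  "finite G \<Longrightarrow> bij_betw ((!) (sorted_list_of_set G)) {..<card G} G"
  using bij_betw_nth[of "sorted_list_of_set G" "{..<card G}" G] by simp

lemma cramer_coeff_set: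
  assumes "finite G" "j \<in> G" and v: "\<And>i. i < card G \<Longrightarrow> v i = (\<Sum>x\<in>G. c x * A i x)"
  shows "replace_det A G j v = c j * det_set A G"
proof -
  let ?L = "sorted_list_of_set G"
  note bij = bij_betw_nth_sorted_list[OF assms(1)]
  obtain k where k: "k < card G" "j = ?L ! k"
    using bij assms(2) by (auto simp: bij_betw_def)
  have "(-1) ^ k * det_front A (list_del k ?L) v = c (?L ! k) * det_cols A ?L"
    using assms(1) k v
    by (intro cramer_coeff) (simp_all add: sum.reindex_bij_betw[OF bij, symmetric, of "\<lambda>x. c x * A _ x"])
  then show ?thesis
    using k assms(1) by (simp add: replace_det_nth)
qed

lemma cramer_solution_set:
  assumes "finite G" "i < card G"
  shows "(\<Sum>j\<in>G. A i j * replace_det A G j v) = det_set A G * v i"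
proof -
  let ?L = "sorted_list_of_set G"
  have "(\<Sum>j\<in>G. A i j * replace_det A G j v) = (\<Sum>k<card G. A i (?L ! k) * replace_det A G (?L ! k) v)"
    by (rule sum.reindex_bij_betw[OF bij_betw_nth_sorted_list[OF assms(1)], symmetric])
  also have "\<dots> = (\<Sum>k<length ?L. A i (?L ! k) * ((-1) ^ k * det_front A (list_del k ?L) v))"
    using assms(1) by (intro sum.cong) (auto simp: replace_det_nth)
  finally show ?thesis
    using cramer_solution[of i ?L A v] assms by simp
qed

text \<open>The setting of the residue argument, over an abstract field. The vector \<open>v\<close>
  and the direction \<open>b\<close> avoid all hyperplanes spanned by walls, and
  \<open>roots_distinct\<close> says that the line through \<open>v\<close> in direction
  \<open>b\<close> meets these hyperplanes at pairwise different parameters. \<open>e_wall\<close>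
  is the orientation relation that makes residues cancel.\<close>

locale generic_manifold = manifold K \<Delta> V d
  for K :: "'k::field itself" and \<Delta> V d +
  fixes A :: "nat \<Rightarrow> nat \<Rightarrow> 'r::field" and v b :: "nat \<Rightarrow> 'r" and e :: "nat set \<Rightarrow> 'r"
  assumes det_nonzero: "\<And>G. G \<in> \<Delta> \<Longrightarrow> card G = d \<Longrightarrow> det_set A G \<noteq> 0"
    and v_nonzero: "\<And>T. T \<in> \<Delta> \<Longrightarrow> card T = d - 1 \<Longrightarrow> face_det A T v \<noteq> 0"
    and b_nonzero: "\<And>T. T \<in> \<Delta> \<Longrightarrow> card T = d - 1 \<Longrightarrow> face_det A T b \<noteq> 0"
    and roots_distinct: "\<And>T T'. T \<in> \<Delta> \<Longrightarrow> card T = d - 1 \<Longrightarrow> T' \<in> \<Delta> \<Longrightarrow> card T' = d - 1 \<Longrightarrow>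
        T \<noteq> T' \<Longrightarrow> face_det A T v * face_det A T' b \<noteq> face_det A T' v * face_det A T b"
    and e_wall: "\<And>T w w'. card T = d - 1 \<Longrightarrow> w \<notin> T \<Longrightarrow> w' \<notin> T \<Longrightarrow> w \<noteq> w' \<Longrightarrow>
        insert w T \<in> \<Delta> \<Longrightarrow> insert w' T \<in> \<Delta> \<Longrightarrow>
        e (insert w T) * (-1) ^ card {x \<in> T. x < w} + e (insert w' T) * (-1) ^ card {x \<in> T. x < w'} = 0"
begin

section \<open>Vanishing of the residue sum\<close>

definition facets :: "nat set set" where "facets = {G \<in> \<Delta>. card G = d}"

definition walls :: "nat set set" where "walls = {T \<in> \<Delta>. card T = d - 1}"

definition walls_of :: "nat set \<Rightarrow> nat set set" where "walls_of G = (\<lambda>j. G - {j}) ` G"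

definition walls_sign :: "nat set \<Rightarrow> 'r" where
  "walls_sign G = (\<Prod>j\<in>G. (-1) ^ card {x \<in> G. x < j})"

text \<open>For \<open>m\<close> of degree \<open>d - 1\<close> the powers of \<open>[G]\<close> in
  the sum over the facets cancel, leaving \<open>e G\<close> times \<open>m\<close> over the product
  of the \<open>[G, j]\<close>. Here this is multiplied by the product over all walls, so that it is
  polynomial in \<open>u\<close>; \<open>walls_sign\<close> compares the \<open>[G, j]\<close> with
  the sorted determinants of the walls.\<close>

definition residue_sum :: "nat multiset \<Rightarrow> (nat \<Rightarrow> 'r) \<Rightarrow> 'r" where
  "residue_sum m u = (\<Sum>G | G \<in> facets \<and> set_mset m \<subseteq> G. e G * walls_sign G *
     (\<Prod>j\<in>#m. replace_det A G j u) * (\<Prod>T\<in>walls - walls_of G. face_det A T u))"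

lemma finite_facets [simp]: "finite facets" and finite_walls [simp]: "finite walls"
  using finite_complex by (auto simp: facets_def walls_def)

lemma facetD: "G \<in> facets \<Longrightarrow> G \<in> \<Delta>" "G \<in> facets \<Longrightarrow> card G = d" "G \<in> facets \<Longrightarrow> finite G"
  using face_finite by (auto simp: facets_def)

lemma walls_of_subset: "G \<in> facets \<Longrightarrow> walls_of G \<subseteq> walls"
  using face_down by (auto simp: walls_of_def walls_def facets_def face_finite)

lemma inj_walls_of: "inj_on (\<lambda>j. G - {j}) G"
  by (auto simp: inj_on_def)

lemma card_walls_of: "G \<in> facets \<Longrightarrow> card (walls_of G) = d"
  by (simp add: walls_of_def card_image inj_walls_of facetD)

lemma walls_sign_square: "walls_sign G * walls_sign G = 1"
  by (simp add: walls_sign_def flip: prod.distrib power_add mult_2)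

lemma prod_replace_det:
  "(\<Prod>j\<in>G. replace_det A G j u) = walls_sign G * (\<Prod>T\<in>walls_of G. face_det A T u)"
  by (simp add: walls_of_def prod.reindex[OF inj_walls_of] walls_sign_def replace_det_def prod.distrib)

text \<open>On the hyperplane of \<open>T\<close> only the two facets containing \<open>T\<close>
  can contribute. There \<open>u\<close> lies in the span of the columns of \<open>T\<close> and has
  the same coefficients \<open>c\<close> with respect to both facets, so the two terms agree up to
  the signs related by \<open>e_wall\<close>.\<close>

lemma residue_zero:
  assumes T: "T \<in> walls" and zero: "face_det A T u = 0"
    and nonzero: "\<And>T'. T' \<in> walls \<Longrightarrow> T' \<noteq> T \<Longrightarrow> face_det A T' u \<noteq> 0"
    and m: "size m = d - 1"
  shows "residue_sum m u = 0"
proof -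
  obtain w w' where ww: "w \<noteq> w'" and eq: "{x. x \<notin> T \<and> insert x T \<in> \<Delta>} = {w, w'}"
    using T two_facets_at_wall by (auto simp: walls_def)
  have TD: "T \<in> \<Delta>" "card T = d - 1" "finite T"
    using T face_finite by (auto simp: walls_def)
  let ?G = "\<lambda>x. insert x T"
  have apex: "x \<notin> T" "?G x \<in> facets" if "x \<in> {w, w'}" for x
  proof -
    have "x \<in> {x. x \<notin> T \<and> insert x T \<in> \<Delta>}" using that eq by simp
    then show "x \<notin> T" "?G x \<in> facets" using TD d by (auto simp: facets_def)
  qed
  let ?t = "\<lambda>G. e G * walls_sign G * (\<Prod>j\<in>#m. replace_det A G j u) * (\<Prod>T\<in>walls - walls_of G. face_det A T u)"
  have other: "?t G = 0" if "G \<in> facets" "G \<notin> {?G w, ?G w'}" for G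
  proof -
    have "T \<notin> walls_of G"
    proof
      assume "T \<in> walls_of G"
      then obtain j where j: "j \<in> G" "T = G - {j}" by (auto simp: walls_of_def)
      then have "j \<in> {x. x \<notin> T \<and> insert x T \<in> \<Delta>}" using that by (auto simp: insert_absorb facets_def)
      then have "j \<in> {w, w'}" using eq by simp
      then show False using that(2) j by (auto simp: insert_absorb)
    qed
    then have "(\<Prod>T\<in>walls - walls_of G. face_det A T u) = 0"
      using T zero by (intro prod_zero) auto
    then show ?thesis by simp
  qed
  have "residue_sum m u = (\<Sum>G | G \<in> {?G w, ?G w'} \<and> set_mset m \<subseteq> G. ?t G)"
    unfolding residue_sum_def
    by (rule sum.mono_neutral_right) (use other apex in auto)
  also have "\<dots> = 0"
  proof (cases "set_mset m \<subseteq> T")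
    case False
    \<comment> \<open>A variable of \<open>m\<close> outside \<open>T\<close> must be the apex of a
      contributing facet, and its coordinate vanishes on the hyperplane.\<close>
    then obtain j where j: "j \<in># m" "j \<notin> T" by auto
    show ?thesis
    proof (rule sum.neutral, clarify)
      fix G assume G: "G \<in> {?G w, ?G w'}" "set_mset m \<subseteq> G"
      then have "G - {j} = T" using j by auto
      then have "replace_det A G j u = 0" by (simp add: replace_det_def zero)
      then have "(\<Prod>j\<in>#m. replace_det A G j u) = 0"
        using j by (auto simp: prod_mset_zero_iff)
      then show "?t G = 0" by simp
    qed
  next
    case True
    define c where "c j = replace_det A (?G w) j u / det_set A (?G w)" for j
    have D0: "det_set A (?G x) \<noteq> 0" if "x \<in> {w, w'}" for x
      using apex[OF that] det_nonzero facetD by blast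
    have cw: "c w = 0"
      using apex[of w] zero by (simp add: c_def replace_det_def)
    have u: "u i = (\<Sum>j\<in>T. c j * A i j)" if "i < d" for i
    proof -
      have "(\<Sum>j\<in>?G w. A i j * replace_det A (?G w) j u) = det_set A (?G w) * u i"
        using that apex[of w] facetD(2) TD by (intro cramer_solution_set) auto
      then have "u i = (\<Sum>j\<in>?G w. A i j * replace_det A (?G w) j u) / det_set A (?G w)"
        using D0[of w] by (simp add: field_simps)
      also have "\<dots> = (\<Sum>j\<in>?G w. c j * A i j)"
        by (simp add: sum_divide_distrib c_def mult.commute)
      also have "\<dots> = (\<Sum>j\<in>T. c j * A i j)"
        using cw apex[of w] TD by simp
      finally show ?thesis .
    qed
    have y: "replace_det A (?G x) j u = c j * det_set A (?G x)" if "x \<in> {w, w'}" "j \<in> T" for x j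
    proof -
      have "replace_det A (?G x) j u = (if j = x then 0 else c j) * det_set A (?G x)"
      proof (rule cramer_coeff_set)
        fix i assume "i < card (?G x)"
        then have "i < d" using apex[OF that(1)] facetD by auto
        then have "u i = (\<Sum>j\<in>T. c j * A i j)" by (rule u)
        also have "\<dots> = (\<Sum>j\<in>T. (if j = x then 0 else c j) * A i j)"
          using apex[OF that(1)] by (intro sum.cong) auto
        finally show "u i = (\<Sum>j\<in>?G x. (if j = x then 0 else c j) * A i j)"
          using apex[OF that(1)] TD by simp
      qed (use that TD in auto)
      then show ?thesis using that apex by auto
    qed
    define C where "C = (\<Prod>j\<in>T. c j)"
    define cm where "cm = (\<Prod>j\<in>#m. c j)"
    define Z where "Z = (\<Prod>T'\<in>walls - {T}. face_det A T' u)"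
    \<comment> \<open>The power of \<open>[G]\<close> coming from \<open>m\<close> turns
      \<open>C\<close> into the product over the remaining walls of the facet, so that the wall
      products combine to \<open>Z\<close>. What is left depends on the facet only through its
      sign.\<close>
    have contrib: "C * ?t (?G x) = e (?G x) * (-1) ^ card {y \<in> T. y < x} * (cm * Z)" if x: "x \<in> {w, w'}" for x
    proof -
      let ?H = "?G x"
      have GT: "?H - {x} = T" "x \<notin> T" using apex[OF x] by auto
      have s: "{y \<in> ?H. y < x} = {y \<in> T. y < x}" by auto
      have TW: "T \<in> walls_of ?H" using GT by (auto simp: walls_of_def)
      have fW: "finite (walls_of ?H)" using TD by (simp add: walls_of_def)
      define sT where "sT = (\<Prod>j\<in>T. (-1) ^ card {y \<in> ?H. y < j} :: 'r)"
      have sg: "walls_sign ?H = (-1) ^ card {y \<in> T. y < x} * sT"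
        unfolding walls_sign_def sT_def using GT TD s by simp
      have sT2: "sT * sT = 1"
        by (simp add: sT_def flip: prod.distrib power_add mult_2)
      have W: "walls_of ?H - {T} = (\<lambda>j. ?H - {j}) ` T"
        using GT by (auto simp: walls_of_def)
      have inj: "inj_on (\<lambda>j. ?H - {j}) T"
        using inj_walls_of[of ?H] by (rule inj_on_subset) auto
      have "C * det_set A ?H ^ (d - 1) = (\<Prod>j\<in>T. replace_det A ?H j u)"
        using TD x by (simp add: y C_def prod.distrib)
      also have "\<dots> = sT * (\<Prod>T'\<in>walls_of ?H - {T}. face_det A T' u)"
        unfolding W by (simp add: prod.reindex[OF inj] replace_det_def prod.distrib sT_def)
      finally have CD: "C * det_set A ?H ^ (d - 1) = sT * (\<Prod>T'\<in>walls_of ?H - {T}. face_det A T' u)" .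
      have pm: "(\<Prod>j\<in>#m. replace_det A ?H j u) = cm * det_set A ?H ^ (d - 1)"
      proof -
        have "(\<Prod>j\<in>#m. replace_det A ?H j u) = (\<Prod>j\<in>#m. c j * det_set A ?H)"
          using True x y by (intro arg_cong[of _ _ prod_mset] image_mset_cong) auto
        then show ?thesis by (simp add: prod_mset.distrib cm_def m)
      qed
      have U: "walls - {T} = (walls_of ?H - {T}) \<union> (walls - walls_of ?H)"
        using TW walls_of_subset[OF apex(2)[OF x]] by auto
      have Z: "Z = (\<Prod>T'\<in>walls_of ?H - {T}. face_det A T' u) * (\<Prod>T'\<in>walls - walls_of ?H. face_det A T' u)"
        unfolding Z_def U using fW by (intro prod.union_disjoint) auto
      have "C * ?t ?H = e ?H * walls_sign ?H * cm * (C * det_set A ?H ^ (d - 1)) *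
          (\<Prod>T'\<in>walls - walls_of ?H. face_det A T' u)"
        unfolding pm by (simp add: mult_ac)
      also have "\<dots> = e ?H * (-1) ^ card {y \<in> T. y < x} * (sT * sT) * cm * Z"
        unfolding CD sg Z by (simp add: mult_ac)
      finally show ?thesis by (simp add: sT2 mult_ac)
    qed
    have "C \<noteq> 0"
    proof -
      have "c j \<noteq> 0" if j: "j \<in> T" for j
      proof -
        have "?G w - {j} \<in> walls" using walls_of_subset[of "?G w"] apex[of w] j by (auto simp: walls_of_def)
        moreover have "?G w - {j} \<noteq> T" using j by auto
        ultimately have "replace_det A (?G w) j u \<noteq> 0" by (simp add: nonzero replace_det_def)
        then show ?thesis using D0[of w] by (simp add: c_def)
      qed
      then show ?thesis using TD by (simp add: C_def)
    qed
    moreover have "C * (?t (?G w) + ?t (?G w')) = 0"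
    proof -
      have "C * (?t (?G w) + ?t (?G w')) = (e (?G w) * (-1) ^ card {x \<in> T. x < w}
          + e (?G w') * (-1) ^ card {x \<in> T. x < w'}) * (cm * Z)"
        by (simp only: distrib_left distrib_right contrib insert_iff simp_thms)
      also have "e (?G w) * (-1) ^ card {x \<in> T. x < w} + e (?G w') * (-1) ^ card {x \<in> T. x < w'} = 0"
        using apex facetD(1) ww TD by (intro e_wall) auto
      finally show ?thesis by simp
    qed
    ultimately have "?t (?G w) + ?t (?G w') = 0" by simp
    moreover have "{G \<in> {?G w, ?G w'}. set_mset m \<subseteq> G} = {?G w, ?G w'}"
      using True by auto
    moreover have "?G w \<noteq> ?G w'" using ww apex by auto
    ultimately show ?thesis by simp
  qed
  finally show ?thesis .
qed

text \<open>Along the line $v + sb$ the residue sum is a polynomial in $s$ of degree less than the number of walls, and each wall contributes a root.\<close>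

lemma residue_sum_eq_0:
  assumes m: "size m = d - 1"
  shows "residue_sum m v = 0"
proof -
  define q where "q T = [:face_det A T v, face_det A T b:]" for T
  define y where "y G j = [:replace_det A G j v, replace_det A G j b:]" for G j
  define N where "N = (\<Sum>G | G \<in> facets \<and> set_mset m \<subseteq> G. smult (e G * walls_sign G)
     ((\<Prod>j\<in>#m. y G j) * (\<Prod>T\<in>walls - walls_of G. q T)))"
  have q: "poly (q T) s = face_det A T (\<lambda>i. v i + s * b i)" for T s
    by (simp add: q_def det_front_add_smult)
  have y: "poly (y G j) s = replace_det A G j (\<lambda>i. v i + s * b i)" for G j s
    by (simp add: y_def replace_det_def det_front_add_smult algebra_simps)
  have pm: "poly (\<Prod>j\<in>#m. y G j) s = (\<Prod>j\<in>#m. poly (y G j) s)" for G s and m :: "nat multiset"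
    by (induction m) auto
  have poly_N: "poly N s = residue_sum m (\<lambda>i. v i + s * b i)" for s
    by (simp add: N_def poly_sum residue_sum_def poly_prod pm q y mult_ac)
  have dm: "Polynomial.degree (\<Prod>j\<in>#m. y G j) \<le> size m" for G and m :: "nat multiset"
  proof (induction m)
    case (add x m)
    have "Polynomial.degree (y G x) \<le> 1" by (simp add: y_def)
    then show ?case
      using add degree_mult_le[of "y G x" "\<Prod>j\<in>#m. y G j"] by simp
  qed simp
  \<comment> \<open>The \<open>d - 1\<close> factors from \<open>m\<close> and the
    \<open>card walls - d\<close> remaining walls are at most linear, which bounds the degree by
    \<open>card walls - 1\<close>.\<close>
  have "Polynomial.degree N < card walls"
  proof -
    have "Polynomial.degree ((\<Prod>j\<in>#m. y G j) * (\<Prod>T\<in>walls - walls_of G. q T)) < card walls"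
      if G: "G \<in> facets" for G
    proof -
      have "Polynomial.degree (\<Prod>T\<in>walls - walls_of G. q T) \<le> (\<Sum>T\<in>walls - walls_of G. Polynomial.degree (q T))"
        by (rule order.trans[OF degree_prod_sum_le]) auto
      also have "\<dots> \<le> (\<Sum>T\<in>walls - walls_of G. 1)"
        by (intro sum_mono) (simp add: q_def)
      also have "\<dots> = card walls - d"
        using walls_of_subset[OF G] card_walls_of[OF G] by (simp add: card_Diff_subset finite_subset)
      finally have "Polynomial.degree (\<Prod>T\<in>walls - walls_of G. q T) \<le> card walls - d" .
      moreover have "d \<le> card walls"
        using card_mono[OF finite_walls walls_of_subset[OF G]] card_walls_of[OF G] by simp
      ultimately show ?thesis
        using degree_mult_le[of "\<Prod>j\<in>#m. y G j" "\<Prod>T\<in>walls - walls_of G. q T"] dm[of G m] m d by linarith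
    qed
    moreover have "card walls > 0"
    proof -
      obtain F where "F \<in> \<Delta>" "card F = d" using ex_facet by auto
      then have F: "F \<in> facets" by (simp add: facets_def)
      show ?thesis
        using card_mono[OF finite_walls walls_of_subset[OF F]] card_walls_of[OF F] d by simp
    qed
    ultimately show ?thesis
      unfolding N_def by (intro degree_sum_less) (auto intro: le_less_trans[OF degree_smult_le])
  qed
  moreover define r where "r T = - face_det A T v / face_det A T b" for T
  have "inj_on r walls"
  proof (rule inj_onI, rule ccontr)
    fix T T' assume T: "T \<in> walls" "T' \<in> walls" "r T = r T'" "T \<noteq> T'"
    then have "face_det A T v * face_det A T' b = face_det A T' v * face_det A T b"
      using b_nonzero[of T] b_nonzero[of T'] by (auto simp: r_def walls_def field_simps)
    then show False using roots_distinct[of T T'] T by (auto simp: walls_def)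
  qed
  then have "card (r ` walls) = card walls" by (rule card_image)
  moreover have "r ` walls \<subseteq> {x. poly N x = 0}"
  proof clarify
    fix T assume T: "T \<in> walls"
    have T0: "face_det A T b \<noteq> 0" using b_nonzero T by (auto simp: walls_def)
    have "residue_sum m (\<lambda>i. v i + r T * b i) = 0"
    proof (rule residue_zero[OF T])
      show "face_det A T (\<lambda>i. v i + r T * b i) = 0"
        unfolding det_front_add_smult using T0 by (simp add: r_def)
      fix T' assume T': "T' \<in> walls" "T' \<noteq> T"
      have "face_det A T v * face_det A T' b \<noteq> face_det A T' v * face_det A T b"
        using roots_distinct[of T T'] T T' by (auto simp: walls_def)
      then show "face_det A T' (\<lambda>i. v i + r T * b i) \<noteq> 0"
        unfolding det_front_add_smult using T0 by (simp add: r_def field_simps)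
    qed (rule m)
    then show "poly N (r T) = 0" by (simp add: poly_N)
  qed
  ultimately have "N = 0"
    using card_poly_roots_bound[of N] card_mono[OF poly_roots_finite[of N]] by (metis leD order.trans)
  then show ?thesis using poly_N[of 0] by simp
qed

end

lemma sum_lists_prod:
  fixes f :: "'a \<Rightarrow> 'r::comm_ring_1"
  assumes "finite X"
  shows "(\<Sum>js | length js = n \<and> set js \<subseteq> X. \<Prod>j\<in>#mset js. f j) = (\<Sum>x\<in>X. f x) ^ n"
proof (induction n)
  case 0
  have "{js. length js = 0 \<and> set js \<subseteq> X} = {[]}" by auto
  then show ?case by simp
next
  case (Suc n)
  let ?S = "{js. length js = n \<and> set js \<subseteq> X}"
  have eq: "{js. length js = Suc n \<and> set js \<subseteq> X} = (\<lambda>(x, js). x # js) ` (X \<times> ?S)"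
    by (auto simp: length_Suc_conv image_iff)
  have "inj_on (\<lambda>(x, js). x # js) (X \<times> ?S)"
    by (auto simp: inj_on_def)
  then have "(\<Sum>js | length js = Suc n \<and> set js \<subseteq> X. \<Prod>j\<in>#mset js. f j)
      = (\<Sum>(x, js)\<in>X \<times> ?S. f x * (\<Prod>j\<in>#mset js. f j))"
    unfolding eq by (subst sum.reindex) (auto intro!: sum.cong)
  also have "\<dots> = (\<Sum>x\<in>X. f x) * (\<Sum>js\<in>?S. \<Prod>j\<in>#mset js. f j)"
    by (simp add: sum_product sum.cartesian_product)
  finally show ?case by (simp add: Suc.IH)
qed

context generic_manifold
begin

section \<open>The degree functional as a sum over facets, and its uniqueness\<close>

lemma replace_det_nonzero:
  assumes "G \<in> facets" "j \<in> G"
  shows "replace_det A G j v \<noteq> 0"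
proof -
  have "G - {j} \<in> walls" using walls_of_subset assms by (auto simp: walls_of_def)
  then show ?thesis using v_nonzero by (auto simp: walls_def replace_det_def)
qed

text \<open>Cramer coordinates of \<open>v\<close> in the basis \<open>G\<close>, extended by 0 so
  that a monomial with a variable outside \<open>G\<close> evaluates to 0.\<close>

definition xcoord :: "nat set \<Rightarrow> nat \<Rightarrow> 'r" where
  "xcoord G j = (if j \<in> G then replace_det A G j v / det_set A G else 0)"

definition degree_form :: "nat multiset \<Rightarrow> 'r" where
  "degree_form \<mu> = (if size \<mu> = d then \<Sum>G\<in>facets. e G * (\<Prod>j\<in>#\<mu>. xcoord G j) /
     (det_set A G * (\<Prod>j\<in>G. xcoord G j)) else 0)"

lemma prod_mset_xcoord:
  "(\<Prod>j\<in>#\<mu>. xcoord G j) = (if set_mset \<mu> \<subseteq> G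
     then (\<Prod>j\<in>#\<mu>. replace_det A G j v) / det_set A G ^ size \<mu> else 0)"
  by (induction \<mu>) (auto simp: xcoord_def)

lemma prod_xcoord:
  "G \<in> facets \<Longrightarrow> (\<Prod>j\<in>G. xcoord G j) = (\<Prod>j\<in>G. replace_det A G j v) / det_set A G ^ d"
  by (simp add: xcoord_def prod_dividef facetD)

lemma prod_xcoord_nonzero: "G \<in> facets \<Longrightarrow> (\<Prod>j\<in>G. xcoord G j) \<noteq> 0"
  using det_nonzero by (simp add: prod_xcoord facetD replace_det_nonzero)

lemma degree_form_nonface:
  assumes "set_mset \<mu> \<notin> \<Delta>"
  shows "degree_form \<mu> = 0"
proof -
  have "\<not> set_mset \<mu> \<subseteq> G" if "G \<in> facets" for G
    using assms face_down facetD(1)[OF that] by blast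
  then show ?thesis
    by (auto simp: degree_form_def prod_mset_xcoord intro!: sum.neutral)
qed

lemma degree_form_facet:
  assumes F: "F \<in> facets"
  shows "degree_form (mset_set F) = e F / det_set A F"
proof -
  have fin: "finite F" and size: "size (mset_set F) = d"
    using facetD[OF F] by auto
  have "\<not> F \<subseteq> G" if "G \<in> facets" "G \<noteq> F" for G
    using facetD[OF F] facetD[OF that(1)] that(2) card_subset_eq[of G F] by auto
  then have zero: "(\<Prod>j\<in>#mset_set F. xcoord G j) = 0" if "G \<in> facets" "G \<noteq> F" for G
    using that fin by (auto simp: prod_mset_xcoord)
  have "degree_form (mset_set F) = (\<Sum>G\<in>facets. e G * (\<Prod>j\<in>#mset_set F. xcoord G j) /
     (det_set A G * (\<Prod>j\<in>G. xcoord G j)))"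
    unfolding degree_form_def using size by simp
  also have "\<dots> = (\<Sum>G\<in>{F}. e G * (\<Prod>j\<in>#mset_set F. xcoord G j) /
     (det_set A G * (\<Prod>j\<in>G. xcoord G j)))"
    by (rule sum.mono_neutral_right) (use F zero in auto)
  also have "\<dots> = e F / det_set A F"
    using prod_xcoord_nonzero[OF F] by (simp add: prod_unfold_prod_mset)
  finally show ?thesis .
qed

text \<open>By Cramer's rule the form with coefficients \<open>A i j\<close> takes the same value
  \<open>v i\<close> at the point of every facet. It factors out and leaves the residue sum in
  degree \<open>d - 1\<close> over the product of all walls.\<close>

lemma degree_form_linear_system:
  assumes "i < d" and m: "size m = d - 1" and X: "finite X" "V \<subseteq> X" and v: "v = (\<lambda>i. A i x)"
  shows "(\<Sum>j\<in>X. A i j * degree_form (m + {#j#})) = 0"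
proof -
  have "(\<Sum>j\<in>X. A i j * degree_form (m + {#j#})) =
      (\<Sum>j\<in>X. \<Sum>G\<in>facets. e G * (\<Prod>j\<in>#m. xcoord G j) / (det_set A G * (\<Prod>j\<in>G. xcoord G j)) *
        (A i j * xcoord G j))"
    using m d by (auto simp: degree_form_def sum_distrib_left intro!: sum.cong)
  also have "\<dots> = (\<Sum>G\<in>facets. e G * (\<Prod>j\<in>#m. xcoord G j) / (det_set A G * (\<Prod>j\<in>G. xcoord G j)) *
        (\<Sum>j\<in>X. A i j * xcoord G j))"
    by (subst sum.swap) (simp add: sum_distrib_left)
  also have "\<dots> = (\<Sum>G | G \<in> facets \<and> set_mset m \<subseteq> G. v i / (\<Prod>T\<in>walls. face_det A T v) *
      (e G * walls_sign G * (\<Prod>j\<in>#m. replace_det A G j v) * (\<Prod>T\<in>walls - walls_of G. face_det A T v)))"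
  proof (rule sum.mono_neutral_cong_right)
    fix G assume "G \<in> {G. G \<in> facets \<and> set_mset m \<subseteq> G}"
    then have G: "G \<in> facets" "set_mset m \<subseteq> G" by auto
    let ?D = "det_set A G" and ?y = "\<Prod>j\<in>G. replace_det A G j v" and ?m = "\<Prod>j\<in>#m. replace_det A G j v"
    have D0: "?D \<noteq> 0" using det_nonzero facetD G by blast
    have y0: "?y \<noteq> 0" using replace_det_nonzero[OF G(1)] facetD[OF G(1)] by auto
    have GX: "G \<subseteq> X" using face_sub facetD(1)[OF G(1)] X by blast
    have "(\<Sum>j\<in>X. A i j * xcoord G j) = (\<Sum>j\<in>G. A i j * xcoord G j)"
      by (rule sum.mono_neutral_right) (use X GX in \<open>auto simp: xcoord_def\<close>)
    also have "\<dots> = (\<Sum>j\<in>G. A i j * replace_det A G j v) / ?D"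
      by (simp add: xcoord_def sum_divide_distrib)
    also have "\<dots> = v i"
      using cramer_solution_set[of G i A v] facetD[OF G(1)] D0 assms(1) by simp
    finally have cr: "(\<Sum>j\<in>X. A i j * xcoord G j) = v i" .
    have D: "?D ^ d = ?D * ?D ^ (d - 1)"
      using d by (metis Suc_diff_1 less_le_trans pos2 power_Suc)
    have pw: "(\<Prod>T\<in>walls. face_det A T v)
        = (\<Prod>T\<in>walls - walls_of G. face_det A T v) * (\<Prod>T\<in>walls_of G. face_det A T v)"
      using walls_of_subset[OF G(1)] by (intro prod.subset_diff) auto
    have nz: "(\<Prod>T\<in>walls. face_det A T v) \<noteq> 0"
      using v_nonzero by (subst prod_zero_iff) (auto simp: walls_def finite_complex)
    have sq: "walls_sign G * walls_sign G = 1" by (rule walls_sign_square)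
    then have s0: "walls_sign G \<noteq> 0" by auto
    have "1 / ?y = walls_sign G * (\<Prod>T\<in>walls - walls_of G. face_det A T v) / (\<Prod>T\<in>walls. face_det A T v)"
      using nz s0 sq unfolding prod_replace_det pw by (simp add: field_simps)
    moreover have "e G * (\<Prod>j\<in>#m. xcoord G j) / (?D * (\<Prod>j\<in>G. xcoord G j)) = e G * ?m * (1 / ?y)"
      using D0 y0 G(2) by (simp add: prod_xcoord[OF G(1)] prod_mset_xcoord m D)
    ultimately show "e G * (\<Prod>j\<in>#m. xcoord G j) / (?D * (\<Prod>j\<in>G. xcoord G j)) * (\<Sum>j\<in>X. A i j * xcoord G j)
      = v i / (\<Prod>T\<in>walls. face_det A T v) * (e G * walls_sign G * ?m * (\<Prod>T\<in>walls - walls_of G. face_det A T v))"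
      by (simp add: cr mult_ac)
  qed (auto simp: prod_mset_xcoord)
  also have "\<dots> = v i / (\<Prod>T\<in>walls. face_det A T v) * residue_sum m v"
    by (simp add: residue_sum_def sum_distrib_left)
  finally show ?thesis
    using residue_sum_eq_0[OF m] by simp
qed

text \<open>At the point of each facet the sum over words is a \<open>d\<close>-th power; it and the
  product of the coordinates are divided by the same power of \<open>[G]\<close>, which
  cancels.\<close>

lemma degree_form_power:
  assumes "finite X" "V \<subseteq> X"
  shows "(\<Sum>js | length js = d \<and> set js \<subseteq> X. degree_form (mset js)) =
    (\<Sum>G\<in>facets. e G * (\<Sum>j\<in>G. replace_det A G j v) ^ d /
      (det_set A G * (\<Prod>j\<in>G. replace_det A G j v)))"
proof -
  have "(\<Sum>js | length js = d \<and> set js \<subseteq> X. degree_form (mset js)) =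
      (\<Sum>G\<in>facets. \<Sum>js | length js = d \<and> set js \<subseteq> X.
        e G / (det_set A G * (\<Prod>j\<in>G. xcoord G j)) * (\<Prod>j\<in>#mset js. xcoord G j))"
    by (subst sum.swap) (auto simp: degree_form_def intro!: sum.cong)
  also have "\<dots> = (\<Sum>G\<in>facets. e G / (det_set A G * (\<Prod>j\<in>G. xcoord G j)) * (\<Sum>j\<in>X. xcoord G j) ^ d)"
    by (simp only: sum_distrib_left[symmetric] sum_lists_prod[OF assms(1)])
  also have "\<dots> = (\<Sum>G\<in>facets. e G * (\<Sum>j\<in>G. replace_det A G j v) ^ d /
      (det_set A G * (\<Prod>j\<in>G. replace_det A G j v)))"
  proof (rule sum.cong[OF refl])
    fix G assume G: "G \<in> facets"
    have D0: "det_set A G \<noteq> 0" using det_nonzero facetD G by blast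
    have GX: "G \<subseteq> X" using face_sub facetD(1)[OF G] assms by blast
    have "(\<Sum>j\<in>X. xcoord G j) = (\<Sum>j\<in>G. xcoord G j)"
      by (rule sum.mono_neutral_right) (use assms GX in \<open>auto simp: xcoord_def\<close>)
    also have "\<dots> = (\<Sum>j\<in>G. replace_det A G j v) / det_set A G"
      by (simp add: xcoord_def sum_divide_distrib)
    finally show "e G / (det_set A G * (\<Prod>j\<in>G. xcoord G j)) * (\<Sum>j\<in>X. xcoord G j) ^ d =
      e G * (\<Sum>j\<in>G. replace_det A G j v) ^ d / (det_set A G * (\<Prod>j\<in>G. replace_det A G j v))"
      using D0 by (simp add: prod_xcoord[OF G] power_divide)
  qed
  finally show ?thesis .
qed

text \<open>Downward induction on the size of the support. Square-free monomials of degree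
  \<open>d\<close> are facets. Otherwise split off a repeated variable,
  \<open>\<mu> = m + {#j#}\<close>, and choose a facet \<open>G\<close> containing the support: by
  induction the linear relations for \<open>m\<close> involve only variables of \<open>G\<close>,
  and the matrix of \<open>G\<close> is invertible.\<close>

lemma degree_form_unique:
  fixes E :: "nat multiset \<Rightarrow> 'r"
  assumes off: "\<And>\<mu>. \<not> (size \<mu> = d \<and> set_mset \<mu> \<subseteq> V \<and> set_mset \<mu> \<in> \<Delta>) \<Longrightarrow> E \<mu> = 0"
    and lin: "\<And>i m. i < d \<Longrightarrow> size m = d - 1 \<Longrightarrow> set_mset m \<subseteq> V \<Longrightarrow> (\<Sum>j\<in>V. A i j * E (m + {#j#})) = 0"
    and facet: "\<And>F. F \<in> facets \<Longrightarrow> E (mset_set F) = 0"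
  shows "E \<mu> = 0"
proof (induction "d - card (set_mset \<mu>)" arbitrary: \<mu> rule: less_induct)
  case less
  show ?case
  proof (cases "size \<mu> = d \<and> set_mset \<mu> \<in> \<Delta>")
    case False
    then show ?thesis using off by blast
  next
    case True
    then have \<mu>: "size \<mu> = d" "set_mset \<mu> \<in> \<Delta>" "set_mset \<mu> \<subseteq> V"
      using face_sub by auto
    show ?thesis
    proof (cases "\<forall>x. count \<mu> x \<le> 1")
      case True
      have "\<mu> = mset_set (set_mset \<mu>)"
      proof (rule multiset_eqI)
        fix x
        have "count \<mu> x = 0 \<or> count \<mu> x = 1" using True by (metis le_neq_implies_less less_one)
        then show "count \<mu> x = count (mset_set (set_mset \<mu>)) x"
          by (auto simp: count_mset_set' count_eq_zero_iff)
      qed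
      moreover from this have "card (set_mset \<mu>) = d"
        using \<mu>(1) by (metis size_mset_set)
      ultimately show ?thesis using facet[of "set_mset \<mu>"] \<mu> by (simp add: facets_def)
    next
      case False
      then obtain j where j: "count \<mu> j \<ge> 2" by (metis not_less_eq_eq One_nat_def numeral_2_eq_2)
      define m where "m = \<mu> - {#j#}"
      have jm: "j \<in># \<mu>" using j by (metis count_greater_zero_iff less_le_trans pos2)
      have \<mu>m: "\<mu> = m + {#j#}" using jm by (simp add: m_def)
      have "j \<in># m" using j by (simp add: m_def flip: count_greater_zero_iff)
      then have set: "set_mset m = set_mset \<mu>" unfolding \<mu>m by auto
      have size: "size m = d - 1" using \<mu>(1) unfolding \<mu>m by simp
      obtain G where G: "G \<in> \<Delta>" "set_mset \<mu> \<subseteq> G" "card G = d" using pure \<mu>(2) by blast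
      \<comment> \<open>Adding a vertex outside \<open>G\<close> either enlarges the support within
        the complex, which the induction covers, or leaves the complex.\<close>
      have other: "E (m + {#l#}) = 0" if l: "l \<notin> G" for l
      proof (cases "insert l (set_mset \<mu>) \<in> \<Delta>")
        case True
        have "card (insert l (set_mset \<mu>)) = Suc (card (set_mset \<mu>))"
          using l G(2) by (subst card_insert_disjoint) auto
        then show ?thesis
          using face_card_le[OF True] by (intro less.hyps) (simp add: set)
      qed (use off set in auto)
      have "E (m + {#j#}) * det_set A G = replace_det A G j (\<lambda>_. 0)"
      proof (rule cramer_coeff_set[symmetric, where c = "\<lambda>l. E (m + {#l#})"])
        fix i assume i: "i < card G"
        have "0 = (\<Sum>l\<in>V. A i l * E (m + {#l#}))"
          using lin[of i m] i G size set \<mu> by simp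
        also have "\<dots> = (\<Sum>l\<in>G. A i l * E (m + {#l#}))"
          by (rule sum.mono_neutral_right) (use finite_V face_sub[OF G(1)] other in auto)
        finally show "0 = (\<Sum>l\<in>G. E (m + {#l#}) * A i l)" by (simp add: mult.commute)
      qed (use G face_finite jm in auto)
      also have "\<dots> = 0" by (simp add: replace_det_def det_front_def)
      finally show ?thesis
        using det_nonzero G \<mu>m by auto
    qed
  qed
qed

end

subsection \<open>Poles along facets\<close>

lemma det_front_hom:
  assumes "comm_ring_hom h"
  shows "h (det_front A M v) = det_front (\<lambda>i j. h (A i j)) M (\<lambda>i. h (v i))"
proof -
  interpret comm_ring_hom h by fact
  have "h (front_minor A M i) = front_minor (\<lambda>i j. h (A i j)) M i" for i
    unfolding front_minor_def hom_mult hom_det[symmetric] hom_power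
    by (intro arg_cong2[of _ _ _ _ "(*)"] arg_cong[of _ _ det] eq_matI) (auto simp: hom_uminus)
  then show ?thesis by (simp add: det_front_def hom_sum hom_mult)
qed

lemma replace_det_hom:
  assumes "comm_ring_hom h"
  shows "h (replace_det A G j v) = replace_det (\<lambda>i j. h (A i j)) G j (\<lambda>i. h (v i))"
proof -
  interpret comm_ring_hom h by fact
  show ?thesis
    by (simp add: replace_det_def hom_mult hom_power hom_uminus det_front_hom[OF comm_ring_hom_axioms])
qed

lemma det_cols_map: "det_cols (\<lambda>i x. A i (f x)) L = det_cols A (map f L)"
  unfolding det_cols_def by (intro arg_cong[of _ _ det] eq_matI) auto

lemma det_cols_Cons: "det_cols A (x # M) = det_front A M (\<lambda>i. A i x)"
  using det_cols_laplace[of 0 "x # M" A] by (simp add: list_del_def)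

lemma comm_ring_hom_Fract: "comm_ring_hom (\<lambda>p::'a::idom. Fract p 1)"
  by unfold_locales (auto simp: Zero_fract_def One_fract_def)

abbreviation gen_matK :: "nat \<Rightarrow> nat \<Rightarrow> 'k::field ratfun" where
  "gen_matK i j \<equiv> aK (Suc i) j"

lemma det_cols_gen_matK: "det_cols gen_matK L = Fract (det_cols gen_mat L) 1"
  by (simp add: det_cols_hom[OF comm_ring_hom_Fract] aK_def)

lemma Fract_eq_0_iff: "b \<noteq> 0 \<Longrightarrow> Fract a b = 0 \<longleftrightarrow> a = (0 :: 'a::idom)"
  by (simp add: Zero_fract_def eq_fract)

lemma sum_Fract:
  fixes N D :: "'i \<Rightarrow> 'a::idom"
  assumes "finite S" "\<And>i. i \<in> S \<Longrightarrow> D i \<noteq> 0"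
  shows "(\<Sum>i\<in>S. Fract (N i) (D i)) = Fract (\<Sum>i\<in>S. N i * (\<Prod>j\<in>S - {i}. D j)) (\<Prod>i\<in>S. D i)"
proof -
  let ?D = "\<Prod>i\<in>S. D i" and ?N = "\<lambda>i. N i * (\<Prod>j\<in>S - {i}. D j)"
  have D0: "?D \<noteq> 0" using assms by simp
  then have nz: "Fract ?D 1 \<noteq> 0" by (simp add: Fract_eq_0_iff)
  have "(\<Sum>i\<in>S. Fract (N i) (D i)) * Fract ?D 1 = (\<Sum>i\<in>S. Fract (N i) (D i) * Fract ?D 1)"
    by (rule sum_distrib_right)
  also have "\<dots> = (\<Sum>i\<in>S. Fract (?N i) 1)"
  proof (rule sum.cong[OF refl])
    fix i assume i: "i \<in> S"
    then have "?D = D i * (\<Prod>j\<in>S - {i}. D j)" by (rule prod.remove[OF assms(1)])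
    then show "Fract (N i) (D i) * Fract ?D 1 = Fract (?N i) 1"
      using assms(2)[OF i] by (simp add: eq_fract)
  qed
  also have "\<dots> = Fract (\<Sum>i\<in>S. ?N i) 1"
  proof -
    interpret F: comm_ring_hom "\<lambda>p::'a. Fract p 1" by (rule comm_ring_hom_Fract)
    show ?thesis by (rule F.hom_sum[symmetric])
  qed
  also have "\<dots> = Fract (\<Sum>i\<in>S. ?N i) ?D * Fract ?D 1"
    using D0 by (simp add: eq_fract)
  finally show ?thesis
    using mult_right_cancel[OF nz] by blast
qed

lemma not_dvd_by_eval:
  fixes \<sigma> :: "nat \<Rightarrow> nat \<Rightarrow> 'k::field"
  assumes "det_cols \<sigma> L = 0" "mpoly_eval (\<lambda>x. x) (\<lambda>(i, j). \<sigma> (i - 1) j) p \<noteq> 0"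
  shows "\<not> det_cols gen_mat L dvd p"
proof
  interpret comm_ring_hom "mpoly_eval (\<lambda>x::'k. x) (\<lambda>(i, j). \<sigma> (i - 1) j)"
    by (rule comm_ring_hom_mpoly_eval[OF comm_ring_hom_id])
  assume "det_cols gen_mat L dvd p"
  then obtain q where p: "p = det_cols gen_mat L * q" by (elim dvdE)
  have "mpoly_eval (\<lambda>x. x) (\<lambda>(i, j). \<sigma> (i - 1) j) p = 0"
    unfolding p hom_mult using assms(1) by (simp add: mpoly_eval_det_cols comm_ring_hom_id)
  then show False using assms(2) by simp
qed

lemma det_cols_unit_cols_eq_0:
  assumes "length L = length X" "x \<in> set L" "x \<notin> set X"
  shows "det_cols (unit_cols X) L = 0"
  by (rule det_cols_zero_column[of x]) (use assms in \<open>auto simp: unit_cols_def\<close>)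

text \<open>At the 0/1 point of \<open>X\<close> the determinant of \<open>X\<close> is 1 and that
  of \<open>L\<close> has a zero column.\<close>

lemma det_cols_not_dvd:
  assumes "distinct X" "distinct L" "length X = length L" "set X \<noteq> set L"
  shows "\<not> det_cols gen_mat L dvd (det_cols gen_mat X :: 'k::field mpoly)"
proof -
  have "\<not> set L \<subseteq> set X"
    using assms card_subset_eq[of "set X" "set L"] by (auto simp: distinct_card)
  then obtain x where "x \<in> set L" "x \<notin> set X" by auto
  then have "det_cols (unit_cols X :: _ \<Rightarrow> _ \<Rightarrow> 'k) L = 0"
    using assms(3) by (intro det_cols_unit_cols_eq_0) auto
  then show ?thesis
    by (rule not_dvd_by_eval)
       (simp add: mpoly_eval_det_cols comm_ring_hom_id det_cols_unit_cols assms)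
qed

text \<open>The vertices are 1 to \<open>n\<close>, so the label 0 is free: its column of
  indeterminates serves as the generic vector \<open>v\<close>.\<close>

abbreviation gen_replace :: "nat set \<Rightarrow> nat \<Rightarrow> 'k::field mpoly" where
  "gen_replace G j \<equiv> replace_det gen_mat G j (\<lambda>i. gen_mat i 0)"

definition replace_list :: "nat set \<Rightarrow> nat \<Rightarrow> nat list" where
  "replace_list G j = (sorted_list_of_set G)[card {x \<in> G. x < j} := 0]"

lemma replace_list:
  assumes "finite G" "j \<in> G" "0 \<notin> G"
  shows "distinct (replace_list G j)" "length (replace_list G j) = card G"
    "set (replace_list G j) = insert 0 (G - {j})"
    "replace_det A G j (\<lambda>i. A i 0) = det_cols A (replace_list G j)"
proof -
  let ?L = "sorted_list_of_set G"
  obtain k where k: "k < card G" "j = ?L ! k"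
    using bij_betw_nth_sorted_list[OF assms(1)] assms(2) by (auto simp: bij_betw_def)
  then have L: "replace_list G j = ?L[k := 0]"
    using card_less_nth_sorted_list[OF assms(1) k(1)] by (simp add: replace_list_def)
  show "distinct (replace_list G j)"
    unfolding L using assms by (intro distinct_list_update) auto
  show "length (replace_list G j) = card G"
    unfolding L by simp
  have "set (?L[k := 0]) = insert 0 (set ?L - {?L ! k})"
    using k assms by (intro set_update_distinct) auto
  then show "set (replace_list G j) = insert 0 (G - {j})"
    unfolding L using assms k by simp
  show "replace_det A G j (\<lambda>i. A i 0) = det_cols A (replace_list G j)"
    unfolding k(2) using L k assms(1) by (simp add: replace_det_eq_det_cols)
qed

lemma prime_elem_det_set:
  "finite F \<Longrightarrow> F \<noteq> {} \<Longrightarrow> prime_elem (det_set gen_mat F :: 'k::field mpoly)"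
  by (intro prime_elem_det_cols) auto

lemma det_set_not_dvd_gen_replace:
  assumes "finite F" "finite G" "card F = card G" "j \<in> G" "0 \<notin> G" "0 \<notin> F"
  shows "\<not> det_set gen_mat F dvd (gen_replace G j :: 'k::field mpoly)"
proof -
  note X = replace_list[OF assms(2,4,5)]
  show ?thesis
    unfolding X(4)[of gen_mat] using X(1-3) assms by (intro det_cols_not_dvd) auto
qed

text \<open>At the 0/1 point of \<open>F\<close> with \<open>j\<close> replaced by 0, column
  \<open>j\<close> is zero. It occurs in \<open>[F]\<close> and in every \<open>[F, l]\<close> with
  \<open>l \<noteq> j\<close>, while \<open>[F, j]\<close> becomes 1.\<close>

lemma det_set_not_dvd_sum_gen_replace:
  assumes "finite F" "j \<in> F" "0 \<notin> F"
  shows "\<not> det_set gen_mat F dvd (\<Sum>j\<in>F. gen_replace F j :: 'k::field mpoly)"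
proof -
  let ?X = "replace_list F j"
  note X = replace_list[OF assms]
  let ?U = "unit_cols ?X :: nat \<Rightarrow> nat \<Rightarrow> 'k"
  define ev where "ev = mpoly_eval (\<lambda>x. x) (\<lambda>(i, j). ?U (i - 1) j)"
  interpret comm_ring_hom ev
    unfolding ev_def by (rule comm_ring_hom_mpoly_eval[OF comm_ring_hom_id])
  have ev_avar: "ev (avar i j) = ?U (i - 1) j" for i j
    by (simp add: ev_def comm_ring_hom_id)
  have ev_repl: "ev (gen_replace F l) = replace_det ?U F l (\<lambda>i. ?U i 0)" for l
    unfolding replace_det_hom[OF comm_ring_hom_axioms] by (simp add: ev_avar)
  have "replace_det ?U F l (\<lambda>i. ?U i 0) = 0" if l: "l \<in> F" "l \<noteq> j" for l
  proof -
    note Y = replace_list[OF assms(1) l(1) assms(3)]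
    show ?thesis
      unfolding Y(4)[of ?U] using Y(2,3) X(2,3) assms l by (intro det_cols_unit_cols_eq_0[of _ _ j]) auto
  qed
  then have "(\<Sum>l\<in>F. replace_det ?U F l (\<lambda>i. ?U i 0)) = (\<Sum>l\<in>{j}. replace_det ?U F l (\<lambda>i. ?U i 0))"
    using assms by (intro sum.mono_neutral_right) auto
  also have "\<dots> = 1" by (simp add: X(4)[of ?U] det_cols_unit_cols X(1))
  finally have "ev (\<Sum>j\<in>F. gen_replace F j) \<noteq> 0" by (simp add: hom_sum ev_repl)
  moreover have "det_cols ?U (sorted_list_of_set F) = 0"
    using X(2,3) assms by (intro det_cols_unit_cols_eq_0[of _ _ j]) auto
  ultimately show ?thesis
    unfolding ev_def by (intro not_dvd_by_eval)
qed

section \<open>The generic matrix with two auxiliary columns\<close>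

locale oriented_manifold = manifold K \<Delta> "{1..n}" d
  for K :: "'k::field itself" and \<Delta> n d +
  fixes ori :: "nat set \<Rightarrow> nat list"
  assumes ori: "CHAR('k) \<noteq> 2 \<longrightarrow> oriented \<Delta> d ori"
begin

abbreviation eps :: "nat set \<Rightarrow> 'k mpoly" where
  "eps G \<equiv> Poly_Mapping.single 0 (epsilon TYPE('k) ori G)"

lemma face_no_0: "F \<in> \<Delta> \<Longrightarrow> 0 \<notin> F" "F \<in> \<Delta> \<Longrightarrow> Suc n \<notin> F"
  using face_sub by fastforce+

lemma gen_wall_distinct:
  assumes "T \<in> \<Delta>" "x = 0 \<or> x = Suc n"
  shows "distinct (x # sorted_list_of_set T)"
  using assms face_no_0 face_finite by auto

text \<open>Identify the auxiliary column \<open>Suc n\<close> with a column \<open>t\<close> of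
  \<open>T'\<close> that is not in \<open>T\<close>: one side acquires a repeated column and
  vanishes, the other remains a product of nonzero generic determinants.\<close>

lemma gen_roots_distinct:
  assumes T: "T \<in> \<Delta>" "T' \<in> \<Delta>" "card T = card T'" "T \<noteq> T'"
  shows "det_cols gen_mat (0 # sorted_list_of_set T) * det_cols gen_mat (Suc n # sorted_list_of_set T')
    \<noteq> (det_cols gen_mat (0 # sorted_list_of_set T') * det_cols gen_mat (Suc n # sorted_list_of_set T) :: 'k mpoly)"
proof
  let ?c = "Poly_Mapping.single 0 :: 'k \<Rightarrow> 'k mpoly"
  assume eq: "det_cols gen_mat (0 # sorted_list_of_set T) * det_cols gen_mat (Suc n # sorted_list_of_set T')
    = (det_cols gen_mat (0 # sorted_list_of_set T') * det_cols gen_mat (Suc n # sorted_list_of_set T) :: 'k mpoly)"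
  have fin: "finite T" "finite T'" using T face_finite by auto
  have "\<not> T' \<subseteq> T" using T fin card_subset_eq by metis
  then obtain t where t: "t \<in> T'" "t \<notin> T" by auto
  define f where "f x = (if x = Suc n then t else x)" for x
  define h where "h = mpoly_eval ?c (\<lambda>(i, j). avar i (f j))"
  interpret comm_ring_hom h
    unfolding h_def by (rule comm_ring_hom_mpoly_eval[OF comm_ring_hom_const_mpoly])
  have h: "h (det_cols gen_mat L) = det_cols gen_mat (map f L)" for L
    using det_cols_map[of gen_mat f L]
    by (simp add: h_def mpoly_eval_det_cols[OF comm_ring_hom_const_mpoly])
  have map: "map f (sorted_list_of_set S) = sorted_list_of_set S" if "S \<in> \<Delta>" for S
    using face_no_0(2)[OF that] face_finite[OF that] by (intro map_idI) (auto simp: f_def)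
  have f: "f 0 = 0" "f (Suc n) = t" by (auto simp: f_def)
  have t0: "t \<noteq> 0" using t T face_no_0 by metis
  have "h (det_cols gen_mat (Suc n # sorted_list_of_set T')) = 0"
    unfolding h using t fin by (intro det_cols_not_distinct) (simp add: f map T)
  moreover have "h (det_cols gen_mat (Suc n # sorted_list_of_set T)) \<noteq> 0"
    unfolding h using t fin by (intro det_cols_gen_mat_nonzero) (simp add: f map T)
  moreover have "h (det_cols gen_mat (0 # sorted_list_of_set T')) \<noteq> 0"
    unfolding h using fin face_no_0 T by (intro det_cols_gen_mat_nonzero) (simp add: f map T)
  ultimately show False
    using arg_cong[OF eq, of h] by (simp add: hom_mult)
qed

text \<open>The label \<open>Suc n\<close> is a second free label; its column gives the direction
  \<open>b\<close>.\<close>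

sublocale generic_manifold K \<Delta> "{1..n}" d gen_matK "\<lambda>i. gen_matK i 0" "\<lambda>i. gen_matK i (Suc n)"
  "\<lambda>G. Fract (eps G) 1"
proof
  show "det_set gen_matK G \<noteq> (0 :: 'k ratfun)" if "G \<in> \<Delta>" "card G = d" for G
    using det_cols_gen_mat_nonzero[of "sorted_list_of_set G", where ?'k = 'k]
    by (simp add: det_cols_gen_matK Fract_eq_0_iff)
  have wall: "face_det gen_matK T (\<lambda>i. gen_matK i x) = (Fract (det_cols gen_mat (x # sorted_list_of_set T)) 1 :: 'k ratfun)"
    for T x using det_cols_gen_matK[of "x # sorted_list_of_set T", where ?'a = 'k]
    by (simp only: det_cols_Cons)
  have wall_nz: "face_det gen_matK T (\<lambda>i. gen_matK i x) \<noteq> (0 :: 'k ratfun)" if "T \<in> \<Delta>" "x = 0 \<or> x = Suc n" for T x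
    unfolding wall using det_cols_gen_mat_nonzero[OF gen_wall_distinct[OF that], where ?'k = 'k]
    by (simp add: Fract_eq_0_iff)
  show "face_det gen_matK T (\<lambda>i. gen_matK i 0) \<noteq> (0 :: 'k ratfun)" if "T \<in> \<Delta>" for T
    using wall_nz[of T 0] that by simp
  show "face_det gen_matK T (\<lambda>i. gen_matK i (Suc n)) \<noteq> (0 :: 'k ratfun)" if "T \<in> \<Delta>" for T
    using wall_nz[of T "Suc n"] that by simp
  show "face_det gen_matK T (\<lambda>i. gen_matK i 0) * face_det gen_matK T' (\<lambda>i. gen_matK i (Suc n))
    \<noteq> face_det gen_matK T' (\<lambda>i. gen_matK i 0) * (face_det gen_matK T (\<lambda>i. gen_matK i (Suc n)) :: 'k ratfun)"
    if "T \<in> \<Delta>" "card T = d - 1" "T' \<in> \<Delta>" "card T' = d - 1" "T \<noteq> T'" for T T'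
    unfolding wall using gen_roots_distinct[of T T'] that by (simp add: eq_fract)
  fix T w w'
  assume T: "card T = d - 1" "w \<notin> T" "w' \<notin> T" "w \<noteq> w'" "insert w T \<in> \<Delta>" "insert w' T \<in> \<Delta>"
  interpret c: comm_ring_hom "\<lambda>c. Fract (Poly_Mapping.single 0 c) 1 :: 'k ratfun"
    by (rule comm_ring_hom_comp[OF comm_ring_hom_Fract comm_ring_hom_const_mpoly])
  show "Fract (eps (insert w T)) 1 * (-1) ^ card {x \<in> T. x < w}
      + Fract (eps (insert w' T)) 1 * (-1) ^ card {x \<in> T. x < w'} = 0"
    using arg_cong[OF epsilon_wall[OF ori T], of "\<lambda>c. Fract (Poly_Mapping.single 0 c) 1 :: 'k ratfun"]
    by (simp only: c.hom_add c.hom_mult c.hom_power c.hom_uminus c.hom_one c.hom_zero)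
qed

lemma is_deg_functional_degree_form: "is_deg_functional \<Delta> n d ori degree_form"
  unfolding is_deg_functional_def
proof (intro conjI allI impI ballI)
  fix \<mu> assume "\<not> (size \<mu> = d \<and> set_mset \<mu> \<subseteq> {1..n} \<and> set_mset \<mu> \<in> \<Delta>)"
  then have "size \<mu> \<noteq> d \<or> set_mset \<mu> \<notin> \<Delta>" using face_sub by blast
  then show "degree_form \<mu> = 0"
  proof
    assume "size \<mu> \<noteq> d"
    then show ?thesis by (simp add: degree_form_def)
  qed (rule degree_form_nonface)
next
  fix i m assume "i \<in> {1..d}" "size m = d - 1 \<and> set_mset m \<subseteq> {1..n}"
  then show "(\<Sum>j\<in>{1..n}. aK i j * degree_form (m + {#j#})) = 0"
    using degree_form_linear_system[of "i - 1" m "{1..n}" 0] by (cases i) auto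
next
  fix F assume "facet \<Delta> F"
  then have F: "F \<in> facets" by (simp add: facet_iff facets_def)
  show "degree_form (mset_set F) = Fract (eps F) 1 / Fract (bracket d F) 1"
    using facetD[OF F] by (simp add: degree_form_facet[OF F] det_cols_gen_matK bracket_eq_det_cols)
qed

lemma deg_fun_eq: "deg_fun \<Delta> n d ori = degree_form"
  unfolding deg_fun_def
proof (rule the_equality[where P = "is_deg_functional \<Delta> n d ori"])
  fix D :: "nat multiset \<Rightarrow> 'k ratfun" assume D: "is_deg_functional \<Delta> n d ori D"
  note 1 = D[unfolded is_deg_functional_def]
  note 2 = is_deg_functional_degree_form[unfolded is_deg_functional_def]
  have "D \<mu> - degree_form \<mu> = 0" for \<mu>
  proof (rule degree_form_unique)
    fix \<mu> assume "\<not> (size \<mu> = d \<and> set_mset \<mu> \<subseteq> {1..n} \<and> set_mset \<mu> \<in> \<Delta>)"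
    then show "D \<mu> - degree_form \<mu> = 0"
      using 1[THEN conjunct1, rule_format, of \<mu>] 2[THEN conjunct1, rule_format, of \<mu>] by simp
  next
    fix i m assume "i < d" and m: "size m = d - 1" "set_mset m \<subseteq> {1..n}"
    then have i: "Suc i \<in> {1..d}" by auto
    have "(\<Sum>j\<in>{1..n}. gen_matK i j * D (m + {#j#})) = 0"
      using 1[THEN conjunct2, THEN conjunct1, rule_format, OF i, of m] m by blast
    moreover have "(\<Sum>j\<in>{1..n}. gen_matK i j * degree_form (m + {#j#})) = 0"
      using 2[THEN conjunct2, THEN conjunct1, rule_format, OF i, of m] m by blast
    ultimately show "(\<Sum>j\<in>{1..n}. gen_matK i j * (D (m + {#j#}) - degree_form (m + {#j#}))) = 0"
      by (simp add: right_diff_distrib sum_subtractf)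
  next
    fix F assume "F \<in> facets"
    then have "facet \<Delta> F" by (simp add: facet_iff facets_def)
    then show "D (mset_set F) - degree_form (mset_set F) = 0"
      using 1[THEN conjunct2, THEN conjunct2, rule_format, of F] 2[THEN conjunct2, THEN conjunct2, rule_format, of F]
      by simp
  qed
  then show "D = degree_form" by (simp add: fun_eq_iff)
qed (rule is_deg_functional_degree_form)

section \<open>The closed formula for the power of the linear form, and its pole along a
  facet\<close>

definition num :: "nat set \<Rightarrow> 'k mpoly" where
  "num G = eps G * (\<Sum>j\<in>G. gen_replace G j) ^ d"

definition den :: "nat set \<Rightarrow> 'k mpoly" where
  "den G = det_set gen_mat G * (\<Prod>j\<in>G. gen_replace G j)"

lemma den_nonzero:
  assumes "G \<in> facets"
  shows "den G \<noteq> 0"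
proof -
  have "gen_replace G j \<noteq> (0 :: 'k mpoly)" if "j \<in> G" for j
    using det_set_not_dvd_gen_replace[of G G j, where ?'k = 'k] facetD[OF assms] face_no_0 that by auto
  then show ?thesis
    using facetD[OF assms] by (simp add: den_def det_cols_gen_mat_nonzero)
qed

lemma deg_ell_pow_eq:
  "deg_ell_pow TYPE('k) \<Delta> n d ori = Fract (\<Sum>G\<in>facets. num G * (\<Prod>H\<in>facets - {G}. den H)) (\<Prod>G\<in>facets. den G)"
proof -
  interpret F: comm_ring_hom "\<lambda>p::'k mpoly. Fract p 1" by (rule comm_ring_hom_Fract)
  have repl: "replace_det gen_matK G j (\<lambda>i. gen_matK i 0) = (Fract (gen_replace G j) 1 :: 'k ratfun)" for G j
    using replace_det_hom[OF F.comm_ring_hom_axioms, of gen_mat G j "\<lambda>i. gen_mat i 0"]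
    by (simp add: aK_def)
  have "deg_ell_pow TYPE('k) \<Delta> n d ori = (\<Sum>G\<in>facets. Fract (num G) (den G))"
    unfolding deg_ell_pow_def deg_fun_eq
  proof (subst degree_form_power)
    show "(\<Sum>G\<in>facets. Fract (eps G) 1 * (\<Sum>j\<in>G. replace_det gen_matK G j (\<lambda>i. gen_matK i 0)) ^ d /
      (det_set gen_matK G * (\<Prod>j\<in>G. replace_det gen_matK G j (\<lambda>i. gen_matK i 0)))) =
      (\<Sum>G\<in>facets. Fract (num G) (den G))"
    proof (rule sum.cong[OF refl])
      fix G assume "G \<in> facets"
      then have "den G \<noteq> 0" by (rule den_nonzero)
      then have "Fract (num G) (den G) = Fract (num G) 1 / Fract (den G) 1" by simp
      also have "\<dots> = Fract (eps G) 1 * (\<Sum>j\<in>G. Fract (gen_replace G j) 1) ^ d /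
          (Fract (det_set gen_mat G) 1 * (\<Prod>j\<in>G. Fract (gen_replace G j) 1))"
        unfolding num_def den_def by (simp only: F.hom_mult F.hom_power F.hom_sum F.hom_prod)
      finally show "Fract (eps G) 1 * (\<Sum>j\<in>G. replace_det gen_matK G j (\<lambda>i. gen_matK i 0)) ^ d /
        (det_set gen_matK G * (\<Prod>j\<in>G. replace_det gen_matK G j (\<lambda>i. gen_matK i 0))) = Fract (num G) (den G)"
        by (simp only: repl det_cols_gen_matK)
    qed
  qed auto
  also have "\<dots> = Fract (\<Sum>G\<in>facets. num G * (\<Prod>H\<in>facets - {G}. den H)) (\<Prod>G\<in>facets. den G)"
    by (rule sum_Fract) (auto simp: den_nonzero)
  finally show ?thesis .
qed

lemma eps_unit: "eps G dvd 1"
proof -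
  have "eps G * Poly_Mapping.single 0 (inverse (epsilon TYPE('k) ori G)) = 1"
    using epsilon_nonzero[of ori G, where ?'k = 'k] by (simp add: Poly_Mapping.mult_single)
  then show ?thesis by (metis dvd_triv_left)
qed

lemma prime_not_dvd_prod:
  fixes P :: "'a::comm_semiring_1"
  assumes "prime_elem P" "finite S" "\<And>x. x \<in> S \<Longrightarrow> \<not> P dvd f x"
  shows "\<not> P dvd prod f S"
  using assms(2,3)
proof (induction S rule: finite_induct)
  case empty
  then show ?case using assms(1) by (simp add: prime_elem_def)
qed (use assms(1) in \<open>auto simp: prime_elem_dvd_mult_iff\<close>)

text \<open>The column set of every factor of \<open>den G\<close> differs from \<open>F\<close>: it
  is \<open>G\<close> or contains the label 0.\<close>

lemma det_set_not_dvd_den: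
  assumes F: "F \<subseteq> {1..n}" "card F = d" and G: "G \<in> facets" "G \<noteq> F"
  shows "\<not> det_set gen_mat F dvd den G"
proof -
  have fin: "finite F" "0 \<notin> F" "F \<noteq> {}" using F finite_subset d by auto
  then have P: "prime_elem (det_set gen_mat F :: 'k mpoly)" by (intro prime_elem_det_set)
  have "\<not> det_set gen_mat F dvd (det_set gen_mat G :: 'k mpoly)"
    using facetD[OF G(1)] fin F G by (intro det_cols_not_dvd) auto
  moreover have "\<not> det_set gen_mat F dvd (\<Prod>j\<in>G. gen_replace G j :: 'k mpoly)"
    using facetD[OF G(1)] fin F face_no_0
    by (intro prime_not_dvd_prod P det_set_not_dvd_gen_replace) auto
  ultimately show ?thesis
    by (simp add: den_def prime_elem_dvd_mult_iff[OF P])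
qed

text \<open>Over the common denominator, \<open>[F]\<close> divides every summand of the numerator
  except that of \<open>F\<close>, and it divides the denominator exactly once.\<close>

lemma ord_deg_ell_pow_facet:
  assumes F: "F \<in> facets"
  shows "ord (bracket d F) (deg_ell_pow TYPE('k) \<Delta> n d ori) = -1"
    and "deg_ell_pow TYPE('k) \<Delta> n d ori \<noteq> 0"
proof -
  have fin: "finite F" "0 \<notin> F" "F \<noteq> {}" "F \<subseteq> {1..n}" "card F = d"
    using facetD[OF F] face_no_0 face_sub d by auto
  define P where "P = (det_set gen_mat F :: 'k mpoly)"
  have P: "prime_elem P" using fin unfolding P_def by (intro prime_elem_det_set)
  define h where "h = (\<Prod>j\<in>F. gen_replace F j) * (\<Prod>G\<in>facets - {F}. den G)"
  define g where "g = (\<Sum>G\<in>facets. num G * (\<Prod>H\<in>facets - {G}. den H))"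
  have others: "\<not> P dvd (\<Prod>G\<in>facets - {F}. den G)"
    using P fin unfolding P_def by (intro prime_not_dvd_prod det_set_not_dvd_den) auto
  have h: "\<not> P dvd h"
  proof -
    have "\<not> P dvd (\<Prod>j\<in>F. gen_replace F j)"
      using P fin unfolding P_def by (intro prime_not_dvd_prod det_set_not_dvd_gen_replace) auto
    then show ?thesis using others by (simp add: h_def prime_elem_dvd_mult_iff[OF P])
  qed
  have "\<not> P dvd num F * (\<Prod>H\<in>facets - {F}. den H)"
  proof -
    obtain j where "j \<in> F" using fin by auto
    then have "\<not> P dvd (\<Sum>j\<in>F. gen_replace F j)"
      unfolding P_def using fin by (intro det_set_not_dvd_sum_gen_replace)
    then have "\<not> P dvd (\<Sum>j\<in>F. gen_replace F j) ^ d"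
      using prime_elem_dvd_power[OF P] by blast
    moreover have "\<not> P dvd eps F"
      using dvd_trans[OF _ eps_unit[of F], of P] P unfolding prime_elem_def by blast
    ultimately show ?thesis
      using others by (simp add: num_def prime_elem_dvd_mult_iff[OF P])
  qed
  moreover have "P dvd (\<Sum>G\<in>facets - {F}. num G * (\<Prod>H\<in>facets - {G}. den H))"
  proof (intro dvd_sum dvd_mult)
    fix G assume "G \<in> facets - {F}"
    then have "den F dvd (\<Prod>H\<in>facets - {G}. den H)" using F by (intro dvd_prodI) auto
    then show "P dvd (\<Prod>H\<in>facets - {G}. den H)"
      by (rule dvd_trans[rotated]) (simp add: den_def P_def)
  qed
  moreover have "g = num F * (\<Prod>H\<in>facets - {F}. den H) + (\<Sum>G\<in>facets - {F}. num G * (\<Prod>H\<in>facets - {G}. den H))"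
    unfolding g_def using F by (simp add: sum.remove)
  ultimately have g: "\<not> P dvd g"
    by (simp add: dvd_add_left_iff)
  have "(\<Prod>G\<in>facets. den G) = P * h"
    using F by (simp add: prod.remove den_def h_def P_def mult_ac)
  moreover have "P \<noteq> 0" "h \<noteq> 0" "g \<noteq> 0" using P h g by auto
  ultimately have eq: "deg_ell_pow TYPE('k) \<Delta> n d ori = Fract g h * Fract P 1 powi (-1)"
    unfolding deg_ell_pow_eq g_def by (simp add: power_int_minus mult.commute)
  show "ord (bracket d F) (deg_ell_pow TYPE('k) \<Delta> n d ori) = -1"
    unfolding eq bracket_eq_det_cols[OF fin(1,5)] P_def[symmetric] by (rule ord_eqI[OF P g h])
  show "deg_ell_pow TYPE('k) \<Delta> n d ori \<noteq> 0"
  proof -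
    have "Fract g h \<noteq> 0" "Fract P 1 \<noteq> 0"
      using \<open>P \<noteq> 0\<close> \<open>h \<noteq> 0\<close> \<open>g \<noteq> 0\<close> by (simp_all add: Fract_eq_0_iff)
    then show ?thesis unfolding eq by (intro no_zero_divisors power_int_not_zero) auto
  qed
qed

end

subsection \<open>Degenerations\<close>

lemma comm_ring_hom_map_poly:
  assumes "comm_ring_hom (h :: 'a::comm_ring_1 \<Rightarrow> 'b::comm_ring_1)"
  shows "comm_ring_hom (map_poly h)"
proof -
  interpret comm_ring_hom h by fact
  have c: "Polynomial.coeff (map_poly h p) k = h (Polynomial.coeff p k)" for p k
    by (simp add: coeff_map_poly)
  show ?thesis
  proof
    show "map_poly h 0 = 0" "map_poly h 1 = 1" by simp_all
    show "map_poly h (p + q) = map_poly h p + map_poly h q" for p q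
      by (rule poly_eqI) (simp add: c hom_add)
    show "map_poly h (p * q) = map_poly h p * map_poly h q" for p q
      by (rule poly_eqI) (simp add: c coeff_mult hom_sum hom_mult)
  qed
qed

text \<open>A coefficient that survives a specialisation was nonzero before it. Upper bounds for the
  order at 0 can thus be read off at a single 0/1 point.\<close>

lemma order_le_if_coeff_map_poly:
  fixes p :: "'a::idom poly"
  assumes "h 0 = 0" "Polynomial.coeff (map_poly h p) e \<noteq> 0"
  shows "p \<noteq> 0 \<and> order 0 p \<le> e"
proof -
  have c: "Polynomial.coeff p e \<noteq> 0" using assms by (auto simp: coeff_map_poly)
  then have "p \<noteq> 0" by auto
  moreover have "order 0 p \<le> e"
  proof (rule ccontr)
    assume "\<not> order 0 p \<le> e"
    then have "monom 1 (Suc e) dvd p" using \<open>p \<noteq> 0\<close> by (simp add: monom_1_dvd_iff)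
    then show False using c by (simp add: monom_1_dvd_iff')
  qed
  ultimately show ?thesis by simp
qed

lemma order_prod_0:
  fixes p :: "'i \<Rightarrow> 'a::idom poly"
  assumes "finite S" "\<And>x. x \<in> S \<Longrightarrow> p x \<noteq> 0"
  shows "order 0 (\<Prod>x\<in>S. p x) = (\<Sum>x\<in>S. order 0 (p x))"
  using assms
proof (induction S rule: finite_induct)
  case (insert x S)
  then have "p x * (\<Prod>x\<in>S. p x) \<noteq> 0" by auto
  then show ?case using insert by (simp add: order_mult)
qed (simp add: order_0I)

lemma unit_cols_notin: "x \<notin> set X \<Longrightarrow> unit_cols X r x = 0"
  unfolding unit_cols_def using nth_mem by fastforce

text \<open>Data of a one-parameter family in \<open>t\<close>: column \<open>f\<close> becomes a
  combination of the columns in \<open>S1\<close> in which that of \<open>i\<close> carries the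
  factor \<open>t\<close>, and column \<open>w\<close> becomes a combination of those in
  \<open>S2\<close> plus \<open>t\<close> times itself. At \<open>t = 0\<close>, \<open>f\<close>
  lies in the span of \<open>S1 - {i}\<close> and \<open>w\<close> in that of
  \<open>S2\<close>.\<close>

locale degeneration =
  fixes d f w i :: nat and S1 S2 :: "nat set"
  assumes fin: "finite S1" "finite S2" and fw: "f \<noteq> w"
    and notin: "f \<notin> S1" "w \<notin> S1" "f \<notin> S2" "w \<notin> S2"
begin

definition w_mat :: "(nat \<Rightarrow> 'r) \<Rightarrow> 'r \<Rightarrow> (nat \<Rightarrow> nat \<Rightarrow> 'r::comm_ring_1) \<Rightarrow> nat \<Rightarrow> nat \<Rightarrow> 'r" where
  "w_mat b t A r l = (if l = w then (\<Sum>s\<in>S2. b s * A r s) + t * A r w else A r l)"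

definition degen ::
    "(nat \<Rightarrow> 'r) \<Rightarrow> (nat \<Rightarrow> 'r) \<Rightarrow> 'r \<Rightarrow> (nat \<Rightarrow> nat \<Rightarrow> 'r::comm_ring_1) \<Rightarrow> nat \<Rightarrow> nat \<Rightarrow> 'r" where
  "degen c b t A r l =
     (if l = f then \<Sum>s\<in>S1. c s * (if s = i then t else 1) * A r s else w_mat b t A r l)"

lemma degen_hom:
  assumes "comm_ring_hom h"
  shows "h (degen c b t A r l)
    = degen (\<lambda>s. h (c s)) (\<lambda>s. h (b s)) (h t) (\<lambda>r l. h (A r l)) r l"
proof -
  interpret comm_ring_hom h by fact
  show ?thesis
    by (simp add: degen_def w_mat_def hom_sum hom_mult hom_add if_distrib[of h] cong: if_cong)
qed

lemma det_degen_expand: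
  assumes "distinct L" "k < length L" "L ! k = f"
  shows "det_cols (degen c b t A) L
    = (\<Sum>s\<in>S1. (c s * (if s = i then t else 1)) * det_cols (w_mat b t A) (L[k := s]))"
proof (rule det_cols_expand)
  show "degen c b t A r (L ! k) = (\<Sum>s\<in>S1. c s * (if s = i then t else 1) * w_mat b t A r s)" for r
    unfolding degen_def assms(3) using notin by (auto simp: w_mat_def intro!: sum.cong)
  show "degen c b t A r (L ! j) = w_mat b t A r (L ! j)" if "j < length L" "j \<noteq> k" for r j
  proof -
    have "L ! j \<noteq> f" using that assms nth_eq_iff_index_eq by metis
    then show ?thesis by (simp add: degen_def)
  qed
qed (use assms in auto)

lemma det_repeated_update:
  assumes "k < length L" "s \<in> set L" "s \<noteq> L ! k"
  shows "det_cols A (L[k := s]) = 0"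
proof (rule det_cols_not_distinct)
  obtain j where "j < length L" "L ! j = s" "j \<noteq> k" using assms by (auto simp: in_set_conv_nth)
  then show "\<not> distinct (L[k := s])"
    using assms(1) unfolding distinct_conv_nth by (metis length_list_update nth_list_update_eq nth_list_update_neq)
qed

text \<open>For every \<open>t\<close>, column \<open>f\<close> lies in the span of other columns of
  the list.\<close>

lemma det_degen_zero:
  assumes "distinct L" "f \<in> set L" "S1 \<subseteq> set L"
  shows "det_cols (degen c b t A) L = 0"
proof -
  obtain k where k: "k < length L" "L ! k = f" using assms(2) by (auto simp: in_set_conv_nth)
  have "det_cols (w_mat b t A) (L[k := s]) = 0" if "s \<in> S1" for s
    using k assms notin that by (intro det_repeated_update) auto
  then show ?thesis by (simp add: det_degen_expand[OF assms(1) k])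
qed

text \<open>Only the summand \<open>s = i\<close> can avoid a repeated column, and it carries the
  factor \<open>t\<close>.\<close>

lemma det_degen_dvd:
  assumes "distinct L" "f \<in> set L" "S1 - {i} \<subseteq> set L"
  shows "t dvd det_cols (degen c b t A) L"
proof -
  obtain k where k: "k < length L" "L ! k = f" using assms(2) by (auto simp: in_set_conv_nth)
  have "t dvd (c s * (if s = i then t else 1)) * det_cols (w_mat b t A) (L[k := s])" if "s \<in> S1" for s
  proof (cases "s = i")
    case False
    then have "det_cols (w_mat b t A) (L[k := s]) = 0"
      using k assms notin that by (intro det_repeated_update) auto
    then show ?thesis by simp
  qed simp
  then show ?thesis unfolding det_degen_expand[OF assms(1) k] by (rule dvd_sum)
qed

lemma det_w_mat_dvd:
  assumes "distinct L" "w \<in> set L" "S2 \<subseteq> set L"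
  shows "t dvd det_cols (w_mat b t A) L"
proof -
  obtain k where k: "k < length L" "L ! k = w" using assms(2) by (auto simp: in_set_conv_nth)
  have "det_cols (w_mat b t A) L
      = (\<Sum>s\<in>insert w S2. (if s = w then t else b s) * det_cols A (L[k := s]))"
  proof (rule det_cols_expand)
    show "w_mat b t A r (L ! k) = (\<Sum>s\<in>insert w S2. (if s = w then t else b s) * A r s)" for r
    proof -
      have "(\<Sum>s\<in>S2. (if s = w then t else b s) * A r s) = (\<Sum>s\<in>S2. b s * A r s)"
        using notin by (intro sum.cong) auto
      then show ?thesis using k fin notin by (simp add: w_mat_def add.commute)
    qed
    show "w_mat b t A r (L ! j) = A r (L ! j)" if "j < length L" "j \<noteq> k" for r j
    proof -
      have "L ! j \<noteq> w" using that assms k nth_eq_iff_index_eq by metis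
      then show ?thesis by (simp add: w_mat_def)
    qed
  qed (use k in auto)
  also have "t dvd \<dots>"
  proof (rule dvd_sum)
    fix s assume s: "s \<in> insert w S2"
    show "t dvd (if s = w then t else b s) * det_cols A (L[k := s])"
    proof (cases "s = w")
      case False
      then have "det_cols A (L[k := s]) = 0"
        using k assms s by (intro det_repeated_update) auto
      then show ?thesis by simp
    qed simp
  qed
  finally show ?thesis .
qed

lemma det_degen_dvd_w:
  assumes "distinct L" "f \<notin> set L" "w \<in> set L" "S2 \<subseteq> set L"
  shows "t dvd det_cols (degen c b t A) L"
proof -
  have "det_cols (degen c b t A) L = det_cols (w_mat b t A) L"
    by (rule det_cols_cong) (use assms in \<open>auto simp: degen_def\<close>)
  then show ?thesis using det_w_mat_dvd[OF assms(1,3,4)] by simp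
qed

text \<open>The surviving summand for column \<open>f\<close> is \<open>s = i\<close>, with a factor
  \<open>t\<close>. It puts \<open>i\<close> into the list, so that \<open>S2\<close> is contained
  in the new list and column \<open>w\<close> contributes a second factor.\<close>

lemma det_degen_dvd_square:
  assumes "distinct L" "f \<in> set L" "S1 - {i} \<subseteq> set L" "w \<in> set L" "S2 \<subseteq> insert i (set L)"
  shows "t ^ 2 dvd det_cols (degen c b t A) L"
proof -
  obtain k where k: "k < length L" "L ! k = f" using assms(2) by (auto simp: in_set_conv_nth)
  have "t ^ 2 dvd (c s * (if s = i then t else 1)) * det_cols (w_mat b t A) (L[k := s])" if s: "s \<in> S1" for s
  proof (cases "s \<in> set L")
    case True
    then have "det_cols (w_mat b t A) (L[k := s]) = 0"
      using k notin that by (intro det_repeated_update) auto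
    then show ?thesis by simp
  next
    case False
    then have si: "s = i" using assms(3) s by auto
    have set: "set (L[k := s]) = insert s (set L - {f})"
      using set_update_distinct[OF assms(1) k(1)] k by simp
    have "t dvd det_cols (w_mat b t A) (L[k := s])"
    proof (rule det_w_mat_dvd)
      show "distinct (L[k := s])" using assms(1) False by (intro distinct_list_update) auto
      show "w \<in> set (L[k := s])" "S2 \<subseteq> set (L[k := s])"
        unfolding set using assms(4,5) fw notin si by auto
    qed
    then have "t * t dvd (c s * t) * det_cols (w_mat b t A) (L[k := s])"
      by (intro mult_dvd_mono) auto
    then show ?thesis using si by (simp add: power2_eq_square)
  qed
  then show ?thesis unfolding det_degen_expand[OF assms(1) k] by (rule dvd_sum)
qed

text \<open>The coefficients of the combinations are themselves generic: determinants of size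
  \<open>d\<close> involve the rows 1 to \<open>d\<close> only, so the indeterminates of rows 0 and
  \<open>Suc d\<close> are free to be these coefficients.\<close>

definition phi :: "'k::field mpoly \<Rightarrow> 'k mpoly poly" where
  "phi = mpoly_eval (\<lambda>c. [:Poly_Mapping.single 0 c:]) (\<lambda>(r, l).
     degen (\<lambda>s. [:avar 0 s:]) (\<lambda>s. [:avar (Suc d) s:]) [:0, 1:] (\<lambda>r l. [:gen_mat r l:]) (r - 1) l)"

lemma comm_ring_hom_const: "comm_ring_hom (\<lambda>c::'k::field. [:Poly_Mapping.single 0 c :: 'k mpoly:])"
  by (rule comm_ring_hom_comp[OF comm_ring_hom_const_poly comm_ring_hom_const_mpoly])

lemma phi_hom: "comm_ring_hom (phi :: 'k::field mpoly \<Rightarrow> _)"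
  unfolding phi_def by (rule comm_ring_hom_mpoly_eval[OF comm_ring_hom_const])

lemma phi_det: "phi (det_cols gen_mat L) = det_cols (degen (\<lambda>s. [:avar 0 s:])
    (\<lambda>s. [:avar (Suc d) s:]) [:0, 1:] (\<lambda>r l. [:gen_mat r l:])) L"
  unfolding phi_def by (simp add: mpoly_eval_det_cols[OF comm_ring_hom_const])

text \<open>A 0/1 specialisation that replaces column \<open>f\<close> by column \<open>p\<close> and column \<open>w\<close> by
  column \<open>q\<close>, up to powers of \<open>t\<close>, and makes the columns of the resulting list a unit matrix.\<close>

definition target :: "nat \<Rightarrow> nat \<Rightarrow> nat list \<Rightarrow> nat list" where
  "target p q X = map (id(f := p, w := q)) X"

definition spec_mat :: "nat \<Rightarrow> nat \<Rightarrow> nat list \<Rightarrow> nat \<Rightarrow> nat \<Rightarrow> 'k::field poly" where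
  "spec_mat p q X = degen (\<lambda>s. [:of_bool (s = p):]) (\<lambda>s. [:of_bool (s = q):]) [:0, 1:]
     (\<lambda>r l. [:unit_cols (target p q X) r l:])"

definition spec_hom :: "nat \<Rightarrow> nat \<Rightarrow> nat list \<Rightarrow> 'k::field mpoly \<Rightarrow> 'k" where
  "spec_hom p q X = mpoly_eval (\<lambda>x. x) (\<lambda>(r, l). if r = 0 then of_bool (l = p)
     else if r = Suc d then of_bool (l = q) else unit_cols (target p q X) (r - 1) l)"

lemma spec_hom: "comm_ring_hom (spec_hom p q X)"
  unfolding spec_hom_def by (rule comm_ring_hom_mpoly_eval[OF comm_ring_hom_id])

lemma spec_phi_det:
  assumes "length L = d"
  shows "map_poly (spec_hom p q X) (phi (det_cols gen_mat L)) = det_cols (spec_mat p q X) L"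
proof -
  let ?h = "spec_hom p q X"
  have hom: "comm_ring_hom (map_poly ?h)"
    by (rule comm_ring_hom_map_poly[OF spec_hom])
  have av: "?h (avar r l) = (if r = 0 then of_bool (l = p)
     else if r = Suc d then of_bool (l = q) else unit_cols (target p q X) (r - 1) l)" for r l
    by (simp add: spec_hom_def comm_ring_hom_id)
  interpret h: comm_ring_hom ?h by (rule spec_hom)
  have c: "map_poly ?h [:x:] = [:?h x:]" "map_poly ?h [:0, 1:] = [:0, 1:]" for x
    by (simp_all add: map_poly_pCons)
  have "map_poly ?h (phi (det_cols gen_mat L)) = det_cols (\<lambda>r l. degen (\<lambda>s. [:?h (avar 0 s):])
      (\<lambda>s. [:?h (avar (Suc d) s):]) [:0, 1:] (\<lambda>r l. [:?h (gen_mat r l):]) r l) L"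
    unfolding phi_det det_cols_hom[OF hom] degen_hom[OF hom] c ..
  also have "\<dots> = det_cols (spec_mat p q X) L"
    by (rule det_cols_cong) (use assms in \<open>auto simp: spec_mat_def degen_def w_mat_def av\<close>)
  finally show ?thesis .
qed

text \<open>The specialised matrix is diagonal. An entry is \<open>t\<close> instead of 1 where
  column \<open>f\<close> is replaced by column \<open>i\<close>, or where column \<open>w\<close>
  keeps only its own summand.\<close>

lemma det_spec_mat:
  assumes dist: "distinct (target p q X)"
    and p: "f \<in> set X \<Longrightarrow> p \<in> S1" and q: "w \<in> set X \<Longrightarrow> q = w \<or> q \<in> S2"
  shows "det_cols (spec_mat p q X) X
    = ([:0, 1:] ^ (of_bool (f \<in> set X \<and> p = i) + of_bool (w \<in> set X \<and> q = w)) :: 'k::field poly)"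
proof -
  let ?t = "[:0, 1:] :: 'k poly" and ?Y = "target p q X"
  define s1 where "s1 x = (if x = f \<and> p = i then ?t else 1)" for x
  define s2 where "s2 x = (if x = w \<and> q = w then ?t else 1)" for x
  have len: "length ?Y = length X" by (simp add: target_def)
  have distX: "distinct X" using dist by (auto simp: target_def distinct_map)
  have Y: "?Y ! j = (if X ! j = w then q else if X ! j = f then p else X ! j)" if "j < length X" for j
    using that by (simp add: target_def)
  have unit: "unit_cols ?Y r (?Y ! j) = (if r = j then 1 else (0 :: 'k))" if "r < length X" "j < length X" for r j
    using that dist len by (auto simp: unit_cols_def nth_eq_iff_index_eq)
  have entry: "spec_mat p q X r (X ! j) = (if r = j then s1 (X ! j) * s2 (X ! j) else 0)"
    if rj: "r < length X" "j < length X" for r j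
  proof -
    have mem: "X ! j \<in> set X" using rj by simp
    consider "X ! j = f" | "X ! j = w" "q = w" | "X ! j = w" "q \<noteq> w" | "X ! j \<noteq> f" "X ! j \<noteq> w" by blast
    then show ?thesis
    proof cases
      case 1
      have "(\<Sum>s\<in>S1. [:of_bool (s = p):] * (if s = i then ?t else 1) * [:unit_cols ?Y r s:])
          = (\<Sum>s\<in>S1. if s = p then (if p = i then ?t else 1) * [:unit_cols ?Y r p:] else 0)"
        by (intro sum.cong) auto
      also have "\<dots> = (if p = i then ?t else 1) * [:unit_cols ?Y r p:]"
        using p mem 1 fin by simp
      finally show ?thesis
        using unit[OF rj] Y[OF rj(2)] 1 fw by (simp add: spec_mat_def degen_def s1_def s2_def)
    next
      case 2
      have "(\<Sum>s\<in>S2. [:of_bool (s = q):] * [:unit_cols ?Y r s:]) = (0 :: 'k poly)"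
        using 2 notin by (intro sum.neutral) auto
      then show ?thesis
        using unit[OF rj] Y[OF rj(2)] 2 fw by (simp add: spec_mat_def degen_def w_mat_def s1_def s2_def)
    next
      case 3
      have qS: "q \<in> S2" using q mem 3 by auto
      \<comment> \<open>No target label is \<open>w\<close>, so the summand of column
        \<open>w\<close> with the factor \<open>t\<close> vanishes.\<close>
      have "w \<notin> set ?Y" using 3 p notin by (auto simp: target_def)
      then have w0: "unit_cols ?Y r w = (0 :: 'k)" by (rule unit_cols_notin)
      have "(\<Sum>s\<in>S2. [:of_bool (s = q):] * [:unit_cols ?Y r s:])
          = (\<Sum>s\<in>S2. if s = q then [:unit_cols ?Y r q:] else (0 :: 'k poly))"
        by (intro sum.cong) auto
      also have "\<dots> = [:unit_cols ?Y r q:]" using qS fin by simp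
      finally show ?thesis
        using unit[OF rj] Y[OF rj(2)] 3 fw w0 by (simp add: spec_mat_def degen_def w_mat_def s1_def s2_def)
    next
      case 4
      then show ?thesis
        using unit[OF rj] Y[OF rj(2)] by (simp add: spec_mat_def degen_def w_mat_def s1_def s2_def)
    qed
  qed
  have bij: "bij_betw ((!) X) {..<length X} (set X)"
    using distX by (intro bij_betw_nth) auto
  have pd: "(\<Prod>x\<in>set X. if x = a \<and> Q then ?t else 1) = ?t ^ of_bool (a \<in> set X \<and> Q)" for a Q
    by (cases Q) (auto simp: prod.delta)
  have "det_cols (spec_mat p q X) X = (\<Prod>j<length X. s1 (X ! j) * s2 (X ! j))"
    using entry by (intro det_cols_diag) auto
  also have "\<dots> = (\<Prod>x\<in>set X. s1 x * s2 x)"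
    by (rule prod.reindex_bij_betw[OF bij])
  also have "\<dots> = (\<Prod>x\<in>set X. s1 x) * (\<Prod>x\<in>set X. s2 x)"
    by (rule prod.distrib)
  finally show ?thesis
    unfolding s1_def s2_def pd power_add .
qed

text \<open>Bounds the order by exhibiting replacements: \<open>p = i\<close> and
  \<open>q = w\<close> each cost one power of \<open>t\<close> when the column is present, every
  other admissible choice is free.\<close>

lemma order_phi_det:
  assumes "distinct (target p q X)" "length X = d"
    and "f \<in> set X \<Longrightarrow> p \<in> S1" "w \<in> set X \<Longrightarrow> q = w \<or> q \<in> S2"
    and e: "of_bool (f \<in> set X \<and> p = i) + of_bool (w \<in> set X \<and> q = w) \<le> (e :: nat)"
  shows "phi (det_cols gen_mat X :: 'k::field mpoly) \<noteq> 0
    \<and> order 0 (phi (det_cols gen_mat X :: 'k mpoly)) \<le> e"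
proof -
  interpret h: comm_ring_hom "spec_hom p q X :: 'k mpoly \<Rightarrow> 'k" by (rule spec_hom)
  let ?m = "of_bool (f \<in> set X \<and> p = i) + of_bool (w \<in> set X \<and> q = w) :: nat"
  have c: "Polynomial.coeff ([:0, 1:] ^ ?m :: 'k poly) ?m = 1"
    by (metis coeff_monom monom_altdef smult_1_left)
  have eq: "map_poly (spec_hom p q X) (phi (det_cols gen_mat X :: 'k mpoly)) = [:0, 1:] ^ ?m"
    unfolding spec_phi_det[OF assms(2)] by (rule det_spec_mat[OF assms(1,3,4)])
  have "Polynomial.coeff (map_poly (spec_hom p q X) (phi (det_cols gen_mat X :: 'k mpoly))) ?m \<noteq> 0"
    unfolding eq c by (rule one_neq_zero)
  from order_le_if_coeff_map_poly[OF h.hom_zero this]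
  show ?thesis using order.trans[OF _ e] by blast
qed

text \<open>The choice \<open>p = f\<close> selects no element of \<open>S1\<close>; likewise
  \<open>q = w\<close> selects none of \<open>S2\<close>, and the summand of \<open>w\<close> itself
  vanishes when \<open>w\<close> is not a target label.\<close>

lemma spec_mat_column_zero:
  assumes "length L = length X"
  shows "p = f \<Longrightarrow> f \<in> set L \<Longrightarrow> det_cols (spec_mat p q X) L = (0 :: 'k::field poly)"
    and "q = w \<Longrightarrow> w \<notin> set X \<Longrightarrow> p \<noteq> w \<Longrightarrow> w \<in> set L \<Longrightarrow> det_cols (spec_mat p q X) L = (0 :: 'k poly)"
proof -
  show "det_cols (spec_mat p q X) L = (0 :: 'k poly)" if "p = f" "f \<in> set L"
  proof (rule det_cols_zero_column[OF that(2)])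
    show "spec_mat p q X r f = (0 :: 'k poly)" for r
      using that notin by (auto simp: spec_mat_def degen_def intro!: sum.neutral)
  qed
  show "det_cols (spec_mat p q X) L = (0 :: 'k poly)" if "q = w" "w \<notin> set X" "p \<noteq> w" "w \<in> set L"
  proof (rule det_cols_zero_column[OF that(4)])
    fix r
    have "w \<notin> set (target p q X)" using that by (auto simp: target_def)
    then have "unit_cols (target p q X) r w = (0 :: 'k)" by (rule unit_cols_notin)
    moreover have "(\<Sum>s\<in>S2. [:of_bool (s = q):] * [:unit_cols (target p q X) r s:]) = (0 :: 'k poly)"
      using that notin by (intro sum.neutral) auto
    ultimately show "spec_mat p q X r w = (0 :: 'k poly)"
      using fw by (simp add: spec_mat_def degen_def w_mat_def)
  qed
qed

end

text \<open>A specialisation that annihilates every list containing \<open>u\<close> leaves only the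
  summand \<open>[G, u]\<close>, and the conditions on \<open>p\<close> and \<open>q\<close> make
  this one equal to 1.\<close>

lemma (in degeneration) coeff_0_sum_gen_replace:
  assumes G: "finite G" "card G = d" "0 \<notin> G" "u \<in> G"
    and X: "X = replace_list G u" "distinct (target p q X)"
    and p: "f \<notin> set X" and q: "w \<in> set X \<Longrightarrow> q \<noteq> w \<and> q \<in> S2"
    and zero: "\<And>L. length L = length X \<Longrightarrow> u \<in> set L \<Longrightarrow> det_cols (spec_mat p q X) L = (0 :: 'k::field poly)"
  shows "Polynomial.coeff (phi (\<Sum>j\<in>G. gen_replace G j :: 'k mpoly)) 0 \<noteq> 0"
proof -
  interpret h: comm_ring_hom "spec_hom p q X :: 'k mpoly \<Rightarrow> 'k" by (rule spec_hom)
  interpret m: comm_ring_hom "map_poly (spec_hom p q X :: 'k mpoly \<Rightarrow> 'k)"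
    by (rule comm_ring_hom_map_poly[OF spec_hom])
  interpret phi: comm_ring_hom "phi :: 'k mpoly \<Rightarrow> _" by (rule phi_hom)
  have repl: "map_poly (spec_hom p q X) (phi (gen_replace G j)) = det_cols (spec_mat p q X) (replace_list G j)"
    if "j \<in> G" for j
    using replace_list[OF G(1) that G(3)] G(2) by (simp add: replace_list(4)[of G j gen_mat] G that spec_phi_det)
  have "det_cols (spec_mat p q X) (replace_list G j) = (0 :: 'k poly)" if "j \<in> G" "j \<noteq> u" for j
    using replace_list[OF G(1) that(1) G(3)] replace_list[OF G(1) G(4) G(3)] G that X by (intro zero) auto
  then have "(\<Sum>j\<in>G. det_cols (spec_mat p q X) (replace_list G j))
      = (\<Sum>j\<in>{u}. det_cols (spec_mat p q X) (replace_list G j) :: 'k poly)"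
    using G by (intro sum.mono_neutral_right) auto
  also have "\<dots> = 1"
    using X p q det_spec_mat[of p q X, where ?'k = 'k] by auto
  finally have "map_poly (spec_hom p q X) (phi (\<Sum>j\<in>G. gen_replace G j)) = (1 :: 'k poly)"
    by (simp add: phi.hom_sum m.hom_sum repl)
  then have "Polynomial.coeff (map_poly (spec_hom p q X) (phi (\<Sum>j\<in>G. gen_replace G j))) 0 = (1 :: 'k)"
    by simp
  then show ?thesis
    by (auto simp: coeff_map_poly)
qed

text \<open>With denominators cleared, the summand of \<open>x\<close> has strictly smallest order
  at 0, because its denominator, of largest order, is the one left out.\<close>

lemma sum_nonzero_if_unique_pole:
  fixes N D :: "'i \<Rightarrow> 'a::idom poly"
  assumes S: "finite S" "x \<in> S" and D: "\<And>y. y \<in> S \<Longrightarrow> D y \<noteq> 0"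
    and N: "Polynomial.coeff (N x) 0 \<noteq> 0"
    and x: "m < order 0 (D x)" and others: "\<And>y. y \<in> S \<Longrightarrow> y \<noteq> x \<Longrightarrow> order 0 (D y) \<le> m"
  shows "(\<Sum>y\<in>S. N y * (\<Prod>z\<in>S - {y}. D z)) \<noteq> 0"
proof
  assume zero: "(\<Sum>y\<in>S. N y * (\<Prod>z\<in>S - {y}. D z)) = 0"
  define c where "c y = (\<Prod>z\<in>S - {y}. D z)" for y
  define tot where "tot = (\<Sum>z\<in>S. order 0 (D z))"
  have c0: "c y \<noteq> 0" for y using S D by (auto simp: c_def)
  have oc: "order 0 (c y) + order 0 (D y) = tot" if "y \<in> S" for y
  proof -
    have "order 0 (c y) = (\<Sum>z\<in>S - {y}. order 0 (D z))"
      unfolding c_def using S D by (intro order_prod_0) auto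
    then show ?thesis using sum.remove[OF S(1) that, of "\<lambda>z. order 0 (D z)"] by (simp add: tot_def)
  qed
  have "N x \<noteq> 0" "order 0 (N x) = 0"
    using N by (auto intro!: order_0I simp: poly_0_coeff_0)
  then have ox: "N x * c x \<noteq> 0" "order 0 (N x * c x) = order 0 (c x)"
    using c0[of x] by (auto simp: order_mult)
  have "monom 1 (Suc (order 0 (c x))) dvd (\<Sum>y\<in>S - {x}. N y * c y)"
  proof (intro dvd_sum dvd_mult)
    fix y assume y: "y \<in> S - {x}"
    then have "Suc (order 0 (c x)) \<le> order 0 (c y)"
      using oc[of x] oc[of y] x others[of y] S by auto
    then show "monom 1 (Suc (order 0 (c x))) dvd c y" using c0[of y] by (simp add: monom_1_dvd_iff)
  qed
  moreover have "N x * c x = - (\<Sum>y\<in>S - {x}. N y * c y)"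
    using zero S by (simp add: c_def sum.remove add_eq_0_iff)
  ultimately have "monom 1 (Suc (order 0 (c x))) dvd N x * c x" by simp
  then show False using ox by (simp add: monom_1_dvd_iff)
qed

section \<open>Absence of a zero along a set that is not a facet\<close>

context oriented_manifold
begin

text \<open>The family stays inside \<open>[F] = 0\<close>, since column \<open>f\<close> is a
  combination of other columns of \<open>F\<close>. If \<open>[F]\<close> divided the numerator, its
  image under \<open>phi\<close> would vanish, contrary to the unique pole of largest order at
  \<open>G0\<close>. \<open>E\<close> bounds orders by column set; \<open>den G\<close> collects
  those of \<open>G\<close> and of the sets with one vertex replaced by 0.\<close>

lemma not_dvd_if_unique_pole:
  fixes E :: "nat set \<Rightarrow> nat"
  assumes "degeneration f w S1 S2" and F: "F \<subseteq> {1..n}" "card F = d" "F \<notin> \<Delta>"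
    and f: "f \<in> F" "S1 \<subseteq> F" and G0: "G0 \<in> facets"
    and bound: "\<And>X. distinct X \<Longrightarrow> length X = d \<Longrightarrow> set X \<noteq> F \<Longrightarrow>
        degeneration.phi d f w i S1 S2 (det_cols gen_mat X :: 'k mpoly) \<noteq> 0 \<and>
        order 0 (degeneration.phi d f w i S1 S2 (det_cols gen_mat X :: 'k mpoly)) \<le> E (set X)"
    and others: "\<And>G. G \<in> facets \<Longrightarrow> G \<noteq> G0 \<Longrightarrow> E G + (\<Sum>j\<in>G. E (insert 0 (G - {j}))) \<le> m"
    and pole: "[:0, 1:] ^ Suc m dvd degeneration.phi d f w i S1 S2 (den G0)"
    and num: "Polynomial.coeff (degeneration.phi d f w i S1 S2 (\<Sum>j\<in>G0. gen_replace G0 j :: 'k mpoly)) 0 \<noteq> 0"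
  shows "\<not> det_set gen_mat F dvd (\<Sum>G\<in>facets. num G * (\<Prod>H\<in>facets - {G}. den H))"
proof
  interpret degeneration d f w i S1 S2 by fact
  interpret phi: comm_ring_hom "phi :: 'k mpoly \<Rightarrow> _" by (rule phi_hom)
  have finF: "finite F" using F finite_subset by auto
  assume "det_set gen_mat F dvd (\<Sum>G\<in>facets. num G * (\<Prod>H\<in>facets - {G}. den H))"
  moreover have "phi (det_set gen_mat F :: 'k mpoly) = 0"
    unfolding phi_det using finF f by (intro det_degen_zero) auto
  ultimately have "phi (\<Sum>G\<in>facets. num G * (\<Prod>H\<in>facets - {G}. den H)) = 0"
    by (auto elim!: dvdE simp: phi.hom_mult)
  then have "(\<Sum>G\<in>facets. phi (num G) * (\<Prod>H\<in>facets - {G}. phi (den H))) = 0"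
    by (simp add: phi.hom_sum phi.hom_mult phi.hom_prod)
  moreover have den: "phi (den G) \<noteq> 0 \<and> order 0 (phi (den G)) \<le> E G + (\<Sum>j\<in>G. E (insert 0 (G - {j})))"
    if G: "G \<in> facets" for G
  proof -
    have fin: "finite G" "card G = d" "0 \<notin> G" using facetD[OF G] face_no_0 by auto
    have d: "phi (det_set gen_mat G :: 'k mpoly) \<noteq> 0 \<and> order 0 (phi (det_set gen_mat G :: 'k mpoly)) \<le> E G"
      using bound[of "sorted_list_of_set G"] fin facetD(1)[OF G] F(3) by auto
    have r: "phi (gen_replace G j :: 'k mpoly) \<noteq> 0
        \<and> order 0 (phi (gen_replace G j :: 'k mpoly)) \<le> E (insert 0 (G - {j}))" if j: "j \<in> G" for j
    proof -
      note R = replace_list[OF fin(1) j fin(3)]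
      have "set (replace_list G j) \<noteq> F" using R(3) F(1) by auto
      then show ?thesis
        using bound[of "replace_list G j"] R(1-3) fin by (simp add: R(4)[of gen_mat])
    qed
    have p: "(\<Prod>j\<in>G. phi (gen_replace G j :: 'k mpoly)) \<noteq> 0"
      using r fin by auto
    have "order 0 (\<Prod>j\<in>G. phi (gen_replace G j :: 'k mpoly)) = (\<Sum>j\<in>G. order 0 (phi (gen_replace G j :: 'k mpoly)))"
      using r fin by (intro order_prod_0) auto
    also have "\<dots> \<le> (\<Sum>j\<in>G. E (insert 0 (G - {j})))"
      using r by (intro sum_mono) auto
    finally show ?thesis
      using d p by (simp add: den_def phi.hom_mult phi.hom_prod order_mult add_mono)
  qed
  moreover have "(\<Sum>G\<in>facets. phi (num G) * (\<Prod>H\<in>facets - {G}. phi (den H))) \<noteq> 0"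
  proof (rule sum_nonzero_if_unique_pole[OF finite_facets G0])
    have "phi (eps G0) = [:eps G0:]"
      by (simp add: phi_def mpoly_eval_const[OF comm_ring_hom_const])
    moreover have "eps G0 \<noteq> 0"
      using epsilon_nonzero[of ori G0, where ?'k = 'k] by (metis lookup_single_eq lookup_zero)
    ultimately show "Polynomial.coeff (phi (num G0)) 0 \<noteq> 0"
      using num by (simp add: num_def phi.hom_mult phi.hom_power coeff_mult_0 coeff_0_power)
    have "monom 1 (Suc m) dvd phi (den G0)"
      using pole by (simp add: monom_altdef)
    then show "m < order 0 (phi (den G0))"
      using den[OF G0] by (simp add: monom_1_dvd_iff Suc_le_eq)
    show "phi (den G) \<noteq> 0" if "G \<in> facets" for G
      using den[OF that] by blast
    show "order 0 (phi (den G)) \<le> m" if "G \<in> facets" "G \<noteq> G0" for G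
      using den[OF that(1)] others[OF that] by linarith
  qed
  ultimately show False by blast
qed

text \<open>Column \<open>f\<close> moves into the span of \<open>F - {f}\<close> and column
  \<open>w\<close> tends to that of \<open>G0 - {w}\<close>, so that, apart from \<open>[F]\<close>,
  only \<open>[G0]\<close> vanishes at \<open>t = 0\<close>. Taking \<open>i = w\<close>, which is
  not in \<open>F\<close>, switches off the factor \<open>t\<close> in column
  \<open>f\<close>.\<close>

lemma not_dvd_far:
  assumes F: "F \<subseteq> {1..n}" "card F = d" "F \<notin> \<Delta>"
    and G0: "G0 \<in> facets" "card (F \<inter> G0) \<le> d - 2"
  shows "\<not> det_set gen_mat F dvd (\<Sum>G\<in>facets. num G * (\<Prod>H\<in>facets - {G}. den H))"
proof -
  have finF: "finite F" using F finite_subset by auto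
  have G: "finite G0" "card G0 = d" "0 \<notin> G0" "G0 \<in> \<Delta>" using facetD[OF G0(1)] face_no_0 by auto
  have "\<not> F \<subseteq> G0" "\<not> G0 \<subseteq> F" using F G finF card_subset_eq by metis+
  then obtain f w where apart: "f \<in> F" "f \<notin> G0" "w \<in> G0" "w \<notin> F" by blast
  interpret degeneration d f w w "F - {f}" "G0 - {w}"
    by unfold_locales (use apart finF G in auto)
  interpret phi: comm_ring_hom "phi :: 'k mpoly \<Rightarrow> _" by (rule phi_hom)
  show ?thesis
  proof (rule not_dvd_if_unique_pole[where m = 0 and E = "\<lambda>X. of_bool (X = G0)" and f = f and w = w and i = w
        and ?S1.0 = "F - {f}" and ?S2.0 = "G0 - {w}", OF _ F apart(1) _ G0(1)])
    show "degeneration f w (F - {f}) (G0 - {w})" by (rule degeneration_axioms)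
    show "of_bool (G = G0) + (\<Sum>j\<in>G. of_bool (insert 0 (G - {j}) = G0)) \<le> (0::nat)" if "G \<noteq> G0" for G
    proof -
      have "(\<Sum>j\<in>G. of_bool (insert 0 (G - {j}) = G0)) = (0::nat)"
        using G by (intro sum.neutral) auto
      then show ?thesis using that by simp
    qed
    have "[:0, 1:] dvd phi (det_set gen_mat G0 :: 'k mpoly)"
      unfolding phi_det using G apart by (intro det_degen_dvd_w) auto
    then show "[:0, 1:] ^ Suc 0 dvd phi (den G0)"
      by (simp add: den_def phi.hom_mult)
    show "Polynomial.coeff (phi (\<Sum>j\<in>G0. gen_replace G0 j :: 'k mpoly)) 0 \<noteq> 0"
    \<comment> \<open>Keep the summand in which \<open>w\<close> itself is replaced by 0. Then
      \<open>w\<close> is no target label, and \<open>q = w\<close> annihilates all other summands,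
      which contain it.\<close>
    proof (rule coeff_0_sum_gen_replace[OF G(1-3) apart(3) refl])
      note R = replace_list[OF G(1) apart(3) G(3)]
      have f0: "f \<noteq> 0" using apart F by auto
      show "distinct (target f w (replace_list G0 w))" using R(1) by (simp add: target_def distinct_map inj_on_def)
      show "f \<notin> set (replace_list G0 w)" using R apart f0 by auto
      have w0: "w \<noteq> 0" using apart(3) G(3) by metis
      then show "w \<noteq> w \<and> w \<in> G0 - {w}" if "w \<in> set (replace_list G0 w)"
        using that R by auto
      show "det_cols (spec_mat f w (replace_list G0 w)) L = (0 :: 'k poly)"
        if "length L = length (replace_list G0 w)" "w \<in> set L" for L
        using that R w0 apart by (intro spec_mat_column_zero(2)) auto
    qed
    fix X :: "nat list" assume X: "distinct X" "length X = d" "set X \<noteq> F"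
    let ?goal = "phi (det_cols gen_mat X :: 'k mpoly) \<noteq> 0
        \<and> order 0 (phi (det_cols gen_mat X :: 'k mpoly)) \<le> of_bool (set X = G0)"
    have cX: "card (set X) = d" using X distinct_card by auto
    have *: ?goal if "inj_on (id(f := p, w := q)) (set X)" "f \<in> set X \<Longrightarrow> p \<in> F - {f}"
      "w \<in> set X \<Longrightarrow> q = w \<or> q \<in> G0 - {w}" "w \<in> set X \<and> q = w \<Longrightarrow> set X = G0" for p q
    proof -
      have "of_bool (f \<in> set X \<and> p = w) + of_bool (w \<in> set X \<and> q = w) \<le> (of_bool (set X = G0) :: nat)"
        using that apart by auto
      then show ?goal
        using that X by (intro order_phi_det[of p q]) (auto simp: target_def distinct_map)
    qed
    have p: "\<exists>p. p \<in> F - {f} \<and> p \<notin> set X" if "f \<in> set X"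
      using that X(3) cX F(2) finF apart card_subset_eq[of "set X" F] by auto
    have q: "\<exists>q. q \<in> G0 - {w} \<and> q \<notin> set X" if "w \<in> set X" "set X \<noteq> G0"
      using that cX G card_subset_eq[of "set X" G0] by auto
    consider "f \<notin> set X" "w \<notin> set X" | "f \<notin> set X" "w \<in> set X" "set X = G0"
      | "f \<notin> set X" "w \<in> set X" "set X \<noteq> G0" | "f \<in> set X" "w \<notin> set X" | "f \<in> set X" "w \<in> set X"
      by blast
    then show ?goal
    proof cases
      case 1
      then show ?thesis by (intro *[of f w]) (auto simp: inj_on_def)
    next
      case 2
      then show ?thesis by (intro *[of f w]) (auto simp: inj_on_def)
    next
      case 3
      then obtain q where "q \<in> G0 - {w}" "q \<notin> set X" using q by blast
      then show ?thesis using 3 by (intro *[of f q]) (auto simp: inj_on_def)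
    next
      case 4
      then obtain p where "p \<in> F - {f}" "p \<notin> set X" using p by blast
      then show ?thesis using 4 by (intro *[of p w]) (auto simp: inj_on_def)
    next
      case 5
      then have "set X \<noteq> G0" using apart by auto
      then obtain p q where pq: "p \<in> F - {f}" "p \<notin> set X" "q \<in> G0 - {w}" "q \<notin> set X"
        using p q 5 by blast
      \<comment> \<open>If the two replacements were forced to coincide, \<open>F\<close> and
        \<open>G0\<close> would agree outside \<open>f\<close> and \<open>w\<close>, against the
        bound on their intersection.\<close>
      have "\<exists>p q. p \<in> F - {f} \<and> p \<notin> set X \<and> q \<in> G0 - {w} \<and> q \<notin> set X \<and> p \<noteq> q"
      proof (rule ccontr)
        assume neg: "\<not> ?thesis"
        have pq': "q = p" using neg pq by blast
        let ?R = "set X - {f, w}"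
        have R: "card ?R = d - 2" "finite ?R" using 5 cX fw by (auto simp: card_Diff_subset)
        have "F - {f, p} \<subseteq> ?R" using neg pq apart unfolding pq' by blast
        moreover have "card (F - {f, p}) = d - 2"
          using pq apart finF F(2) by (subst card_Diff_subset) auto
        ultimately have 1: "F - {f, p} = ?R" using R by (metis card_subset_eq)
        have "G0 - {w, p} \<subseteq> ?R" using neg pq apart unfolding pq' by blast
        moreover have "card (G0 - {w, p}) = d - 2"
          using pq apart G unfolding pq' by (subst card_Diff_subset) auto
        ultimately have 2: "G0 - {w, p} = ?R" using R by (metis card_subset_eq)
        have "F - {f} \<subseteq> F \<inter> G0" using 1 2 pq unfolding pq' by blast
        then have "card (F - {f}) \<le> card (F \<inter> G0)" using finF by (intro card_mono) auto
        then show False using G0(2) F(2) apart finF d by simp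
      qed
      then obtain p q where "p \<in> F - {f}" "p \<notin> set X" "q \<in> G0 - {w}" "q \<notin> set X" "p \<noteq> q" by blast
      then show ?thesis using 5 by (intro *[of p q]) (auto simp: inj_on_def)
    qed
  qed auto
qed

text \<open>At \<open>t = 0\<close> column \<open>f\<close> falls into the span of
  \<open>F - {f, i}\<close> and column \<open>w\<close> into that of \<open>F - {f}\<close>. This
  gives \<open>[G0]\<close> a factor \<open>t^2\<close>, and \<open>[G0, w]\<close> a further factor
  \<open>t\<close>, since its columns include \<open>f\<close> and
  \<open>F - {f, i}\<close>.\<close>

lemma not_dvd_near:
  assumes F: "F \<subseteq> {1..n}" "card F = d" "F \<notin> \<Delta>"
    and G0: "G0 \<in> facets" "G0 = insert w (F - {i})" "i \<in> F" "w \<notin> F"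
  shows "\<not> det_set gen_mat F dvd (\<Sum>G\<in>facets. num G * (\<Prod>H\<in>facets - {G}. den H))"
proof -
  have finF: "finite F" using F finite_subset by auto
  have F0: "0 \<notin> F" using F by auto
  have G: "finite G0" "card G0 = d" "0 \<notin> G0" "G0 \<in> \<Delta>" using facetD[OF G0(1)] face_no_0 by auto
  have "card (F - {i}) > 0" using F G0 finF d by simp
  then have "F - {i} \<noteq> {}" by (metis card.empty less_irrefl)
  then obtain f where f: "f \<in> F" "f \<noteq> i" by auto
  have w0: "w \<noteq> 0" "w \<in> G0" "f \<in> G0" "f \<noteq> w" using G G0 f by auto
  interpret degeneration d f w i "F - {f}" "F - {f}"
    by unfold_locales (use f finF G0 w0 in auto)
  interpret phi: comm_ring_hom "phi :: 'k mpoly \<Rightarrow> _" by (rule phi_hom)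
  \<comment> \<open>The first summand allows for column \<open>f\<close> having no replacement but
    \<open>i\<close>, the second for column \<open>w\<close> having to keep its own summand.\<close>
  let ?E = "\<lambda>X. of_bool (F - {i} \<subseteq> X) + of_bool (X \<subseteq> insert w F) :: nat"
  show ?thesis
  proof (rule not_dvd_if_unique_pole[where m = 2 and E = ?E and f = f and w = w and i = i
        and ?S1.0 = "F - {f}" and ?S2.0 = "F - {f}", OF _ F f(1) _ G0(1)])
    show "degeneration f w (F - {f}) (F - {f})" by (rule degeneration_axioms)
    show "?E H + (\<Sum>j\<in>H. ?E (insert 0 (H - {j}))) \<le> 2" if H: "H \<in> facets" "H \<noteq> G0" for H
    proof -
      have H': "finite H" "card H = d" "H \<in> \<Delta>" using facetD[OF H(1)] by auto
      have e: "?E (insert 0 (H - {j})) = of_bool (F - {i} \<subseteq> H - {j})" for j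
        using F0 w0 by auto
      show ?thesis
      proof (cases "F - {i} \<subseteq> H")
        case False
        then have "(\<Sum>j\<in>H. of_bool (F - {i} \<subseteq> H - {j}) :: nat) = 0" by (intro sum.neutral) auto
        then show ?thesis using False unfolding e by simp
      next
        case True
        \<comment> \<open>Here \<open>H\<close> is \<open>F - {i}\<close> with one vertex
          \<open>x\<close> outside \<open>insert w F\<close>, so \<open>[H]\<close> and
          \<open>[H, x]\<close> contribute at most one each. That \<open>x \<noteq> i\<close> holds
          because \<open>F\<close> is not a face.\<close>
        have "card (H - (F - {i})) = 1"
          using True finF F G0 d H' by (subst card_Diff_subset) auto
        then obtain x where x: "H - (F - {i}) = {x}" by (auto simp: card_1_singleton_iff)
        then have Hx: "H = insert x (F - {i})" using True by blast
        have "x \<noteq> w" using Hx H(2) G0 by auto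
        moreover have "x \<noteq> i" using Hx H'(3) F(3) G0(3) by (auto simp: insert_absorb)
        moreover have "x \<notin> F - {i}" using x by auto
        ultimately have "\<not> H \<subseteq> insert w F" using Hx by auto
        moreover have "(\<Sum>j\<in>H. of_bool (F - {i} \<subseteq> H - {j}) :: nat) \<le> (\<Sum>j\<in>H. of_bool (j = x))"
          using Hx by (intro sum_mono) auto
        moreover have "(\<Sum>j\<in>H. of_bool (j = x) :: nat) = 1"
          using H'(1) Hx by (simp add: of_bool_def)
        ultimately show ?thesis unfolding e using True by simp
      qed
    qed
    show "[:0, 1:] ^ Suc 2 dvd phi (den G0)"
    proof -
      note R = replace_list[OF G(1) w0(2) G(3)]
      have "[:0, 1:] ^ 2 dvd phi (det_set gen_mat G0 :: 'k mpoly)"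
        unfolding phi_det
      proof (rule det_degen_dvd_square)
        have set: "set (sorted_list_of_set G0) = G0" using G by simp
        show "f \<in> set (sorted_list_of_set G0)" "w \<in> set (sorted_list_of_set G0)"
          unfolding set by (rule w0)+
        show "F - {f} - {i} \<subseteq> set (sorted_list_of_set G0)" "F - {f} \<subseteq> insert i (set (sorted_list_of_set G0))"
          unfolding set using G0(2) by auto
      qed simp
      moreover have "[:0, 1:] dvd phi (gen_replace G0 w :: 'k mpoly)"
        unfolding R(4)[of gen_mat] phi_det using R f G0 by (intro det_degen_dvd) auto
      then have "[:0, 1:] dvd (\<Prod>j\<in>G0. phi (gen_replace G0 j :: 'k mpoly))"
        using dvd_prodI[OF G(1) w0(2), of "\<lambda>j. phi (gen_replace G0 j :: 'k mpoly)"] dvd_trans by blast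
      ultimately have "[:0, 1:] ^ 2 * [:0, 1:] dvd phi (den G0)"
        unfolding den_def phi.hom_mult phi.hom_prod by (rule mult_dvd_mono)
      then show ?thesis by (simp only: power_Suc mult.commute)
    qed
    show "Polynomial.coeff (phi (\<Sum>j\<in>G0. gen_replace G0 j :: 'k mpoly)) 0 \<noteq> 0"
    \<comment> \<open>Keep the summand in which \<open>f\<close> is replaced by 0;
      \<open>p = f\<close> annihilates the others, and \<open>w\<close> is sent to \<open>i\<close>,
      which is free there.\<close>
    proof (rule coeff_0_sum_gen_replace[OF G(1-3) w0(3) refl])
      note R = replace_list[OF G(1) w0(3) G(3)]
      have i0: "i \<noteq> 0" "f \<noteq> 0" using G0 F0 f by auto
      show "distinct (target f i (replace_list G0 f))"
        using R i0 G0 f unfolding target_def distinct_map by (auto simp: inj_on_def)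
      show "f \<notin> set (replace_list G0 f)" using R i0 by auto
      show "i \<noteq> w \<and> i \<in> F - {f}" if "w \<in> set (replace_list G0 f)"
        using G0 f by auto
      show "det_cols (spec_mat f i (replace_list G0 f)) L = (0 :: 'k poly)"
        if "length L = length (replace_list G0 f)" "f \<in> set L" for L
        using that by (intro spec_mat_column_zero(1)) auto
    qed
    fix X :: "nat list" assume X: "distinct X" "length X = d" "set X \<noteq> F"
    let ?goal = "phi (det_cols gen_mat X :: 'k mpoly) \<noteq> 0
        \<and> order 0 (phi (det_cols gen_mat X :: 'k mpoly)) \<le> ?E (set X)"
    have cX: "card (set X) = d" using X distinct_card by auto
    have *: ?goal if "inj_on (id(f := p, w := q)) (set X)" "f \<in> set X \<Longrightarrow> p \<in> F - {f}"
      "w \<in> set X \<Longrightarrow> q = w \<or> q \<in> F - {f}"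
      "f \<in> set X \<and> p = i \<Longrightarrow> F - {i} \<subseteq> set X"
      "w \<in> set X \<and> q = w \<Longrightarrow> set X \<subseteq> insert w F" for p q
      using that X by (intro order_phi_det[of p q]) (auto simp: target_def distinct_map)
    have noti: "i \<notin> set X" if "F - {i} \<subseteq> set X"
    proof
      assume "i \<in> set X"
      then have "F \<subseteq> set X" using that by auto
      then show False using X(3) cX F(2) card_subset_eq[of "set X" F] by auto
    qed
    consider "f \<notin> set X" "w \<notin> set X" | "f \<notin> set X" "w \<in> set X" "F - {f} \<subseteq> set X"
      | "f \<notin> set X" "w \<in> set X" "\<not> F - {f} \<subseteq> set X"
      | "f \<in> set X" "w \<notin> set X" "F - {i} \<subseteq> set X" | "f \<in> set X" "w \<notin> set X" "\<not> F - {i} \<subseteq> set X"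
      | "f \<in> set X" "w \<in> set X" "F - {i} \<subseteq> set X" | "f \<in> set X" "w \<in> set X" "\<not> F - {i} \<subseteq> set X"
      by blast
    then show ?goal
    proof cases
      case 1
      then show ?thesis by (intro *[of f w]) (auto simp: inj_on_def)
    next
      case 2
      have "card (insert w (F - {f})) = d" using F f finF G0 d by simp
      moreover have "insert w (F - {f}) \<subseteq> set X" using 2 by auto
      ultimately have "insert w (F - {f}) = set X" using cX by (intro card_subset_eq) auto
      then show ?thesis using 2 by (intro *[of f w]) (auto simp: inj_on_def)
    next
      case 3
      then obtain q where "q \<in> F - {f}" "q \<notin> set X" by blast
      then show ?thesis using 3 G0 by (intro *[of f q]) (auto simp: inj_on_def)
    next
      case 4
      then show ?thesis using noti G0 f by (intro *[of i w]) (auto simp: inj_on_def)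
    next
      case 5
      then obtain p where "p \<in> F - {f}" "p \<notin> set X" "p \<noteq> i" by blast
      then show ?thesis using 5 by (intro *[of p w]) (auto simp: inj_on_def)
    next
      case 6
      have "G0 \<subseteq> set X" using 6 G0 by auto
      then have "G0 = set X" using cX G by (intro card_subset_eq) auto
      then have "set X \<subseteq> insert w F" using G0 by auto
      then show ?thesis using 6 noti G0 f by (intro *[of i w]) (auto simp: inj_on_def)
    next
      case 7
      then obtain p where p: "p \<in> F - {f}" "p \<notin> set X" "p \<noteq> i" by blast
      show ?thesis
      proof (cases "\<exists>q. q \<in> F - {f} \<and> q \<notin> set X \<and> q \<noteq> p")
        case True
        then obtain q where "q \<in> F - {f}" "q \<notin> set X" "q \<noteq> p" by blast
        then show ?thesis using 7 p G0 by (intro *[of p q]) (auto simp: inj_on_def)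
      next
        \<comment> \<open>With only one vertex free, \<open>p\<close> takes it; the list is then
          \<open>insert w (F - {p})\<close>, where \<open>?E\<close> allows for keeping
          \<open>w\<close>.\<close>
        case False
        have "card (insert w (F - {p})) = d" using F p finF G0 d by simp
        moreover have "insert w (F - {p}) \<subseteq> set X" using False 7 by auto
        ultimately have "insert w (F - {p}) = set X" using cX by (intro card_subset_eq) auto
        then have "set X \<subseteq> insert w F" by auto
        then show ?thesis using 7 p G0 by (intro *[of p w]) (auto simp: inj_on_def)
      qed
    qed
  qed auto
qed

lemma ord_deg_ell_pow_nonface:
  assumes F: "F \<subseteq> {1..n}" "card F = d" "F \<notin> \<Delta>"
  shows "ord (bracket d F) (deg_ell_pow TYPE('k) \<Delta> n d ori) = 0"
proof -
  have fin: "finite F" "F \<noteq> {}" using F finite_subset d by auto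
  define P where "P = (det_set gen_mat F :: 'k mpoly)"
  have P: "prime_elem P" using fin unfolding P_def by (intro prime_elem_det_set)
  have h: "\<not> P dvd (\<Prod>G\<in>facets. den G)"
    using P F facetD unfolding P_def by (intro prime_not_dvd_prod det_set_not_dvd_den) auto
  have g: "\<not> P dvd (\<Sum>G\<in>facets. num G * (\<Prod>H\<in>facets - {G}. den H))"
  proof (cases "\<exists>G\<in>facets. card (F \<inter> G) \<le> d - 2")
    case True
    then show ?thesis using not_dvd_far[OF F] by (auto simp: P_def)
  next
    \<comment> \<open>If no facet is far from \<open>F\<close>, an arbitrary facet shares exactly
      \<open>d - 1\<close> vertices with it.\<close>
    case False
    obtain G where "G \<in> \<Delta>" "card G = d" using ex_facet by auto
    then have G: "G \<in> facets" "card G = d" "finite G" "G \<noteq> F" using F face_finite by (auto simp: facets_def)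
    have "card (F \<inter> G) < d"
    proof (rule ccontr)
      assume "\<not> card (F \<inter> G) < d"
      then have "F \<inter> G = F" "F \<inter> G = G" using fin G F by (metis Int_lower1 Int_lower2 card_seteq not_less)+
      then show False using G by simp
    qed
    moreover have "card (F \<inter> G) > d - 2" using False G by (auto simp: not_le)
    ultimately have c: "card (F \<inter> G) = d - 1" using d by auto
    have "card (F - G) = 1" "card (G - F) = 1"
      using card_Diff_subset_Int[of F G] card_Diff_subset_Int[of G F] c F G fin d by (auto simp: Int_commute)
    then obtain i w where "F - G = {i}" "G - F = {w}" by (auto simp: card_1_singleton_iff)
    then have "G = insert w (F - {i})" "i \<in> F" "w \<notin> F" by blast+
    then show ?thesis using not_dvd_near[OF F G(1)] by (simp add: P_def)
  qed
  show ?thesis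
    using ord_eqI[OF P g h, of 0] fin F by (simp add: deg_ell_pow_eq bracket_eq_det_cols P_def)
qed

end

theorem theorem1p4:
  fixes \<Delta> :: "nat set set" and n d :: nat and ori :: "nat set \<Rightarrow> nat list"
  assumes "d \<ge> 2"
    and "homology_manifold TYPE('k::field) \<Delta> {1..n} d"
    and "CHAR('k) \<noteq> 2 \<longrightarrow> oriented \<Delta> d ori"
  shows "deg_ell_pow TYPE('k) \<Delta> n d ori \<noteq> 0 \<and>
    (\<forall>F. F \<subseteq> {1..n} \<and> card F = d \<longrightarrow>
       ord (bracket d F) (deg_ell_pow TYPE('k) \<Delta> n d ori) = (if facet \<Delta> F then -1 else 0))"
proof -
  interpret oriented_manifold "TYPE('k)" \<Delta> n d ori
    by unfold_locales (use assms in auto)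
  obtain F where "F \<in> facets" using ex_facet by (auto simp: facets_def)
  then have "deg_ell_pow TYPE('k) \<Delta> n d ori \<noteq> 0" by (rule ord_deg_ell_pow_facet)
  moreover have "ord (bracket d F) (deg_ell_pow TYPE('k) \<Delta> n d ori) = (if facet \<Delta> F then -1 else 0)"
    if "F \<subseteq> {1..n}" "card F = d" for F
    using ord_deg_ell_pow_facet(1)[of F] ord_deg_ell_pow_nonface[of F] that by (auto simp: facet_iff facets_def)
  ultimately show ?thesis by blast
qed

end
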